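(* Let $\mathbb{K}$ be an algebraically closed field containing $\mathbb{F}_q$, and let $\mathsf{M}$ be a pure Anderson $t$-motive over $\mathbb{K}$ of $\mathbb{K}\{\tau\}$-rank $d$. Then there exists a $\mathbb{K}\{\tau\}$-basis $\{\kappa_1,\ldots,\kappa_d\}$ of $\mathsf{M}$ such that $\mathsf{M}$ is almost strictly pure with respect to $\{\kappa_1,\ldots,\kappa_d\}$. In addition, the $\mathbb{K}\{\tau\}$-basis can be chosen such that $\mathsf{M}$ is strictly pure with respect to it if and only if the reciprocal of the weight of $\mathsf{M}$ is an integer.
   Context: $\mathbb{F}_q$ is the finite field with $q$ elements, $\mathbb{K}$ is an algebraically closed field containing $\mathbb{F}_q$, and $\theta\in\mathbb{K}$ is a fixed element. $\mathbb{K}\{\tau\}$ is the skew polynomial ring with $\tau\alpha=\alpha^q\tau$ for $\alpha\in\mathbb{K}$; $\mathbb{K}\{\tau,t\}$ is the skew polynomial ring in $\tau,t$ with in addition $t\alpha=\alpha t$ for $\alpha\in\mathbb{K}$, and $t\tau=\tau t$. It contains $\mathbb{K}\{\tau\}$ and the commutative polynomial ring $\mathbb{K}[t]$. An (abelian) Anderson $t$-motive over $\mathbb{K}$ is a (nonzero) left $\mathbb{K}\{\tau,t\}$-module $\mathsf{M}$ which is free of finite rank over $\mathbb{K}\{\tau\}$ and free of finite rank over $\mathbb{K}[t]$, and such that $\mathsf{M}/(\mathbb{K}\{\tau\}\tau\mathsf{M})$ is annihilated by a power of $t-\theta$. Purity: $\mathbb{K}(\!(\frac1t)\!)\otimes_{\mathbb{K}[t]}\mathsf{M}$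 carries the $\tau$-action $\tau(f\otimes m)=f^{(1)}\otimes\tau m$, where $f^{(1)}$ is obtained from $f$ by raising all coefficients to the $q$-th power. $\mathsf{M}$ is pure if there are positive integers $u,v$ and a $\mathbb{K}[\![\frac1t]\!]$-lattice $\tilde\Lambda$ (the $\mathbb{K}[\![\frac1t]\!]$-span of a $\mathbb{K}(\!(\frac1t)\!)$-basis) in $\mathbb{K}(\!(\frac1t)\!)\otimes_{\mathbb{K}[t]}\mathsf{M}$ such that $t^u\tilde\Lambda=\tau^v\tilde\Lambda$. The weight of $\mathsf{M}$ is then $u/v$. $\mathsf{M}$ is almost strictly pure with respect to a $\mathbb{K}\{\tau\}$-basis $\{\kappa_1,\dots,\kappa_d\}$ if for some integer $n\ge 1$ one has $t^n(\kappa_1,\dots,\kappa_d)^{\mathrm{tr}}=D\,(\kappa_1,\dots,\kappa_d)^{\mathrm{tr}}$ with $D=D_0+D_1\tau+\cdots+D_s\tau^s$, all $D_j\in\mathrm{Mat}_d(\mathbb{K})$ and $D_s\in\mathrm{GL}_d(\mathbb{K})$. It is strictly pure with respect to this basis if this holds with $n=1$. *)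

theory Defs
  imports
    "HOL-Computational_Algebra.Computational_Algebra"
    "HOL-Library.Poly_Mapping"
    "Jordan_Normal_Form.Matrix"
begin

definition finite_subfield :: "'k::field set \<Rightarrow> bool" where
  "finite_subfield F \<longleftrightarrow> finite F \<and> 0 \<in> F \<and> 1 \<in> F \<and>
     (\<forall>x\<in>F. \<forall>y\<in>F. x + y \<in> F \<and> x * y \<in> F) \<and>
     (\<forall>x\<in>F. - x \<in> F \<and> inverse x \<in> F)"


section \<open>The skew polynomial ring in \<open>\<tau>\<close> and \<open>t\<close>\<close>

text \<open>
  An element of \<open>K{\<tau>,t}\<close> is stored by its coefficients: \<open>single (i, j) a\<close> is the monomial
  \<open>a \<tau>\<^sup>i t\<^sup>j\<close>.  Addition is that of the type, but the ring multiplication is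
  \<open>skew_times\<close>, not the \<open>(*)\<close> (commutative convolution) of the type.
\<close>

type_synonym 'k skew = "nat \<times> nat \<Rightarrow>\<^sub>0 'k"

definition skew_times :: "nat \<Rightarrow> 'k::field skew \<Rightarrow> 'k skew \<Rightarrow> 'k skew" where
  "skew_times q f g =
     (\<Sum>a\<in>Poly_Mapping.keys f. \<Sum>b\<in>Poly_Mapping.keys g.
        Poly_Mapping.single (fst a + fst b, snd a + snd b)
          (Poly_Mapping.lookup f a * Poly_Mapping.lookup g b ^ (q ^ fst a)))"

definition skew_one :: "'k::field skew" where
  "skew_one = Poly_Mapping.single (0, 0) 1"

definition skew_tau :: "'k::field skew" where
  "skew_tau = Poly_Mapping.single (1, 0) 1"

lemma skew_times_single:
  assumes "q > 0"
  shows "skew_times q (Poly_Mapping.single (i, j) a) (Poly_Mapping.single (k, l) b) =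
           Poly_Mapping.single (i + k, j + l) (a * b ^ (q ^ i))"
  using assms by (cases "b = 0"; cases "a = 0") (simp_all add: skew_times_def zero_power)

lemma skew_tau_times_const:
  assumes "q > 0"
  shows "skew_times q skew_tau (Poly_Mapping.single (0, 0) a) =
           skew_times q (Poly_Mapping.single (0, 0) (a ^ q)) skew_tau"
  by (simp add: skew_tau_def skew_times_single[OF assms])

text \<open>The subrings \<open>K{\<tau>}\<close> and \<open>K[t]\<close>.\<close>

definition tau_subring :: "'k::field skew set" where
  "tau_subring = {f. Poly_Mapping.keys f \<subseteq> UNIV \<times> {0}}"

definition poly_to_skew :: "'k::field poly \<Rightarrow> 'k skew" where
  "poly_to_skew p = (\<Sum>j\<le>degree p. Poly_Mapping.single (0, j) (coeff p j))"

definition t_subring :: "'k::field skew set" where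
  "t_subring = range poly_to_skew"


section \<open>Abelian Anderson \<open>t\<close>-motives\<close>

locale skew_module =
  fixes q :: nat and act :: "'k::field skew \<Rightarrow> 'm::ab_group_add \<Rightarrow> 'm"
  assumes act_add_left: "act (f + g) x = act f x + act g x"
    and act_add_right: "act f (x + y) = act f x + act f y"
    and act_times: "act (skew_times q f g) x = act f (act g x)"
    and act_one: "act skew_one x = x"

definition is_basis_over ::
    "'k::field skew set \<Rightarrow> ('k skew \<Rightarrow> 'm::ab_group_add \<Rightarrow> 'm) \<Rightarrow> nat \<Rightarrow> (nat \<Rightarrow> 'm) \<Rightarrow> bool" where
  "is_basis_over S act n b \<longleftrightarrow>
     (\<forall>x. \<exists>c. (\<forall>i<n. c i \<in> S) \<and> x = (\<Sum>i<n. act (c i) (b i))) \<and>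
     (\<forall>c. (\<forall>i<n. c i \<in> S) \<and> (\<Sum>i<n. act (c i) (b i)) = 0 \<longrightarrow> (\<forall>i<n. c i = 0))"

definition free_of_rank ::
    "'k::field skew set \<Rightarrow> ('k skew \<Rightarrow> 'm::ab_group_add \<Rightarrow> 'm) \<Rightarrow> nat \<Rightarrow> bool" where
  "free_of_rank S act n \<longleftrightarrow> (\<exists>b. is_basis_over S act n b)"

text \<open>The \<open>K{\<tau>}\<close>-submodule generated by \<open>\<tau>M\<close>.\<close>

definition tau_image :: "('k::field skew \<Rightarrow> 'm::ab_group_add \<Rightarrow> 'm) \<Rightarrow> 'm set" where
  "tau_image act =
     {\<Sum>i<n. act (f i) (act skew_tau (x i)) | n f x. \<forall>i<(n::nat). f i \<in> tau_subring}"

definition anderson_t_motive ::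
    "nat \<Rightarrow> 'k::field \<Rightarrow> ('k skew \<Rightarrow> 'm::ab_group_add \<Rightarrow> 'm) \<Rightarrow> bool" where
  "anderson_t_motive q \<theta> act \<longleftrightarrow>
     skew_module q act \<and>
     (\<exists>x::'m. x \<noteq> 0) \<and>
     (\<exists>d. free_of_rank tau_subring act d) \<and>
     (\<exists>r. free_of_rank t_subring act r) \<and>
     (\<exists>N. \<forall>x. act (poly_to_skew ([:- \<theta>, 1:] ^ N)) x \<in> tau_image act)"


section \<open>Tensor products\<close>

text \<open>
  The tensor product of \<open>A\<close> (with scalar action \<open>ra\<close>) and \<open>M\<close> (with scalar action \<open>la\<close>) is the
  quotient of the free abelian group on pairs, \<open>('a \<times> 'm) \<Rightarrow>\<^sub>0 int\<close>, by the subgroup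
  \<open>tensor_null\<close>; the pure tensor of \<open>a\<close> and \<open>m\<close> is the class of \<open>frag_of (a, m)\<close>.
\<close>

inductive_set tensor_null ::
    "('a::ab_group_add \<Rightarrow> 'r \<Rightarrow> 'a) \<Rightarrow> ('r \<Rightarrow> 'm::ab_group_add \<Rightarrow> 'm) \<Rightarrow> ('a \<times> 'm \<Rightarrow>\<^sub>0 int) set"
  for ra la where
    zero: "0 \<in> tensor_null ra la"
  | diff: "x \<in> tensor_null ra la \<Longrightarrow> y \<in> tensor_null ra la \<Longrightarrow> x - y \<in> tensor_null ra la"
  | add_left: "frag_of (a + b, m) - frag_of (a, m) - frag_of (b, m) \<in> tensor_null ra la"
  | add_right: "frag_of (a, m + n) - frag_of (a, m) - frag_of (a, n) \<in> tensor_null ra la"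
  | balanced: "frag_of (ra a r, m) - frag_of (a, la r m) \<in> tensor_null ra la"

definition tensor_rel ::
    "('a::ab_group_add \<Rightarrow> 'r \<Rightarrow> 'a) \<Rightarrow> ('r \<Rightarrow> 'm::ab_group_add \<Rightarrow> 'm) \<Rightarrow> ('a \<times> 'm \<Rightarrow>\<^sub>0 int) rel" where
  "tensor_rel ra la = {(x, y). x - y \<in> tensor_null ra la}"

lemma equiv_tensor_rel: "equiv UNIV (tensor_rel ra la)"
proof (rule equivI)
  show "refl (tensor_rel ra la)"
    by (auto simp: tensor_rel_def refl_on_def intro: tensor_null.zero)
  show "sym (tensor_rel ra la)"
  proof (rule symI)
    fix x y assume "(x, y) \<in> tensor_rel ra la"
    then have "0 - (x - y) \<in> tensor_null ra la"
      by (intro tensor_null.diff[OF tensor_null.zero]) (simp add: tensor_rel_def)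
    then show "(y, x) \<in> tensor_rel ra la" by (simp add: tensor_rel_def)
  qed
  show "trans (tensor_rel ra la)"
  proof (rule transI)
    fix x y z assume xy: "(x, y) \<in> tensor_rel ra la" and yz: "(y, z) \<in> tensor_rel ra la"
    have "(x - y) - ((0 - (y - z))) \<in> tensor_null ra la"
      using xy yz
      by (intro tensor_null.diff[of "x - y"] tensor_null.diff[of 0] tensor_null.zero)
        (simp_all add: tensor_rel_def)
    then show "(x, z) \<in> tensor_rel ra la" by (simp add: tensor_rel_def)
  qed
qed auto


section \<open>The completion of a motive at infinity\<close>

text \<open>
  In \<open>'k fls\<close> the variable \<open>fls_X\<close> stands for \<open>1/t\<close>, so that \<open>'k fls\<close> is \<open>K((1/t))\<close>,
  \<open>range fps_to_fls\<close> is \<open>K[[1/t]]\<close>, and \<open>t\<close> is \<open>fls_X_inv\<close>.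
\<close>

definition poly_to_laurent :: "'k::field poly \<Rightarrow> 'k fls" where
  "poly_to_laurent p = poly (map_poly fls_const p) fls_X_inv"

definition laurent_twist :: "nat \<Rightarrow> 'k::field fls \<Rightarrow> 'k fls" where
  "laurent_twist q f = Abs_fls (\<lambda>n. fls_nth f n ^ q)"

lemma fls_nth_laurent_twist:
  assumes "q > 0"
  shows "fls_nth (laurent_twist q f) n = fls_nth f n ^ q"
  unfolding laurent_twist_def
  by (rule nth_Abs_fls_ex_lower_bound)
     (use assms in \<open>auto intro!: exI[of _ "fls_subdegree f"]\<close>)

definition completion_rel ::
    "('k::field skew \<Rightarrow> 'm::ab_group_add \<Rightarrow> 'm) \<Rightarrow> ('k fls \<times> 'm \<Rightarrow>\<^sub>0 int) rel" where
  "completion_rel act =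
     tensor_rel (\<lambda>f p. f * poly_to_laurent p) (\<lambda>p. act (poly_to_skew p))"

text \<open>The tensor product of \<open>K((1/t))\<close> and \<open>M\<close> over \<open>K[t]\<close>.\<close>

definition completion ::
    "('k::field skew \<Rightarrow> 'm::ab_group_add \<Rightarrow> 'm) \<Rightarrow> ('k fls \<times> 'm \<Rightarrow>\<^sub>0 int) set set" where
  "completion act = UNIV // completion_rel act"

definition completion_zero ::
    "('k::field skew \<Rightarrow> 'm::ab_group_add \<Rightarrow> 'm) \<Rightarrow> ('k fls \<times> 'm \<Rightarrow>\<^sub>0 int) set" where
  "completion_zero act = completion_rel act `` {0}"

definition completion_add ::
    "('k::field skew \<Rightarrow> 'm::ab_group_add \<Rightarrow> 'm) \<Rightarrow> ('k fls \<times> 'm \<Rightarrow>\<^sub>0 int) set \<Rightarrow>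
      ('k fls \<times> 'm \<Rightarrow>\<^sub>0 int) set \<Rightarrow> ('k fls \<times> 'm \<Rightarrow>\<^sub>0 int) set" where
  "completion_add act X Y = (\<Union>x\<in>X. \<Union>y\<in>Y. completion_rel act `` {x + y})"

text \<open>The additive map on classes given on pure tensors by a map of pairs.\<close>

definition completion_map ::
    "('k::field skew \<Rightarrow> 'm::ab_group_add \<Rightarrow> 'm) \<Rightarrow> ('k fls \<times> 'm \<Rightarrow> 'k fls \<times> 'm) \<Rightarrow>
      ('k fls \<times> 'm \<Rightarrow>\<^sub>0 int) set \<Rightarrow> ('k fls \<times> 'm \<Rightarrow>\<^sub>0 int) set" where
  "completion_map act h X =
     (\<Union>x\<in>X. completion_rel act `` {frag_extend (\<lambda>p. frag_of (h p)) x})"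

definition completion_scale ::
    "('k::field skew \<Rightarrow> 'm::ab_group_add \<Rightarrow> 'm) \<Rightarrow> 'k fls \<Rightarrow>
      ('k fls \<times> 'm \<Rightarrow>\<^sub>0 int) set \<Rightarrow> ('k fls \<times> 'm \<Rightarrow>\<^sub>0 int) set" where
  "completion_scale act g = completion_map act (\<lambda>(f, m). (g * f, m))"

definition completion_tau ::
    "nat \<Rightarrow> ('k::field skew \<Rightarrow> 'm::ab_group_add \<Rightarrow> 'm) \<Rightarrow>
      ('k fls \<times> 'm \<Rightarrow>\<^sub>0 int) set \<Rightarrow> ('k fls \<times> 'm \<Rightarrow>\<^sub>0 int) set" where
  "completion_tau q act = completion_map act (\<lambda>(f, m). (laurent_twist q f, act skew_tau m))"

lemma completion_scale_class:
  "completion_scale act g (completion_rel act `` {x}) =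
     completion_rel act `` {frag_extend (\<lambda>p. frag_of (case p of (f, m) \<Rightarrow> (g * f, m))) x}"
proof -
  let ?N = "tensor_null (\<lambda>f p. f * poly_to_laurent p) (\<lambda>p. act (poly_to_skew p))"
  let ?E = "frag_extend (\<lambda>p. frag_of (case p of (f, m) \<Rightarrow> (g * f, m)))"
  have E: "?E z \<in> ?N" if "z \<in> ?N" for z
    using that
  proof induction
    case (add_left a b m)
    show ?case
      using tensor_null.add_left[of "g * a" "g * b" m]
      by (simp add: frag_extend_diff distrib_left)
  next
    case (add_right a m n)
    show ?case
      using tensor_null.add_right[of "g * a" m n] by (simp add: frag_extend_diff)
  next
    case (balanced a r m)
    show ?case
      using tensor_null.balanced[of "\<lambda>f p. f * poly_to_laurent p" "g * a" r m]
      by (simp add: frag_extend_diff mult.assoc)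
  qed (simp_all add: tensor_null.zero tensor_null.diff frag_extend_diff)
  have "(\<lambda>y. completion_rel act `` {?E y}) respects completion_rel act"
  proof (rule congruentI)
    fix y z assume "(y, z) \<in> completion_rel act"
    then have "(?E y, ?E z) \<in> completion_rel act"
      using E[of "y - z"] by (simp add: completion_rel_def tensor_rel_def frag_extend_diff)
    then show "completion_rel act `` {?E y} = completion_rel act `` {?E z}"
      unfolding completion_rel_def by (rule equiv_class_eq[OF equiv_tensor_rel])
  qed
  moreover have "equiv UNIV (completion_rel act)"
    by (simp add: completion_rel_def equiv_tensor_rel)
  ultimately show ?thesis
    unfolding completion_scale_def completion_map_def
    by (intro UN_equiv_class) auto
qed

primrec completion_lincomb ::
    "('k::field skew \<Rightarrow> 'm::ab_group_add \<Rightarrow> 'm) \<Rightarrow> (nat \<Rightarrow> 'k fls) \<Rightarrow>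
      (nat \<Rightarrow> ('k fls \<times> 'm \<Rightarrow>\<^sub>0 int) set) \<Rightarrow> nat \<Rightarrow> ('k fls \<times> 'm \<Rightarrow>\<^sub>0 int) set" where
  "completion_lincomb act c b 0 = completion_zero act"
| "completion_lincomb act c b (Suc n) =
     completion_add act (completion_lincomb act c b n) (completion_scale act (c n) (b n))"

definition completion_basis ::
    "('k::field skew \<Rightarrow> 'm::ab_group_add \<Rightarrow> 'm) \<Rightarrow> nat \<Rightarrow>
      (nat \<Rightarrow> ('k fls \<times> 'm \<Rightarrow>\<^sub>0 int) set) \<Rightarrow> bool" where
  "completion_basis act n b \<longleftrightarrow>
     (\<forall>i<n. b i \<in> completion act) \<and>
     (\<forall>X\<in>completion act. \<exists>c. X = completion_lincomb act c b n) \<and>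
     (\<forall>c. completion_lincomb act c b n = completion_zero act \<longrightarrow> (\<forall>i<n. c i = 0))"

definition is_lattice ::
    "('k::field skew \<Rightarrow> 'm::ab_group_add \<Rightarrow> 'm) \<Rightarrow> ('k fls \<times> 'm \<Rightarrow>\<^sub>0 int) set set \<Rightarrow> bool" where
  "is_lattice act L \<longleftrightarrow>
     (\<exists>n b. completion_basis act n b \<and>
        L = {completion_lincomb act c b n | c. \<forall>i<n. c i \<in> range fps_to_fls})"


section \<open>Purity\<close>

definition purity_exponents ::
    "nat \<Rightarrow> ('k::field skew \<Rightarrow> 'm::ab_group_add \<Rightarrow> 'm) \<Rightarrow> nat \<Rightarrow> nat \<Rightarrow> bool" where
  "purity_exponents q act u v \<longleftrightarrow>
     u > 0 \<and> v > 0 \<and>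
     (\<exists>L. is_lattice act L \<and>
        completion_scale act (fls_X_inv ^ u) ` L = (completion_tau q act ^^ v) ` L)"

definition pure_motive :: "nat \<Rightarrow> ('k::field skew \<Rightarrow> 'm::ab_group_add \<Rightarrow> 'm) \<Rightarrow> bool" where
  "pure_motive q act \<longleftrightarrow> (\<exists>u v. purity_exponents q act u v)"

text \<open>Different exponents of the same pure motive have the same quotient.\<close>

definition motive_weight :: "nat \<Rightarrow> ('k::field skew \<Rightarrow> 'm::ab_group_add \<Rightarrow> 'm) \<Rightarrow> rat" where
  "motive_weight q act =
     (THE w. \<exists>u v. purity_exponents q act u v \<and> w = of_nat u / of_nat v)"

text \<open>
  The equation \<open>t\<^sup>n \<kappa> = D \<kappa>\<close> with \<open>D = D\<^sub>0 + D\<^sub>1 \<tau> + \<dots> + D\<^sub>s \<tau>\<^sup>s\<close>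
  and \<open>D\<^sub>s\<close> invertible.
\<close>

definition strict_purity_equation ::
    "('k::field skew \<Rightarrow> 'm::ab_group_add \<Rightarrow> 'm) \<Rightarrow> nat \<Rightarrow> (nat \<Rightarrow> 'm) \<Rightarrow> nat \<Rightarrow> bool" where
  "strict_purity_equation act d \<kappa> n \<longleftrightarrow>
     (\<exists>s (D :: nat \<Rightarrow> 'k mat).
        (\<forall>j\<le>s. D j \<in> carrier_mat d d) \<and> invertible_mat (D s) \<and>
        (\<forall>i<d. act (Poly_Mapping.single (0, n) 1) (\<kappa> i) =
           (\<Sum>k<d. act (\<Sum>j\<le>s. Poly_Mapping.single (j, 0) (index_mat (D j) (i, k))) (\<kappa> k))))"

definition almost_strictly_pure ::
    "('k::field skew \<Rightarrow> 'm::ab_group_add \<Rightarrow> 'm) \<Rightarrow> nat \<Rightarrow> (nat \<Rightarrow> 'm) \<Rightarrow> bool" where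
  "almost_strictly_pure act d \<kappa> \<longleftrightarrow> (\<exists>n\<ge>1. strict_purity_equation act d \<kappa> n)"

definition strictly_pure ::
    "('k::field skew \<Rightarrow> 'm::ab_group_add \<Rightarrow> 'm) \<Rightarrow> nat \<Rightarrow> (nat \<Rightarrow> 'm) \<Rightarrow> bool" where
  "strictly_pure act d \<kappa> \<longleftrightarrow> strict_purity_equation act d \<kappa> 1"

end

theory Submission
  imports Defs "Jordan_Normal_Form.Determinant"
begin

text \<open>
  The proof replaces the lattice of a pure motive \<open>M\<close> by a \<^emph>\<open>degree filtration\<close>: an increasing
  exhaustive family of \<open>K\<close>-subspaces \<open>F\<^sub>j\<close> of \<open>M\<close> with \<open>F\<^sub>j = 0\<close> for \<open>j < 0\<close> for which \<open>\<tau>\<close> raises the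
  degree by exactly \<open>1\<close> and \<open>t\<^sup>n\<close> raises it by exactly \<open>s\<close>.

  \<^emph>\<open>From purity to a filtration.\<close>  Let \<open>t\<^sup>u \<Lambda> = \<tau>\<^sup>v \<Lambda>\<close>.  The elements of \<open>M\<close> lying in \<open>t\<^sup>c \<Lambda>\<close> form subspaces
  \<open>E\<^sub>c\<close> on which \<open>t\<close> raises the index by \<open>1\<close> and \<open>\<tau>\<^sup>v\<close> raises it by \<open>u\<close>; they vanish for small \<open>c\<close>,
  because the coordinates with respect to a \<open>K[t]\<close>-basis of \<open>M\<close> extend to the completion.  Calling \<open>x\<close>
  of degree at most \<open>j\<close> if every \<open>\<tau>\<^sup>b x\<close> lies in all \<open>E\<^sub>c\<close> with \<open>u (b + j) \<le> v c\<close> refines this to a degree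
  filtration for every pair \<open>(n, s)\<close> with \<open>n v = s u\<close>: always for \<open>(u, v)\<close>, and for \<open>(1, v / u)\<close> when
  \<open>v / u\<close> is an integer (\<open>purity_exponents_imp_degree_filtration\<close>).

  \<^emph>\<open>From a filtration to a basis.\<close>  If \<open>M\<close> is generated by \<open>F\<^sub>0\<close> in the sense that
  \<open>F\<^sub>j = \<tau>\<^sup>j F\<^sub>0 + F\<^bsub>j-1\<^esub>\<close> for all \<open>j \<ge> 0\<close>, then a \<open>K\<close>-basis of \<open>F\<^sub>0\<close> is a \<open>K{\<tau>}\<close>-basis of \<open>M\<close>.  As \<open>t\<^sup>n\<close> maps
  \<open>F\<^sub>0\<close> into \<open>F\<^sub>s\<close> and no nonzero element of it into \<open>F\<^bsub>s-1\<^esub>\<close>, the leading matrix \<open>D\<^sub>s\<close> is then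
  invertible.  This condition holds for a filtration that is \<^emph>\<open>maximal\<close> among all degree filtrations
  for \<open>(n, s)\<close>, and these exist by Zorn's lemma.  Indeed, let \<open>G\<^sub>j = F\<^sub>j / F\<^bsub>j-1\<^esub>\<close>.  For large \<open>N\<close> the map
  \<open>t\<^sup>n : G\<^sub>N \<rightarrow> G\<^bsub>N+s\<^esub>\<close> is bijective, since \<open>M / t\<^sup>n M\<close> has finite dimension.  So \<open>t\<^bsup>-n\<^esup> \<tau>\<^sup>s\<close> is a
  Frobenius-semilinear injection of \<open>G\<^sub>N\<close> into itself, and as \<open>K\<close> is algebraically closed its fixed
  vectors span \<open>G\<^sub>N\<close> (a form of Lang's theorem, \<open>frobenius_fixed_vectors_span\<close>).  If a fixed vector
  \<open>g\<close> were not in the image of \<open>\<tau>\<^sup>N F\<^sub>0\<close>, one could lower the degree of all elements with leading term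
  proportional to that of \<open>g\<close> by one and still have nothing in negative degrees; the filtration would
  not be maximal.  Hence \<open>G\<^sub>N = \<tau>\<^sup>N G\<^sub>0\<close> for large \<open>N\<close>, and then for all \<open>N\<close>.

  \<^emph>\<open>Uniqueness of the slope.\<close>  Conversely an equation \<open>t\<^sup>n \<kappa> = D \<kappa>\<close> with invertible leading matrix
  of degree \<open>s\<close> makes the degree in \<open>\<tau>\<close> a degree filtration for \<open>(n, s)\<close>.  Any two degree filtrations
  differ by a bounded shift, so all of them have the same ratio \<open>n / s\<close>
  (\<open>filtration_slope_unique\<close>).  This shows that the weight \<open>u / v\<close> is well defined, and that strict
  purity with \<open>D\<close> of degree \<open>s\<close> forces the weight to be \<open>1 / s\<close>.
\<close>

section \<open>Frobenius-type equations over an algebraically closed field\<close>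

text \<open>
  The recursion expresses that \<open>\<Sum>c\<^sub>i v\<^sub>i\<close> is fixed by a semilinear map sending each \<open>v\<^sub>i\<close> to \<open>v\<^bsub>i+1\<^esub>\<close>, where
  \<open>v\<^bsub>l+1\<^esub> = \<Sum>a\<^sub>i v\<^sub>i\<close>.  Eliminating all \<open>c\<^sub>i\<close> leaves one equation \<open>P(z) = z\<close> with \<open>P\<close> nonzero and divisible
  by \<open>X\<^sup>Q\<close>; its root \<open>0\<close> is simple and another root remains.
\<close>

lemma twisted_recursion_solvable:
  fixes a :: "nat \<Rightarrow> 'k::alg_closed_field"
  assumes Q: "2 \<le> Q" and a: "i \<le> l" "a i \<noteq> 0"
  shows "\<exists>c z. z \<noteq> 0 \<and> c 0 = z ^ Q * a 0 \<and>
           (\<forall>i<l. c (Suc i) = c i ^ Q + z ^ Q * a (Suc i)) \<and> c l = z"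
proof -
  define P where "P = rec_nat (monom (a 0) Q) (\<lambda>i p. p ^ Q + monom (a (Suc i)) Q)"
  have P0: "P 0 = monom (a 0) Q" and PS: "\<And>i. P (Suc i) = P i ^ Q + monom (a (Suc i)) Q"
    by (simp_all add: P_def)
  have mon: "monom c Q = [:c:] * monom 1 Q" for c :: 'k
    by (simp add: smult_monom)
  \<comment> \<open>Each \<open>c\<^sub>i\<close> is the value at \<open>z\<close> of the polynomial \<open>P i\<close>.\<close>
  have dvd: "monom 1 Q dvd P i" for i
  proof (induction i)
    case 0
    show ?case unfolding P0 by (subst mon) (rule dvd_triv_right)
  next
    case (Suc i)
    have "monom 1 Q dvd P i ^ Q"
      using Suc Q by (meson dvd_power dvd_trans less_le_trans pos2)
    moreover have "monom 1 Q dvd monom (a (Suc i)) Q"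
      by (subst mon) (rule dvd_triv_right)
    ultimately show ?case unfolding PS by (rule dvd_add)
  qed
  \<comment> \<open>The term \<open>P i ^ Q\<close>, of degree at least \<open>Q * Q\<close>, cannot be cancelled by a monomial of degree \<open>Q\<close>.\<close>
  have nz: "P i = 0 \<Longrightarrow> j \<le> i \<Longrightarrow> a j = 0" for i j
  proof (induction i)
    case 0
    then show ?case by (simp add: P0)
  next
    case (Suc i)
    have "P i = 0"
    proof (rule ccontr)
      assume ne: "P i \<noteq> 0"
      have dg: "Q \<le> degree (P i)"
        using dvd_imp_degree_le[OF dvd[of i] ne] by (simp add: degree_monom_eq)
      have "P i ^ Q = - monom (a (Suc i)) Q"
        using Suc.prems(1) by (simp add: PS eq_neg_iff_add_eq_0)
      then have "degree (P i ^ Q) \<le> Q"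
        by (simp add: degree_monom_le)
      then have "Q * degree (P i) \<le> Q"
        using ne by (simp add: degree_power_eq)
      moreover have "Q * 2 \<le> Q * degree (P i)"
        using dg Q by (intro mult_le_mono2) linarith
      ultimately show False using Q by linarith
    qed
    moreover from this have "a (Suc i) = 0"
      using Suc.prems(1) Q by (simp add: PS zero_power)
    ultimately show ?case using Suc by (cases "j = Suc i") auto
  qed
  have "P l \<noteq> 0" using nz[of l i] a by blast
  moreover obtain R where R: "P l = monom 1 Q * R" using dvd by blast
  ultimately have "R \<noteq> 0" by auto
  \<comment> \<open>\<open>P l - X = X * S\<close>, and \<open>S\<close> has constant term \<open>-1\<close>, so its roots are nonzero.\<close>
  define S where "S = monom 1 (Q - 1) * R - 1"
  have "degree (monom 1 (Q - 1) * R) = (Q - 1) + degree R"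
    using \<open>R \<noteq> 0\<close> by (subst degree_mult_eq) (simp_all add: degree_monom_eq)
  then have d: "degree (monom 1 (Q - 1) * R) > 0" using Q by simp
  have "degree S = degree (monom 1 (Q - 1) * R)"
  proof -
    have "degree (monom 1 (Q - 1) * R + (- 1)) = degree (monom 1 (Q - 1) * R)"
      using d by (intro degree_add_eq_left) simp
    then show ?thesis by (simp add: S_def)
  qed
  then obtain z where z: "poly S z = 0"
    using alg_closed_imp_poly_has_root[of S] d by auto
  then have zR: "z ^ (Q - 1) * poly R z = 1"
    by (simp add: S_def poly_monom)
  then have z0: "z \<noteq> 0" using Q by (auto simp: power_0_left split: if_splits)
  have "z ^ Q = z * z ^ (Q - 1)" using Q by (cases Q) simp_all
  then have "poly (P l) z = z * (z ^ (Q - 1) * poly R z)"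
    unfolding R by (simp add: poly_monom)
  then have "poly (P l) z = z" using zR by simp
  then have "poly (P l) z = z" .
  moreover have "poly (P 0) z = z ^ Q * a 0"
    by (simp add: P0 poly_monom)
  moreover have "poly (P (Suc i)) z = poly (P i) z ^ Q + z ^ Q * a (Suc i)" for i
    by (simp add: PS poly_monom)
  ultimately show ?thesis
    using z0 by (intro exI[of _ "\<lambda>i. poly (P i) z"] exI[of _ z] conjI allI impI)
qed

lemma artin_schreier_solvable:
  fixes c :: "'k::alg_closed_field"
  assumes "2 \<le> Q"
  shows "\<exists>b. b - b ^ Q = c"
proof -
  let ?p = "monom 1 Q + [:c, - 1:]"
  have "degree ?p = Q"
    using assms by (subst degree_add_eq_left) (simp_all add: degree_monom_eq)
  then obtain b where "poly ?p b = 0"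
    using alg_closed_imp_poly_has_root[of ?p] assms by auto
  then show ?thesis by (intro exI[of _ b]) (simp add: poly_monom algebra_simps)
qed

section \<open>Independence modulo a subspace\<close>

context vector_space
begin

lemma in_span_image_lessThan:
  "x \<in> span (f ` {..<k::nat}) \<Longrightarrow> \<exists>a. x = (\<Sum>i<k. scale (a i) (f i))"
proof (induction k arbitrary: x)
  case 0
  then show ?case by simp
next
  case (Suc k)
  then obtain c where "x - scale c (f k) \<in> span (f ` {..<k})"
    by (auto simp: lessThan_Suc span_breakdown_eq)
  then obtain a where a: "x - scale c (f k) = (\<Sum>i<k. scale (a i) (f i))"
    using Suc.IH by blast
  show ?case
    by (rule exI[of _ "a(k := c)"]) (use a in \<open>simp add: algebra_simps\<close>)
qed

lemma independent_image_lessThan: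
  assumes "\<And>k. k < n \<Longrightarrow> v k \<notin> span (v ` {..<k})"
  shows "inj_on v {..<n::nat} \<and> independent (v ` {..<n})"
  using assms
proof (induction n)
  case (Suc n)
  then have IH: "inj_on v {..<n}" "independent (v ` {..<n})" and n: "v n \<notin> span (v ` {..<n})"
    by auto
  have "v n \<notin> v ` {..<n}" using n span_base[of "v n" "v ` {..<n}"] by blast
  then show ?case
    using IH n by (auto simp: lessThan_Suc independent_insertI)
qed (simp add: independent_empty)

text \<open>
  If \<open>U\<close> meets \<open>Z\<close> trivially, then \<open>U\<close> embeds into the quotient by \<open>Z\<close>, and independent subsets of \<open>U\<close>
  are bounded by any set that spans this quotient.  Replacing each element of \<open>B\<close> by a representative in
  the span of \<open>Y\<close> keeps it independent.
\<close>

lemma independent_modulo_bound: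
  assumes U: "subspace U" and Z: "subspace Z" and UZ: "U \<inter> Z \<subseteq> {0}"
    and B: "independent B" "B \<subseteq> U"
    and Y: "finite Y" "\<And>x. x \<in> B \<Longrightarrow> \<exists>z\<in>Z. x - z \<in> span Y"
  shows "finite B \<and> card B \<le> card Y"
proof -
  have "card X \<le> card Y" if X: "X \<subseteq> B" "finite X" for X
  proof -
    obtain z where z: "\<And>x. x \<in> B \<Longrightarrow> z x \<in> Z \<and> x - z x \<in> span Y"
      using Y(2) by metis
    let ?w = "\<lambda>x. x - z x"
    have inj: "inj_on ?w X"
    proof (rule inj_onI)
      fix x y assume xy: "x \<in> X" "y \<in> X" "?w x = ?w y"
      then have "x - y = z x - z y" by (simp add: algebra_simps)
      moreover have "x - y \<in> U" using xy X B U by (auto intro: subspace_diff)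
      moreover have "z x - z y \<in> Z" using xy X z Z by (auto intro: subspace_diff)
      ultimately show "x = y" using UZ by auto
    qed
    have "independent (?w ` X)"
    proof (rule independent_if_scalars_zero)
      show "finite (?w ` X)" using X by simp
      fix f y assume f: "(\<Sum>y\<in>?w ` X. scale (f y) y) = 0" and y: "y \<in> ?w ` X"
      have "(\<Sum>x\<in>X. scale (f (?w x)) (?w x)) = 0"
        using f inj by (simp add: sum.reindex)
      then have eq: "(\<Sum>x\<in>X. scale (f (?w x)) x) = (\<Sum>x\<in>X. scale (f (?w x)) (z x))"
        by (simp add: scale_right_diff_distrib sum_subtractf)
      have "(\<Sum>x\<in>X. scale (f (?w x)) x) \<in> U"
        using X B by (intro subspace_sum[OF U] subspace_scale[OF U]) auto
      moreover have "(\<Sum>x\<in>X. scale (f (?w x)) (z x)) \<in> Z"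
        using X z by (intro subspace_sum[OF Z] subspace_scale[OF Z]) auto
      ultimately have "(\<Sum>x\<in>X. scale (f (?w x)) x) = 0" using eq UZ by auto
      then have "\<forall>x\<in>X. f (?w x) = 0"
        using independentD[OF B(1) X(2,1), of "\<lambda>x. f (?w x)"] by blast
      then show "f y = 0" using y by auto
    qed
    moreover have "?w ` X \<subseteq> span Y" using z X by auto
    ultimately have "card (?w ` X) \<le> card Y"
      using independent_span_bound[OF Y(1)] by blast
    then show ?thesis using inj by (simp add: card_image)
  qed
  then show ?thesis using finite_if_finite_subsets_card_bdd[of B "card Y"] by blast
qed

lemma sequence_dependent_modulo:
  assumes U: "subspace U" and Z: "subspace Z" and UZ: "U \<inter> Z \<subseteq> {0}"
    and Y: "finite Y" "\<And>x. x \<in> U \<Longrightarrow> \<exists>z\<in>Z. x - z \<in> span Y"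
    and v: "\<And>i::nat. v i \<in> U"
  shows "\<exists>k. v k \<in> span (v ` {..<k})"
proof (rule ccontr)
  assume "\<not> ?thesis"
  then have "inj_on v {..<Suc (card Y)} \<and> independent (v ` {..<Suc (card Y)})"
    by (intro independent_image_lessThan) auto
  moreover have "card (v ` {..<Suc (card Y)}) \<le> card Y"
    if "independent (v ` {..<Suc (card Y)})"
    using independent_modulo_bound[OF U Z UZ that _ Y(1)] Y(2) v by auto
  ultimately show False by (auto simp: card_image)
qed

end

section \<open>Fixed vectors of semilinear maps\<close>

text \<open>
  This is the structure of a \<open>K{\<tau>,t}\<close>-module seen from \<open>K\<close>: a vector space with a Frobenius-semilinear
  and a linear operator that commute.
\<close>

locale frobenius_space = vector_space scale
  for scale :: "'k::alg_closed_field \<Rightarrow> 'm::ab_group_add \<Rightarrow> 'm" +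
  fixes q :: nat and tau t :: "'m \<Rightarrow> 'm"
  assumes q_ge_2: "2 \<le> q"
    and frobenius_add: "\<And>a b :: 'k. (a + b) ^ q = a ^ q + b ^ q"
    and tau_add: "\<And>x y. tau (x + y) = tau x + tau y"
    and tau_scale: "\<And>a x. tau (scale a x) = scale (a ^ q) (tau x)"
    and t_add: "\<And>x y. t (x + y) = t x + t y"
    and t_scale: "\<And>a x. t (scale a x) = scale a (t x)"
    and t_tau: "\<And>x. t (tau x) = tau (t x)"
begin

lemma frobenius_root: "\<exists>b::'k. b ^ (q ^ n) = a"
  using nth_root_exists[of "q ^ n" a] q_ge_2 by auto

lemma tau_pow_add: "(tau ^^ n) (x + y) = (tau ^^ n) x + (tau ^^ n) y"
  by (induction n) (simp_all add: tau_add)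

lemma tau_pow_scale: "(tau ^^ n) (scale a x) = scale (a ^ (q ^ n)) ((tau ^^ n) x)"
  by (induction n) (simp_all add: tau_scale mult.commute flip: power_mult)

lemma t_pow_add: "(t ^^ n) (x + y) = (t ^^ n) x + (t ^^ n) y"
  by (induction n) (simp_all add: t_add)

lemma t_pow_scale: "(t ^^ n) (scale a x) = scale a ((t ^^ n) x)"
  by (induction n) (simp_all add: t_scale)

lemma t_pow_tau_pow: "(t ^^ n) ((tau ^^ k) x) = (tau ^^ k) ((t ^^ n) x)"
proof -
  have "t ((tau ^^ k) x) = (tau ^^ k) (t x)" for x
    by (induction k) (simp_all add: t_tau)
  then show ?thesis by (induction n) simp_all
qed

lemma additive_tau_pow: "Modules.additive (tau ^^ n)"
  by (simp add: Modules.additive_def tau_pow_add)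

lemma additive_t_pow: "Modules.additive (t ^^ n)"
  by (simp add: Modules.additive_def t_pow_add)

lemmas tau_pow_simps = tau_pow_scale additive.zero[OF additive_tau_pow]
  additive.diff[OF additive_tau_pow] additive.minus[OF additive_tau_pow]
lemmas tau_pow_sum = additive.sum[OF additive_tau_pow]
lemmas t_pow_simps = t_pow_scale additive.zero[OF additive_t_pow]
  additive.diff[OF additive_t_pow] additive.minus[OF additive_t_pow]
lemmas t_pow_sum = additive.sum[OF additive_t_pow]

text \<open>Since \<open>K\<close> is perfect, semilinear images of subspaces are subspaces.\<close>

lemma subspace_tau_pow_image:
  assumes "subspace A"
  shows "subspace ((tau ^^ n) ` A)"
proof (rule subspaceI)
  have "0 = (tau ^^ n) 0" by (simp only: tau_pow_simps)
  then show "0 \<in> (tau ^^ n) ` A"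
    using subspace_0[OF assms] by (rule image_eqI)
next
  fix x y assume "x \<in> (tau ^^ n) ` A" "y \<in> (tau ^^ n) ` A"
  then obtain x' y' where x: "x = (tau ^^ n) x'" "x' \<in> A" and y: "y = (tau ^^ n) y'" "y' \<in> A"
    unfolding image_iff by metis
  have "x + y = (tau ^^ n) (x' + y')" unfolding x(1) y(1) tau_pow_add ..
  then show "x + y \<in> (tau ^^ n) ` A"
    using subspace_add[OF assms x(2) y(2)] by (rule image_eqI)
next
  fix c :: 'k and x assume "x \<in> (tau ^^ n) ` A"
  then obtain x' where x: "x = (tau ^^ n) x'" "x' \<in> A" by (rule imageE)
  obtain b where b: "b ^ (q ^ n) = c" using frobenius_root[of n c] by blast
  have "scale c x = (tau ^^ n) (scale b x')" unfolding x(1) tau_pow_scale b ..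
  then show "scale c x \<in> (tau ^^ n) ` A"
    using subspace_scale[OF assms x(2)] by (rule image_eqI)
qed

text \<open>
  Lang's theorem for \<open>\<phi> = t\<^bsup>-n\<^esup> \<tau>\<^sup>s\<close> on the finite-dimensional quotient \<open>A / A0\<close>, phrased without forming
  quotients: \<open>t\<^sup>n\<close> and \<open>\<tau>\<^sup>s\<close> both embed \<open>A / A0\<close> into the quotient of the whole space by \<open>B\<close>, and every
  \<open>\<tau>\<^sup>s x\<close> is congruent to some \<open>t\<^sup>n y\<close>.

  Let \<open>F\<close> be the set of fixed vectors.  If \<open>v\<^sub>0\<close> is not in its span, the first linear relation modulo
  that span among \<open>v\<^sub>0, \<phi> v\<^sub>0, \<phi>\<^sup>2 v\<^sub>0, \<dots>\<close> produces a vector \<open>g\<close> outside the span of \<open>F\<close> that is fixed up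
  to an error in this span; an Artin-Schreier equation removes the error, a contradiction.
\<close>

lemma frobenius_fixed_vectors_span:
  assumes s: "1 \<le> s" and A: "subspace A" and B: "subspace B" and A0: "A0 \<subseteq> A"
    and T: "\<And>x. x \<in> A \<Longrightarrow> (t ^^ n) x \<in> B \<longleftrightarrow> x \<in> A0"
    and tau: "\<And>x. x \<in> A \<Longrightarrow> (tau ^^ s) x \<in> B \<longleftrightarrow> x \<in> A0"
    and surj: "\<And>x. x \<in> A \<Longrightarrow> \<exists>y\<in>A. (t ^^ n) y - (tau ^^ s) x \<in> B"
    and fd: "\<And>v. (\<And>i::nat. v i \<in> A) \<Longrightarrow> \<exists>k. v k \<in> span (v ` {..<k})"
  shows "A \<subseteq> span {g \<in> A. (t ^^ n) g - (tau ^^ s) g \<in> B}"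
proof
  define F where "F = {g \<in> A. (t ^^ n) g - (tau ^^ s) g \<in> B}"
  define Q where "Q = q ^ s"
  let ?T = "t ^^ n" and ?\<sigma> = "tau ^^ s"
  have Q2: "2 \<le> Q"
    using q_ge_2 s self_le_power[of q s] by (auto simp: Q_def)
  have \<sigma>: "?\<sigma> (scale a x) = scale (a ^ Q) (?\<sigma> x)" for a x
    by (simp add: Q_def tau_pow_scale)
  have SA: "span F \<subseteq> A" using A by (intro span_minimal) (auto simp: F_def)
  have A0F: "x \<in> span F" if "x \<in> A0" for x
    using that T[of x] tau[of x] A0 B by (intro span_base) (auto simp: F_def intro: subspace_diff)
  \<comment> \<open>\<open>\<phi>\<close> is surjective on the span of \<open>F\<close>: extract \<open>Q\<close>-th roots of the coefficients.\<close>
  have H1: "\<exists>y\<in>span F. ?\<sigma> y - ?T x \<in> B" if "x \<in> span F" for x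
    using that
  proof (induction rule: span_induct_alt)
    case base
    show ?case by (intro bexI[of _ 0]) (simp_all add: tau_pow_simps t_pow_simps span_zero subspace_0[OF B])
  next
    case (step c f x)
    then obtain y where y: "y \<in> span F" "?\<sigma> y - ?T x \<in> B" by blast
    obtain b where b: "b ^ Q = c" using frobenius_root[of s c] Q_def by blast
    have f: "?T f - ?\<sigma> f \<in> B" using step by (simp add: F_def)
    have "?\<sigma> (scale b f + y) - ?T (scale c f + x) = (?\<sigma> y - ?T x) - scale c (?T f - ?\<sigma> f)"
      by (simp add: tau_pow_add t_pow_add \<sigma> t_pow_scale b algebra_simps)
    also have "\<dots> \<in> B" by (rule subspace_diff[OF B y(2) subspace_scale[OF B f]])
    finally show ?case
      using y step by (intro bexI[of _ "scale b f + y"]) (auto intro: span_add span_scale span_base)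
  qed
  \<comment> \<open>\<open>1 - \<phi>\<close> is surjective on the span of \<open>F\<close>: solve \<open>b - b ^ Q = c\<close> for each coefficient.\<close>
  have H2: "\<exists>y\<in>span F. ?T y - ?\<sigma> y - ?T x \<in> B" if "x \<in> span F" for x
    using that
  proof (induction rule: span_induct_alt)
    case base
    show ?case by (intro bexI[of _ 0]) (simp_all add: tau_pow_simps t_pow_simps span_zero subspace_0[OF B])
  next
    case (step c f x)
    then obtain y where y: "y \<in> span F" "?T y - ?\<sigma> y - ?T x \<in> B" by blast
    obtain b where b: "b - b ^ Q = c" using artin_schreier_solvable[OF Q2, of c] by blast
    have f: "?T f - ?\<sigma> f \<in> B" using step by (simp add: F_def)
    have "?T (scale b f + y) - ?\<sigma> (scale b f + y) - ?T (scale c f + x)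
        = (?T y - ?\<sigma> y - ?T x) + scale (b ^ Q) (?T f - ?\<sigma> f)"
      by (simp add: tau_pow_add t_pow_add \<sigma> t_pow_simps algebra_simps flip: b)
    also have "\<dots> \<in> B" by (rule subspace_add[OF B y(2) subspace_scale[OF B f]])
    finally show ?case
      using y step by (intro bexI[of _ "scale b f + y"]) (auto intro: span_add span_scale span_base)
  qed
  \<comment> \<open>As \<open>\<phi>\<close> is injective, a vector that it sends into the span of \<open>F\<close> is already there.\<close>
  have H3: "x \<in> span F" if x: "x \<in> A" "y \<in> span F" "?\<sigma> x - ?T y \<in> B" for x y
  proof -
    obtain y' where y': "y' \<in> span F" "?\<sigma> y' - ?T y \<in> B" using H1 x by blast
    have "?\<sigma> (x - y') = (?\<sigma> x - ?T y) - (?\<sigma> y' - ?T y)" by (simp add: tau_pow_simps)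
    also have "\<dots> \<in> B" by (rule subspace_diff[OF B x(3) y'(2)])
    finally have "x - y' \<in> A0" using tau[of "x - y'"] x y' SA A by (auto intro: subspace_diff)
    then show ?thesis using A0F y' span_add[of "x - y'" F y'] by simp
  qed
  fix v0 assume v0: "v0 \<in> A"
  show "v0 \<in> span {g \<in> A. ?T g - ?\<sigma> g \<in> B}"
    unfolding F_def[symmetric]
  proof (rule ccontr)
    assume v0F: "v0 \<notin> span F"
    have "\<forall>x\<in>A. \<exists>y. y \<in> A \<and> ?T y - ?\<sigma> x \<in> B" using surj by blast
    then obtain \<phi> where "\<forall>x\<in>A. \<phi> x \<in> A \<and> ?T (\<phi> x) - ?\<sigma> x \<in> B"
      using bchoice[of A "\<lambda>x y. y \<in> A \<and> ?T y - ?\<sigma> x \<in> B"] by blast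
    then have \<phi>: "\<And>x. x \<in> A \<Longrightarrow> \<phi> x \<in> A" "\<And>x. x \<in> A \<Longrightarrow> ?T (\<phi> x) - ?\<sigma> x \<in> B"
      by blast+
    define v where "v i = (\<phi> ^^ i) v0" for i
    have vA: "v i \<in> A" for i by (induction i) (simp_all add: v_def v0 \<phi>)
    have vS: "?T (v (Suc i)) - ?\<sigma> (v i) \<in> B" for i
      using \<phi>(2)[OF vA[of i]] by (simp add: v_def)
    define dep where "dep k \<longleftrightarrow> v k \<in> span (F \<union> v ` {..<k})" for k
    obtain k where "v k \<in> span (v ` {..<k})" using fd[of v, OF vA] by blast
    then have "dep k" using span_mono[of "v ` {..<k}" "F \<union> v ` {..<k}"] by (auto simp: dep_def)
    then have k: "dep (Least dep)" by (rule LeastI)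
    have "Least dep \<noteq> 0"
      using k v0F by (metis Un_empty_right dep_def funpow_0 image_empty lessThan_0 v_def)
    then obtain l where l: "Least dep = Suc l" by (cases "Least dep") simp_all
    have nl: "\<not> dep l" using l not_less_Least[of l dep] by simp
    obtain s0 w where s0: "s0 \<in> span F" and w: "w \<in> span (v ` {..<Suc l})" and vk: "v (Suc l) = s0 + w"
      using k unfolding l dep_def span_Un mem_Collect_eq by blast
    obtain a where a: "w = (\<Sum>i<Suc l. scale (a i) (v i))"
      using in_span_image_lessThan[OF w] by blast
    show False
    proof (cases "\<exists>i\<le>l. a i \<noteq> 0")
      \<comment> \<open>Without a nonzero coefficient \<open>\<phi> (v l)\<close> is in the span of \<open>F\<close>, so \<open>v l\<close> gives an earlier relation.\<close>
      case False
      then have "a i = 0" if "i < Suc l" for i using that less_Suc_eq_le by blast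
      then have "w = 0" unfolding a by simp
      then have "v (Suc l) \<in> span F" using vk s0 by simp
      moreover have "?\<sigma> (v l) - ?T (v (Suc l)) \<in> B"
        using subspace_neg[OF B vS[of l]] by simp
      ultimately have "v l \<in> span F" by (intro H3[OF vA])
      then show False
        using nl span_mono[of F "F \<union> v ` {..<l}"] unfolding dep_def by blast
    next
      case True
      then obtain i where i: "i \<le> l" "a i \<noteq> 0" by blast
      obtain c z where z: "z \<noteq> 0" and c0: "c 0 = z ^ Q * a 0"
        and cS: "\<And>i. i < l \<Longrightarrow> c (Suc i) = c i ^ Q + z ^ Q * a (Suc i)" and cl: "c l = z"
        using twisted_recursion_solvable[where a = a and l = l, OF Q2 i] by blast
      \<comment> \<open>The coefficients are chosen such that \<open>\<phi> g = g\<close> modulo the span of \<open>F\<close>.\<close>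
      define g where "g = (\<Sum>i<Suc l. scale (c i) (v i))"
      have "g = scale (c 0) (v 0) + (\<Sum>i<l. scale (c (Suc i)) (v (Suc i)))"
        unfolding g_def by (rule sum.lessThan_Suc_shift)
      also have "(\<Sum>i<l. scale (c (Suc i)) (v (Suc i))) =
          (\<Sum>i<l. scale (c i ^ Q) (v (Suc i))) + (\<Sum>i<l. scale (z ^ Q * a (Suc i)) (v (Suc i)))"
        unfolding sum.distrib[symmetric] by (rule sum.cong) (simp_all add: cS scale_left_distrib)
      finally have g1: "g = (\<Sum>i<l. scale (c i ^ Q) (v (Suc i))) +
          (scale (z ^ Q * a 0) (v 0) + (\<Sum>i<l. scale (z ^ Q * a (Suc i)) (v (Suc i))))"
        by (simp add: c0 algebra_simps)
      have "scale (z ^ Q) w = (\<Sum>i<Suc l. scale (z ^ Q * a i) (v i))"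
        unfolding a by (simp only: scale_sum_right scale_scale)
      also have "\<dots> = scale (z ^ Q * a 0) (v 0) + (\<Sum>i<l. scale (z ^ Q * a (Suc i)) (v (Suc i)))"
        by (rule sum.lessThan_Suc_shift)
      finally have g2: "g = (\<Sum>i<l. scale (c i ^ Q) (v (Suc i))) + scale (z ^ Q) w"
        using g1 by simp
      define s1 where "s1 = scale (z ^ Q) s0"
      have s1: "s1 \<in> span F" using s0 by (simp add: s1_def span_scale)
      have g3: "g + s1 = (\<Sum>i<Suc l. scale (c i ^ Q) (v (Suc i)))"
        using g2 vk by (simp add: s1_def cl scale_right_distrib algebra_simps)
      have "?T (g + s1) - ?\<sigma> g = (\<Sum>i<Suc l. scale (c i ^ Q) (?T (v (Suc i)) - ?\<sigma> (v i)))"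
        unfolding g3 unfolding g_def
        by (simp only: t_pow_sum tau_pow_sum t_pow_scale \<sigma> scale_right_diff_distrib sum_subtractf)
      also have "\<dots> \<in> B" by (intro subspace_sum[OF B] subspace_scale[OF B] vS)
      finally have g4: "?T (g + s1) - ?\<sigma> g \<in> B" .
      obtain y where y: "y \<in> span F" "?T y - ?\<sigma> y - ?T s1 \<in> B" using H2 s1 by blast
      have gA: "g \<in> A" unfolding g_def using vA by (intro subspace_sum[OF A] subspace_scale[OF A])
      have "?T (g + y) - ?\<sigma> (g + y) = (?T (g + s1) - ?\<sigma> g) + (?T y - ?\<sigma> y - ?T s1)"
        by (simp add: t_pow_add tau_pow_add)
      also have "\<dots> \<in> B" by (rule subspace_add[OF B g4 y(2)])
      finally have "g + y \<in> span F"
        using gA y SA A by (intro span_base) (auto simp: F_def intro: subspace_add)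
      then have "g \<in> span F" using span_diff[OF _ y(1)] by fastforce
      then have gl: "g \<in> span (F \<union> v ` {..<l})" using span_mono[of F "F \<union> v ` {..<l}"] by auto
      have "(\<Sum>i<l. scale (c i) (v i)) \<in> span (F \<union> v ` {..<l})"
        by (intro span_sum span_scale span_base) auto
      from span_diff[OF gl this] have "scale z (v l) \<in> span (F \<union> v ` {..<l})"
        by (simp add: g_def cl)
      then have "scale (inverse z) (scale z (v l)) \<in> span (F \<union> v ` {..<l})" by (rule span_scale)
      then show False using nl z by (simp add: dep_def)
    qed
  qed
qed

end

section \<open>Degree filtrations\<close>

context frobenius_space
begin

lemma tau_pow_span:
  assumes "x \<in> span Y"
  shows "(tau ^^ k) x \<in> span ((tau ^^ k) ` Y)"
  using assms
proof (induction rule: span_induct_alt)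
  case base
  show ?case by (simp add: tau_pow_simps span_zero)
next
  case (step c x y)
  show ?case
    unfolding tau_pow_add tau_pow_scale
    by (rule span_add[OF span_scale[OF span_base[OF imageI[OF step(1)]]] step(2)])
qed

lemma t_pow_span:
  assumes "x \<in> span Y"
  shows "(t ^^ k) x \<in> span ((t ^^ k) ` Y)"
  using assms
proof (induction rule: span_induct_alt)
  case base
  show ?case by (simp add: t_pow_simps span_zero)
next
  case (step c x y)
  show ?case
    unfolding t_pow_add t_pow_scale
    by (rule span_add[OF span_scale[OF span_base[OF imageI[OF step(1)]]] step(2)])
qed

end

text \<open>
  Free modules of finite rank over \<open>K{\<tau>}\<close> and over \<open>K[t]\<close> have finite-dimensional quotients by \<open>\<tau>\<close> and
  by \<open>t\<close>, on which all dimension arguments below rest.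
\<close>

locale cofinite_frobenius_space = frobenius_space scale q tau t
  for scale :: "'k::alg_closed_field \<Rightarrow> 'm::ab_group_add \<Rightarrow> 'm"
    and q :: nat and tau t :: "'m \<Rightarrow> 'm" +
  assumes tau_cofinite: "\<exists>Y. finite Y \<and> (\<forall>x. \<exists>y. x - tau y \<in> span Y)"
    and t_cofinite: "\<exists>Y. finite Y \<and> (\<forall>x. \<exists>y. x - t y \<in> span Y)"
begin

lemma funpow_cofinite:
  assumes diff: "\<And>k x y. (f ^^ k) (x - y) = (f ^^ k) x - (f ^^ k) y"
    and span: "\<And>k x Y. x \<in> span Y \<Longrightarrow> (f ^^ k) x \<in> span ((f ^^ k) ` Y)"
    and cofinite: "\<exists>Y. finite Y \<and> (\<forall>x. \<exists>y. x - f y \<in> span Y)"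
  shows "\<exists>Y. finite Y \<and> (\<forall>x. \<exists>y. x - (f ^^ k) y \<in> span Y)"
proof (induction k)
  case 0
  show ?case
    by (rule exI[of _ "{}"]) auto
next
  case (Suc k)
  then obtain Y where Y: "finite Y" "\<And>x. \<exists>y. x - (f ^^ k) y \<in> span Y" by blast
  obtain Y' where Y': "finite Y'" "\<And>x. \<exists>y. x - f y \<in> span Y'" using cofinite by blast
  let ?Y = "Y \<union> (f ^^ k) ` Y'"
  have "\<exists>z. x - (f ^^ Suc k) z \<in> span ?Y" for x
  proof -
    obtain y where y: "x - (f ^^ k) y \<in> span Y" using Y(2)[of x] by blast
    obtain z where z: "y - f z \<in> span Y'" using Y'(2)[of y] by blast
    have "x - (f ^^ Suc k) z = (x - (f ^^ k) y) + (f ^^ k) (y - f z)"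
      by (simp add: diff funpow_Suc_right del: funpow.simps)
    moreover have "x - (f ^^ k) y \<in> span ?Y"
      using y span_mono[of Y ?Y] by blast
    moreover have "(f ^^ k) (y - f z) \<in> span ?Y"
      using span[OF z, of k] span_mono[of "(f ^^ k) ` Y'" ?Y] by blast
    ultimately show ?thesis using span_add[of "x - (f ^^ k) y" ?Y] by metis
  qed
  then show ?case using Y(1) Y'(1) by (intro exI[of _ ?Y]) blast
qed

lemma tau_pow_cofinite: "\<exists>Y. finite Y \<and> (\<forall>x. \<exists>y. x - (tau ^^ k) y \<in> span Y)"
  by (rule funpow_cofinite[OF _ _ tau_cofinite]) (simp_all only: tau_pow_simps tau_pow_span)

lemma t_pow_cofinite: "\<exists>Y. finite Y \<and> (\<forall>x. \<exists>y. x - (t ^^ k) y \<in> span Y)"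
  by (rule funpow_cofinite[OF _ _ t_cofinite]) (simp_all only: t_pow_simps t_pow_span)

text \<open>
  A filtration is stored as the set of pairs \<open>(j, x)\<close> with \<open>x\<close> in \<open>F\<^sub>j\<close>, so that comparing filtrations is
  set inclusion and Zorn's lemma for sets applies.
\<close>

definition degree_filtration :: "nat \<Rightarrow> nat \<Rightarrow> (int \<times> 'm) set \<Rightarrow> bool" where
  "degree_filtration n s P \<longleftrightarrow>
     (\<forall>j. subspace (P `` {j})) \<and>
     (\<forall>j x. (j, x) \<in> P \<longrightarrow> (j + 1, x) \<in> P) \<and>
     (\<forall>x. \<exists>j. (j, x) \<in> P) \<and>
     (\<forall>j x. j < 0 \<longrightarrow> (j, x) \<in> P \<longrightarrow> x = 0) \<and>
     (\<forall>j x. (j + 1, tau x) \<in> P \<longleftrightarrow> (j, x) \<in> P) \<and>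
     (\<forall>j x. (j + int s, (t ^^ n) x) \<in> P \<longleftrightarrow> (j, x) \<in> P)"

context
  fixes n s :: nat and P :: "(int \<times> 'm) set"
  assumes filtration: "degree_filtration n s P"
begin

lemma layer_subspace: "subspace (P `` {j})"
  using filtration by (simp add: degree_filtration_def)

lemma layer_zero: "(j, 0) \<in> P"
  using subspace_0[OF layer_subspace[of j]] by simp

lemma layer_add: "(j, x) \<in> P \<Longrightarrow> (j, y) \<in> P \<Longrightarrow> (j, x + y) \<in> P"
  using subspace_add[OF layer_subspace[of j], of x y] by simp

lemma layer_diff: "(j, x) \<in> P \<Longrightarrow> (j, y) \<in> P \<Longrightarrow> (j, x - y) \<in> P"
  using subspace_diff[OF layer_subspace[of j], of x y] by simp

lemma layer_scale: "(j, x) \<in> P \<Longrightarrow> (j, scale c x) \<in> P"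
  using subspace_scale[OF layer_subspace[of j], of x c] by simp

lemma layer_span: "Y \<subseteq> P `` {j} \<Longrightarrow> x \<in> span Y \<Longrightarrow> (j, x) \<in> P"
  using span_minimal[OF _ layer_subspace[of j], of Y] by blast

lemma layer_mono:
  assumes "(i, x) \<in> P" "i \<le> j"
  shows "(j, x) \<in> P"
proof -
  have "(i + int k, x) \<in> P" for k
  proof (induction k)
    case (Suc k)
    have "(i + int k + 1, x) \<in> P" using Suc filtration unfolding degree_filtration_def by blast
    then show ?case by (simp add: algebra_simps)
  qed (use assms in simp)
  from this[of "nat (j - i)"] show ?thesis using assms by simp
qed

lemma layer_exhaustive: "\<exists>j. (j, x) \<in> P"
  using filtration by (simp add: degree_filtration_def)

lemma layer_negative: "(j, x) \<in> P \<Longrightarrow> j < 0 \<Longrightarrow> x = 0"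
  using filtration unfolding degree_filtration_def by blast

lemma layer_tau: "(j + 1, tau x) \<in> P \<longleftrightarrow> (j, x) \<in> P"
  using filtration by (simp add: degree_filtration_def)

lemma layer_tau_pow: "(j + int k, (tau ^^ k) x) \<in> P \<longleftrightarrow> (j, x) \<in> P"
proof (induction k)
  case (Suc k)
  have "(j + int (Suc k), (tau ^^ Suc k) x) \<in> P \<longleftrightarrow> ((j + int k) + 1, tau ((tau ^^ k) x)) \<in> P"
    by (simp add: algebra_simps)
  then show ?case unfolding layer_tau Suc .
qed simp

lemma layer_t: "(j + int s, (t ^^ n) x) \<in> P \<longleftrightarrow> (j, x) \<in> P"
  using filtration by (simp add: degree_filtration_def)

lemma layer_t_pow: "(j + int (s * k), (t ^^ (n * k)) x) \<in> P \<longleftrightarrow> (j, x) \<in> P"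
proof (induction k)
  case (Suc k)
  have "(t ^^ (n * Suc k)) x = (t ^^ n) ((t ^^ (n * k)) x)"
    by (simp add: funpow_add)
  moreover have "j + int (s * Suc k) = (j + int (s * k)) + int s" by simp
  ultimately show ?case using Suc layer_t by metis
qed simp

lemma finite_subset_layer:
  assumes "finite Y"
  shows "\<exists>j\<ge>i. Y \<subseteq> P `` {j}"
  using assms
proof (induction Y)
  case empty
  show ?case by auto
next
  case (insert y Y)
  then obtain j where j: "i \<le> j" "Y \<subseteq> P `` {j}" by blast
  obtain k where k: "(k, y) \<in> P" using layer_exhaustive by blast
  have "insert y Y \<subseteq> P `` {max j k}"
    using j k layer_mono[of k y "max j k"] layer_mono[of j _ "max j k"] by auto
  then show ?case using j by (intro exI[of _ "max j k"]) auto
qed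

text \<open>
  Dividing by \<open>\<tau>\<^bsup>j+1\<^esup>\<close> would lead to degree \<open>-1\<close>.  Hence each layer embeds into a quotient of finite
  dimension.
\<close>

lemma layer_inter_tau_range: "P `` {j} \<inter> range (tau ^^ nat (j + 1)) \<subseteq> {0}"
proof
  fix x assume x: "x \<in> P `` {j} \<inter> range (tau ^^ nat (j + 1))"
  then obtain y where y: "x = (tau ^^ nat (j + 1)) y" by blast
  show "x \<in> {0}"
  proof (cases "j < 0")
    case True
    then show ?thesis using x layer_negative by auto
  next
    case False
    then have "(-1 + int (nat (j + 1)), (tau ^^ nat (j + 1)) y) \<in> P" using x y by simp
    then have "y = 0" unfolding layer_tau_pow using layer_negative[of "-1" y] by simp
    then show ?thesis by (simp add: y tau_pow_simps)
  qed
qed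

lemma layer_sequence_dependent:
  assumes "\<And>i::nat. (j, v i) \<in> P"
  shows "\<exists>k. v k \<in> span (v ` {..<k})"
proof -
  obtain Y where Y: "finite Y" "\<And>x. \<exists>y. x - (tau ^^ nat (j + 1)) y \<in> span Y"
    using tau_pow_cofinite[of "nat (j + 1)"] by blast
  show ?thesis
  proof (rule sequence_dependent_modulo)
    show "subspace (P `` {j})" by (rule layer_subspace)
    show "subspace (range (tau ^^ nat (j + 1)))" by (rule subspace_tau_pow_image) simp
    show "P `` {j} \<inter> range (tau ^^ nat (j + 1)) \<subseteq> {0}" by (rule layer_inter_tau_range)
    show "finite Y" by (rule Y)
    show "\<exists>z\<in>range (tau ^^ nat (j + 1)). x - z \<in> span Y" for x using Y(2)[of x] by blast
    show "v i \<in> P `` {j}" for i using assms[of i] by simp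
  qed
qed

lemma layer_basis: "\<exists>B. finite B \<and> independent B \<and> span B = P `` {j}"
proof -
  obtain Y where Y: "finite Y" "\<And>x. \<exists>y. x - (tau ^^ nat (j + 1)) y \<in> span Y"
    using tau_pow_cofinite[of "nat (j + 1)"] by blast
  obtain B where B: "B \<subseteq> P `` {j}" "independent B" "P `` {j} \<subseteq> span B"
    using maximal_independent_subset[of "P `` {j}"] by blast
  have "finite B \<and> card B \<le> card Y"
  proof (rule independent_modulo_bound)
    show "subspace (P `` {j})" by (rule layer_subspace)
    show "subspace (range (tau ^^ nat (j + 1)))" by (rule subspace_tau_pow_image) simp
    show "P `` {j} \<inter> range (tau ^^ nat (j + 1)) \<subseteq> {0}" by (rule layer_inter_tau_range)
    show "\<exists>z\<in>range (tau ^^ nat (j + 1)). x - z \<in> span Y" for x using Y(2)[of x] by blast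
  qed (use Y B in auto)
  moreover have "span B = P `` {j}"
    using B layer_subspace by (intro span_subspace)
  ultimately show ?thesis using B by blast
qed

text \<open>
  The map \<open>G\<^sub>N \<rightarrow> G\<^bsub>N+s\<^esub>\<close> induced by \<open>t\<^sup>n\<close> is surjective once \<open>F\<^sub>N\<close> contains representatives of
  \<open>M / t\<^sup>n M\<close>: such representatives vanish in \<open>G\<^bsub>N+s\<^esub>\<close>, as \<open>s \<ge> 1\<close>.
\<close>

lemma layer_t_surj:
  assumes "1 \<le> s"
  shows "\<exists>N0\<ge>0. \<forall>N\<ge>N0. \<forall>x. (N + int s, x) \<in> P \<longrightarrow>
           (\<exists>y. (N, y) \<in> P \<and> (N + int s - 1, x - (t ^^ n) y) \<in> P)"
proof -
  obtain Y where Y: "finite Y" "\<And>x. \<exists>y. x - (t ^^ n) y \<in> span Y"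
    using t_pow_cofinite[of n] by blast
  obtain N0 where N0: "0 \<le> N0" "Y \<subseteq> P `` {N0}" using finite_subset_layer[OF Y(1)] by blast
  have "\<exists>y. (N, y) \<in> P \<and> (N + int s - 1, x - (t ^^ n) y) \<in> P"
    if "N0 \<le> N" and x: "(N + int s, x) \<in> P" for N x
  proof -
    obtain y where y: "x - (t ^^ n) y \<in> span Y" using Y(2)[of x] by blast
    have "(N0, x - (t ^^ n) y) \<in> P" using layer_span[OF N0(2) y] .
    then have w: "(N + int s - 1, x - (t ^^ n) y) \<in> P"
      by (rule layer_mono) (use that assms in linarith)
    then have "(N + int s, x - (t ^^ n) y) \<in> P" by (rule layer_mono) simp
    from layer_diff[OF x this] have "(N + int s, (t ^^ n) y) \<in> P" by simp
    then show ?thesis using w layer_t by blast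
  qed
  then show ?thesis using N0(1) by blast
qed

lemma layer_fixed_vectors_span:
  assumes "1 \<le> s"
  shows "\<exists>N0\<ge>0. \<forall>N\<ge>N0. P `` {N} \<subseteq>
           span {g \<in> P `` {N}. (t ^^ n) g - (tau ^^ s) g \<in> P `` {N + int s - 1}}"
proof -
  obtain N0 where N0: "0 \<le> N0" "\<And>N x. N0 \<le> N \<Longrightarrow> (N + int s, x) \<in> P \<Longrightarrow>
      \<exists>y. (N, y) \<in> P \<and> (N + int s - 1, x - (t ^^ n) y) \<in> P"
    using layer_t_surj[OF assms] by blast
  have "P `` {N} \<subseteq> span {g \<in> P `` {N}. (t ^^ n) g - (tau ^^ s) g \<in> P `` {N + int s - 1}}"
    if N: "N0 \<le> N" for N
  proof (rule frobenius_fixed_vectors_span[OF assms layer_subspace layer_subspace])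
    show "P `` {N - 1} \<subseteq> P `` {N}" using layer_mono[of "N - 1" _ N] by auto
    show "(t ^^ n) x \<in> P `` {N + int s - 1} \<longleftrightarrow> x \<in> P `` {N - 1}" for x
      using layer_t[of "N - 1" x] by (simp add: algebra_simps)
    show "(tau ^^ s) x \<in> P `` {N + int s - 1} \<longleftrightarrow> x \<in> P `` {N - 1}" for x
      using layer_tau_pow[of "N - 1" s x] by (simp add: algebra_simps)
    show "\<exists>y\<in>P `` {N}. (t ^^ n) y - (tau ^^ s) x \<in> P `` {N + int s - 1}" if x: "x \<in> P `` {N}" for x
    proof -
      have "(N + int s, (tau ^^ s) x) \<in> P" using x by (simp add: layer_tau_pow)
      then obtain y where y: "(N, y) \<in> P" "(N + int s - 1, (tau ^^ s) x - (t ^^ n) y) \<in> P"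
        using N0(2)[OF N] by blast
      from layer_diff[OF layer_zero y(2)] y(1) show ?thesis by auto
    qed
    show "\<exists>k. v k \<in> span (v ` {..<k})" if "\<And>i::nat. v i \<in> P `` {N}" for v
      using layer_sequence_dependent[of N v] that by simp
  qed
  then show ?thesis using N0(1) by blast
qed

text \<open>
  Elements of \<open>F\<^bsub>j+1\<^esub>\<close> whose leading term is proportional to that of \<open>g\<close>, an element of degree \<open>N\<close>, are
  moved down to degree \<open>j\<close>.  Leading terms in different degrees are compared after multiplication with
  powers of \<open>\<tau>\<close>, so \<open>k\<close> and \<open>i\<close> bring \<open>x\<close> and \<open>g\<close> to the same degree.
\<close>

definition enlarged :: "int \<Rightarrow> 'm \<Rightarrow> (int \<times> 'm) set" where
  "enlarged N g = {(j, x). (j + 1, x) \<in> P \<and>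
     (\<exists>k i c. j + 1 + int k = N + int i \<and> (j + int k, (tau ^^ k) x - scale c ((tau ^^ i) g)) \<in> P)}"

lemma tau_pow_combination:
  "(j + int (m + k), (tau ^^ (m + k)) x - scale (b ^ (q ^ m)) ((tau ^^ (m + i)) g)) \<in> P \<longleftrightarrow>
     (j + int k, (tau ^^ k) x - scale b ((tau ^^ i) g)) \<in> P"
proof -
  have "(tau ^^ (m + k)) x - scale (b ^ (q ^ m)) ((tau ^^ (m + i)) g) =
      (tau ^^ m) ((tau ^^ k) x - scale b ((tau ^^ i) g))"
    by (simp add: tau_pow_simps funpow_add)
  moreover have "j + int (m + k) = (j + int k) + int m" by simp
  ultimately show ?thesis by (simp only: layer_tau_pow)
qed

text \<open>
  The choice of the powers of \<open>\<tau>\<close> does not matter: multiplication by \<open>\<tau>\<close> shifts degrees by exactly one,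
  and constants can be moved across it because \<open>K\<close> is perfect.
\<close>

lemma enlarged_iff:
  assumes ki: "j + 1 + int k = N + int i"
  shows "(j, x) \<in> enlarged N g \<longleftrightarrow> (j + 1, x) \<in> P \<and>
    (\<exists>c. (j + int k, (tau ^^ k) x - scale c ((tau ^^ i) g)) \<in> P)"
proof
  assume "(j, x) \<in> enlarged N g"
  then obtain k' i' c where x: "(j + 1, x) \<in> P" and ki': "j + 1 + int k' = N + int i'"
    and c: "(j + int k', (tau ^^ k') x - scale c ((tau ^^ i') g)) \<in> P"
    by (auto simp: enlarged_def)
  have "(j + int (k + k'), (tau ^^ (k + k')) x - scale (c ^ (q ^ k)) ((tau ^^ (k + i')) g)) \<in> P"
    using c by (simp only: tau_pow_combination)
  moreover have "k + k' = k' + k" "k + i' = k' + i" using ki ki' by linarith+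
  moreover obtain e where "e ^ (q ^ k') = c ^ (q ^ k)" using frobenius_root by blast
  ultimately have "(j + int (k' + k), (tau ^^ (k' + k)) x - scale (e ^ (q ^ k')) ((tau ^^ (k' + i)) g)) \<in> P"
    by simp
  then show "(j + 1, x) \<in> P \<and> (\<exists>c. (j + int k, (tau ^^ k) x - scale c ((tau ^^ i) g)) \<in> P)"
    using x tau_pow_combination by blast
next
  assume "(j + 1, x) \<in> P \<and> (\<exists>c. (j + int k, (tau ^^ k) x - scale c ((tau ^^ i) g)) \<in> P)"
  then show "(j, x) \<in> enlarged N g" using ki unfolding enlarged_def by blast
qed

lemma enlarged_superset: "P \<subseteq> enlarged N g"
proof
  fix p assume "p \<in> P"
  moreover obtain j x where "p = (j, x)" by (cases p)
  ultimately have x: "(j, x) \<in> P" by simp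
  define k i where "k = nat (N - j - 1)" and "i = nat (j + 1 - N)"
  have ki: "j + 1 + int k = N + int i" by (simp add: k_def i_def)
  have "(j + 1, x) \<in> P" using x by (rule layer_mono) simp
  moreover have "(j + int k, (tau ^^ k) x - scale 0 ((tau ^^ i) g)) \<in> P"
    using x by (simp add: layer_tau_pow)
  ultimately show "p \<in> enlarged N g" unfolding \<open>p = (j, x)\<close> enlarged_iff[OF ki] by blast
qed

text \<open>
  That \<open>g\<close> is fixed makes the new filtration compatible with \<open>t\<^sup>n\<close>: the leading terms of \<open>t\<^sup>n g\<close> and
  \<open>\<tau>\<^sup>s g\<close> agree.  That the leading term of \<open>g\<close> does not come from \<open>F\<^sub>0\<close> keeps degree \<open>-1\<close> empty: an
  element \<open>x\<close> of \<open>F\<^sub>0\<close> can only be moved down if \<open>\<tau>\<^sup>N x\<close> and \<open>g\<close> have proportional leading terms.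
\<close>

lemma enlarged_filtration:
  assumes g: "(N + int s - 1, (t ^^ n) g - (tau ^^ s) g) \<in> P"
    and N: "0 \<le> N"
    and new: "\<And>w. (0, w) \<in> P \<Longrightarrow> (N - 1, g - (tau ^^ nat N) w) \<notin> P"
  shows "degree_filtration n s (enlarged N g)"
  unfolding degree_filtration_def
proof (intro conjI allI impI)
  fix j
  define k i where "k = nat (N - j - 1)" and "i = nat (j + 1 - N)"
  have ki: "j + 1 + int k = N + int i" by (simp add: k_def i_def)
  note iff = enlarged_iff[OF ki]
  show "subspace (enlarged N g `` {j})"
  proof (rule subspaceI)
    show "0 \<in> enlarged N g `` {j}"
      using enlarged_superset layer_zero by blast
  next
    fix x y assume "x \<in> enlarged N g `` {j}" "y \<in> enlarged N g `` {j}"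
    then obtain a b where "(j + 1, x) \<in> P" "(j + 1, y) \<in> P"
      and ab: "(j + int k, (tau ^^ k) x - scale a ((tau ^^ i) g)) \<in> P"
        "(j + int k, (tau ^^ k) y - scale b ((tau ^^ i) g)) \<in> P"
      by (auto simp: iff)
    moreover have "(j + int k, (tau ^^ k) (x + y) - scale (a + b) ((tau ^^ i) g)) \<in> P"
      using layer_add[OF ab] by (simp add: tau_pow_add scale_left_distrib algebra_simps)
    ultimately show "x + y \<in> enlarged N g `` {j}" using layer_add unfolding Image_singleton_iff iff by blast
  next
    fix c :: 'k and x assume "x \<in> enlarged N g `` {j}"
    then obtain a where "(j + 1, x) \<in> P"
      and a: "(j + int k, (tau ^^ k) x - scale a ((tau ^^ i) g)) \<in> P"
      by (auto simp: iff)
    moreover have "(j + int k, (tau ^^ k) (scale c x) - scale (c ^ (q ^ k) * a) ((tau ^^ i) g)) \<in> P"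
      using layer_scale[OF a, of "c ^ (q ^ k)"] by (simp add: tau_pow_scale scale_right_diff_distrib)
    ultimately show "scale c x \<in> enlarged N g `` {j}"
      using layer_scale unfolding Image_singleton_iff iff by blast
  qed
  fix x
  show "(j + 1, x) \<in> enlarged N g" if "(j, x) \<in> enlarged N g"
    using that enlarged_superset unfolding iff by blast
  show "x = 0" if "j < 0" "(j, x) \<in> enlarged N g"
  proof -
    have x: "(j + 1, x) \<in> P"
      and "\<exists>c. (j + int k, (tau ^^ k) x - scale c ((tau ^^ i) g)) \<in> P"
      using that(2) by (auto simp: iff)
    then obtain c where c: "(j + int k, (tau ^^ k) x - scale c ((tau ^^ i) g)) \<in> P" by blast
    show ?thesis
    proof (cases "j = -1")
      case False
      then show ?thesis using that x layer_negative by auto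
    next
      case True
      then have k: "k = nat N" "i = 0" using N by (simp_all add: k_def i_def)
      have c': "(N - 1, (tau ^^ nat N) x - scale c g) \<in> P"
        using c True N by (simp add: k)
      show ?thesis
      proof (cases "c = 0")
        case True
        then have "(-1 + int (nat N), (tau ^^ nat N) x) \<in> P" using c' N by simp
        then show ?thesis unfolding layer_tau_pow using layer_negative[of "-1" x] by simp
      next
        case False
        obtain b where b: "b ^ (q ^ nat N) = inverse c" using frobenius_root by blast
        have "(N - 1, scale (- inverse c) ((tau ^^ nat N) x - scale c g)) \<in> P"
          using layer_scale[OF c'] .
        also have "scale (- inverse c) ((tau ^^ nat N) x - scale c g) = g - (tau ^^ nat N) (scale b x)"
          using False by (simp add: tau_pow_scale b scale_right_diff_distrib)
        finally have "(N - 1, g - (tau ^^ nat N) (scale b x)) \<in> P" .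
        moreover have "(0, scale b x) \<in> P" using x True \<open>j = -1\<close> by (intro layer_scale) simp
        ultimately show ?thesis using new by blast
      qed
    qed
  qed
  show "(j + 1, tau x) \<in> enlarged N g \<longleftrightarrow> (j, x) \<in> enlarged N g"
  proof -
    have "(j + 1, tau x) \<in> enlarged N g \<longleftrightarrow> (j + 1 + 1, tau x) \<in> P \<and>
        (\<exists>c. (j + 1 + int k, (tau ^^ k) (tau x) - scale c ((tau ^^ Suc i) g)) \<in> P)"
      by (rule enlarged_iff) (use ki in simp)
    also have "(\<exists>c. (j + 1 + int k, (tau ^^ k) (tau x) - scale c ((tau ^^ Suc i) g)) \<in> P) \<longleftrightarrow>
        (\<exists>c. (j + int k, (tau ^^ k) x - scale c ((tau ^^ i) g)) \<in> P)"
    proof -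
      have *: "(j + 1 + int k, (tau ^^ k) (tau x) - scale (b ^ (q ^ 1)) ((tau ^^ Suc i) g)) \<in> P \<longleftrightarrow>
          (j + int k, (tau ^^ k) x - scale b ((tau ^^ i) g)) \<in> P" for b
        using tau_pow_combination[of j 1 k x b i g]
        by (simp add: funpow_swap1 algebra_simps)
      have "\<exists>b. b ^ (q ^ 1) = c" for c :: 'k by (rule frobenius_root)
      then show ?thesis using * by metis
    qed
    finally show ?thesis unfolding layer_tau iff .
  qed
  show "(j + int s, (t ^^ n) x) \<in> enlarged N g \<longleftrightarrow> (j, x) \<in> enlarged N g"
  proof -
    have 1: "(j + int s, (t ^^ n) x) \<in> enlarged N g \<longleftrightarrow> (j + int s + 1, (t ^^ n) x) \<in> P \<and>
        (\<exists>c. (j + int s + int k, (tau ^^ k) ((t ^^ n) x) - scale c ((tau ^^ (i + s)) g)) \<in> P)"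
      by (rule enlarged_iff) (use ki in simp)
    have 2: "(j + int s + 1, (t ^^ n) x) \<in> P \<longleftrightarrow> (j + 1, x) \<in> P"
      using layer_t[of "j + 1" x] by (simp add: algebra_simps)
    \<comment> \<open>Up to lower degree, \<open>t\<^sup>n\<close> maps \<open>\<tau>\<^sup>k x - c \<tau>\<^sup>i g\<close> to \<open>\<tau>\<^sup>k t\<^sup>n x - c \<tau>\<^bsup>i+s\<^esup> g\<close>.\<close>
    have 3: "(j + int s + int k, (tau ^^ k) ((t ^^ n) x) - scale c ((tau ^^ (i + s)) g)) \<in> P \<longleftrightarrow>
        (j + int k, (tau ^^ k) x - scale c ((tau ^^ i) g)) \<in> P" for c
    proof -
      have "((N + int s - 1) + int i, (tau ^^ i) ((t ^^ n) g - (tau ^^ s) g)) \<in> P"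
        using g by (simp only: layer_tau_pow)
      moreover have "N + int s - 1 + int i = j + int s + int k" using ki by simp
      ultimately have d: "(j + int s + int k, scale c ((tau ^^ i) ((t ^^ n) g - (tau ^^ s) g))) \<in> P"
        using layer_scale by metis
      let ?l = "(tau ^^ k) ((t ^^ n) x) - scale c ((tau ^^ (i + s)) g)"
      let ?r = "(t ^^ n) ((tau ^^ k) x - scale c ((tau ^^ i) g))"
      have eq: "?r + scale c ((tau ^^ i) ((t ^^ n) g - (tau ^^ s) g)) = ?l"
        by (simp add: t_pow_simps tau_pow_simps t_pow_tau_pow funpow_add algebra_simps)
      have "(j + int s + int k, ?l) \<in> P \<longleftrightarrow> (j + int s + int k, ?r) \<in> P"
        using layer_add[OF _ d, of ?r] layer_diff[OF _ d, of ?l] eq by (metis add_diff_cancel_right')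
      moreover have "j + int s + int k = (j + int k) + int s" by simp
      ultimately show ?thesis using layer_t by metis
    qed
    show ?thesis unfolding 1 2 3 iff ..
  qed
next
  show "\<exists>j. (j, x) \<in> enlarged N g" for x
    using layer_exhaustive[of x] enlarged_superset[of N g] by blast
qed

lemma enlarged_new_element:
  assumes "(N, g) \<in> P"
  shows "(N - 1, g) \<in> enlarged N g"
proof -
  have "(N - 1, g) \<in> enlarged N g \<longleftrightarrow> (N - 1 + 1, g) \<in> P \<and>
      (\<exists>c. (N - 1 + int 0, (tau ^^ 0) g - scale c ((tau ^^ 0) g)) \<in> P)"
    by (rule enlarged_iff) simp
  moreover have "(tau ^^ 0) g - scale 1 ((tau ^^ 0) g) = 0" by simp
  ultimately show ?thesis using assms layer_zero by (metis diff_add_cancel)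
qed

end

end

section \<open>Maximal filtrations\<close>

context cofinite_frobenius_space
begin

lemma degree_filtration_Union:
  assumes C: "C \<noteq> {}" "\<And>P. P \<in> C \<Longrightarrow> degree_filtration n s P"
    and chain: "\<And>P P'. P \<in> C \<Longrightarrow> P' \<in> C \<Longrightarrow> P \<subseteq> P' \<or> P' \<subseteq> P"
  shows "degree_filtration n s (\<Union>C)"
  unfolding degree_filtration_def
proof (intro conjI allI impI)
  obtain P0 where P0: "P0 \<in> C" using C(1) by blast
  show "subspace (\<Union>C `` {j})" for j
  proof (rule subspaceI)
    show "0 \<in> \<Union>C `` {j}" using P0 layer_zero[OF C(2)[OF P0]] by blast
  next
    fix x y assume "x \<in> \<Union>C `` {j}" "y \<in> \<Union>C `` {j}"
    then obtain P P' where P: "P \<in> C" "(j, x) \<in> P" and P': "P' \<in> C" "(j, y) \<in> P'" by blast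
    obtain P'' where P'': "P'' \<in> C" "(j, x) \<in> P''" "(j, y) \<in> P''"
      using chain[OF P(1) P'(1)] P P' by blast
    show "x + y \<in> \<Union>C `` {j}" using layer_add[OF C(2)[OF P''(1)] P''(2,3)] P''(1) by blast
  next
    fix c :: 'k and x assume "x \<in> \<Union>C `` {j}"
    then obtain P where P: "P \<in> C" "(j, x) \<in> P" by blast
    show "scale c x \<in> \<Union>C `` {j}" using layer_scale[OF C(2)[OF P(1)] P(2), of c] P(1) by blast
  qed
  show "(j + 1, x) \<in> \<Union>C" if "(j, x) \<in> \<Union>C" for j x
    using that layer_mono[OF C(2), of _ j x "j + 1"] by fastforce
  show "\<exists>j. (j, x) \<in> \<Union>C" for x
    using layer_exhaustive[OF C(2)[OF P0], of x] P0 by blast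
  show "x = 0" if "j < 0" "(j, x) \<in> \<Union>C" for j x
    using that layer_negative[OF C(2), of _ j x] by blast
  show "(j + 1, tau x) \<in> \<Union>C \<longleftrightarrow> (j, x) \<in> \<Union>C" for j x
    using layer_tau[OF C(2), of _ j x] by blast
  show "(j + int s, (t ^^ n) x) \<in> \<Union>C \<longleftrightarrow> (j, x) \<in> \<Union>C" for j x
    using layer_t[OF C(2), of _ j x] by blast
qed

lemma maximal_degree_filtration:
  assumes "degree_filtration n s P"
  shows "\<exists>P. degree_filtration n s P \<and> (\<forall>P'. degree_filtration n s P' \<longrightarrow> P \<subseteq> P' \<longrightarrow> P' = P)"
proof -
  have "\<exists>P\<in>{P. degree_filtration n s P}. \<forall>X\<in>{P. degree_filtration n s P}. P \<subseteq> X \<longrightarrow> X = P"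
  proof (rule subset_Zorn_nonempty)
    show "{P. degree_filtration n s P} \<noteq> {}" using assms by blast
    show "\<Union>C \<in> {P. degree_filtration n s P}"
      if "C \<noteq> {}" "subset.chain {P. degree_filtration n s P} C" for C
      using that degree_filtration_Union[of C n s] unfolding subset_chain_def by blast
  qed
  then show ?thesis by blast
qed

text \<open>
  For large \<open>N\<close> all fixed vectors of \<open>G\<^sub>N\<close> lie in the image \<open>U / F\<^bsub>N-1\<^esub>\<close> of \<open>\<tau>\<^sup>N F\<^sub>0\<close>, as otherwise the
  filtration could be enlarged; since they span, \<open>U\<close> is all of \<open>F\<^sub>N\<close>.  Dividing by a power of \<open>\<tau>\<close>
  transfers this to every degree \<open>j\<close>.
\<close>

lemma maximal_filtration_generated:
  assumes F: "degree_filtration n s P" and s: "1 \<le> s"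
    and max: "\<And>P'. degree_filtration n s P' \<Longrightarrow> P \<subseteq> P' \<Longrightarrow> P' = P"
    and x: "(int j, x) \<in> P"
  shows "\<exists>w. (0, w) \<in> P \<and> (int j - 1, x - (tau ^^ j) w) \<in> P"
proof -
  obtain N0 where N0: "0 \<le> N0" "\<And>N. N0 \<le> N \<Longrightarrow> P `` {N} \<subseteq>
      span {g \<in> P `` {N}. (t ^^ n) g - (tau ^^ s) g \<in> P `` {N + int s - 1}}"
    using layer_fixed_vectors_span[OF F s] by blast
  define N where "N = j + nat N0"
  have N: "N0 \<le> int N" by (simp add: N_def)
  define U where "U = {y + z | y z. y \<in> (tau ^^ N) ` (P `` {0}) \<and> z \<in> P `` {int N - 1}}"
  have U: "subspace U"
    unfolding U_def by (intro subspace_sums subspace_tau_pow_image layer_subspace[OF F])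
  have "g \<in> U" if g: "(int N, g) \<in> P" "(int N + int s - 1, (t ^^ n) g - (tau ^^ s) g) \<in> P" for g
  proof (rule ccontr)
    assume gU: "g \<notin> U"
    have "(int N - 1, g - (tau ^^ nat (int N)) w) \<notin> P" if "(0, w) \<in> P" for w
    proof
      assume "(int N - 1, g - (tau ^^ nat (int N)) w) \<in> P"
      moreover have "g = (tau ^^ N) w + (g - (tau ^^ nat (int N)) w)" by simp
      ultimately show False using gU that unfolding U_def by blast
    qed
    then have "degree_filtration n s (enlarged P (int N) g)"
      by (intro enlarged_filtration[OF F g(2)]) simp_all
    then have "enlarged P (int N) g = P" by (rule max[OF _ enlarged_superset[OF F]])
    then have "(int N - 1, g) \<in> P" using enlarged_new_element[OF F g(1)] by simp
    moreover have "g = (tau ^^ N) 0 + g" by (simp add: tau_pow_simps)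
    ultimately show False using gU layer_zero[OF F, of 0] unfolding U_def by blast
  qed
  then have "span {g \<in> P `` {int N}. (t ^^ n) g - (tau ^^ s) g \<in> P `` {int N + int s - 1}} \<subseteq> U"
    by (intro span_minimal[OF _ U]) auto
  moreover have "(int N, (tau ^^ nat N0) x) \<in> P"
    using x layer_tau_pow[OF F, of "int j" "nat N0" x] by (simp add: N_def)
  ultimately have "(tau ^^ nat N0) x \<in> U" using N0(2)[OF N] by blast
  then obtain w z where w: "(0, w) \<in> P" and z: "(int N - 1, z) \<in> P"
    and eq: "(tau ^^ nat N0) x = (tau ^^ N) w + z"
    unfolding U_def by blast
  have "(tau ^^ N) w = (tau ^^ nat N0) ((tau ^^ j) w)"
    by (simp add: N_def add.commute[of j] funpow_add)
  then have "(tau ^^ nat N0) (x - (tau ^^ j) w) = z"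
    using eq by (simp add: tau_pow_simps)
  moreover have "int N - 1 = (int j - 1) + int (nat N0)" by (simp add: N_def)
  ultimately have "(int j - 1, x - (tau ^^ j) w) \<in> P"
    using z layer_tau_pow[OF F] by metis
  then show ?thesis using w by blast
qed

end

section \<open>Bases over the skew polynomial ring\<close>

context frobenius_space
begin

definition tau_combination :: "nat \<Rightarrow> (nat \<Rightarrow> 'm) \<Rightarrow> (nat \<Rightarrow> nat \<Rightarrow> 'k) \<Rightarrow> nat \<Rightarrow> 'm" where
  "tau_combination d \<kappa> c N = (\<Sum>k<d. \<Sum>i<N. scale (c k i) ((tau ^^ i) (\<kappa> k)))"

definition tau_basis :: "nat \<Rightarrow> (nat \<Rightarrow> 'm) \<Rightarrow> bool" where
  "tau_basis d \<kappa> \<longleftrightarrow> (\<forall>x. \<exists>N c. x = tau_combination d \<kappa> c N) \<and>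
     (\<forall>N c. tau_combination d \<kappa> c N = 0 \<longrightarrow> (\<forall>k<d. \<forall>i<N. c k i = 0))"

lemma tau_combination_0 [simp]: "tau_combination d \<kappa> c 0 = 0"
  by (simp add: tau_combination_def)

lemma tau_combination_Suc:
  "tau_combination d \<kappa> c (Suc N) =
     tau_combination d \<kappa> c N + (\<Sum>k<d. scale (c k N) ((tau ^^ N) (\<kappa> k)))"
  by (simp add: tau_combination_def sum.distrib)

lemma tau_combination_cong:
  "(\<And>k i. k < d \<Longrightarrow> i < N \<Longrightarrow> c k i = c' k i) \<Longrightarrow>
     tau_combination d \<kappa> c N = tau_combination d \<kappa> c' N"
  unfolding tau_combination_def by (intro sum.cong) simp_all

lemma tau_combination_add:
  "tau_combination d \<kappa> (\<lambda>k i. c k i + c' k i) N =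
     tau_combination d \<kappa> c N + tau_combination d \<kappa> c' N"
  by (simp add: tau_combination_def scale_left_distrib sum.distrib)

lemma tau_combination_diff:
  "tau_combination d \<kappa> (\<lambda>k i. c k i - c' k i) N =
     tau_combination d \<kappa> c N - tau_combination d \<kappa> c' N"
  by (simp add: tau_combination_def scale_left_diff_distrib sum_subtractf)

lemma tau_combination_scale:
  "tau_combination d \<kappa> (\<lambda>k i. a * c k i) N = scale a (tau_combination d \<kappa> c N)"
  by (simp add: tau_combination_def scale_sum_right)

lemma tau_combination_sum:
  "tau_combination d \<kappa> (\<lambda>k i. \<Sum>j\<in>J. x j * c j k i) N =
     (\<Sum>j\<in>J. scale (x j) (tau_combination d \<kappa> (c j) N))"
proof (cases "finite J")
  case True
  then show ?thesis
  proof (induction J)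
    case empty
    show ?case by (simp add: tau_combination_def)
  next
    case (insert j J)
    then show ?case by (simp add: tau_combination_add tau_combination_scale)
  qed
qed (simp add: tau_combination_def)

lemma tau_combination_extend:
  assumes "N \<le> N'"
  shows "tau_combination d \<kappa> c N = tau_combination d \<kappa> (\<lambda>k i. if i < N then c k i else 0) N'"
proof -
  have "(\<Sum>i<N. scale (c k i) ((tau ^^ i) (\<kappa> k))) =
      (\<Sum>i<N'. scale (if i < N then c k i else 0) ((tau ^^ i) (\<kappa> k)))" for k
    using assms by (intro sum.mono_neutral_cong_left) auto
  then show ?thesis by (simp add: tau_combination_def)
qed

lemma tau_tau_combination:
  "tau (tau_combination d \<kappa> c N) =
     tau_combination d \<kappa> (\<lambda>k i. case i of 0 \<Rightarrow> 0 | Suc i \<Rightarrow> c k i ^ q) (Suc N)"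
proof -
  have "(tau ^^ 1) (tau_combination d \<kappa> c N) =
      (\<Sum>k<d. \<Sum>i<N. scale (c k i ^ q) ((tau ^^ Suc i) (\<kappa> k)))"
    unfolding tau_combination_def tau_pow_sum tau_pow_scale by simp
  then show ?thesis by (simp add: tau_combination_def sum.lessThan_Suc_shift del: sum.lessThan_Suc)
qed

text \<open>The constant terms remain modulo \<open>\<tau>\<close>; the rest is divisible by \<open>\<tau>\<close> because \<open>K\<close> is perfect.\<close>

lemma tau_combination_modulo_tau:
  "\<exists>y. tau_combination d \<kappa> c N - tau y \<in> span (\<kappa> ` {..<d})"
proof (cases N)
  case 0
  have "tau_combination d \<kappa> c N - tau 0 = 0"
    using tau_pow_simps(2)[of 1] by (simp add: 0)
  then show ?thesis by (metis span_zero)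
next
  case (Suc M)
  have "\<forall>k i. \<exists>b. b ^ q = c k (Suc i)" using frobenius_root[of 1] by simp
  then obtain b where b: "\<And>k i. b k i ^ q = c k (Suc i)" by metis
  have "tau_combination d \<kappa> c (Suc M) =
      tau (tau_combination d \<kappa> b M) + (\<Sum>k<d. scale (c k 0) (\<kappa> k))"
    unfolding tau_tau_combination
    by (simp add: tau_combination_def b sum.lessThan_Suc_shift sum.distrib del: sum.lessThan_Suc)
  moreover have "(\<Sum>k<d. scale (c k 0) (\<kappa> k)) \<in> span (\<kappa> ` {..<d})"
    by (intro span_sum span_scale span_base) auto
  ultimately show ?thesis
    by (intro exI[of _ "tau_combination d \<kappa> b M"]) (simp add: Suc)
qed

lemma tau_basis_cofinite:
  assumes "tau_basis d \<kappa>"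
  shows "\<exists>Y. finite Y \<and> (\<forall>x. \<exists>y. x - tau y \<in> span Y)"
proof (intro exI[of _ "\<kappa> ` {..<d}"] conjI allI)
  fix x
  obtain N c where "x = tau_combination d \<kappa> c N" using assms unfolding tau_basis_def by blast
  then show "\<exists>y. x - tau y \<in> span (\<kappa> ` {..<d})" using tau_combination_modulo_tau by simp
qed simp

text \<open>For a basis, degrees in \<open>\<tau>\<close> can be read off from the coefficients.\<close>

lemma tau_combination_eq_iff:
  assumes "tau_basis d \<kappa>"
  shows "(\<exists>c'. tau_combination d \<kappa> c N = tau_combination d \<kappa> c' M) \<longleftrightarrow>
    (\<forall>k<d. \<forall>i<N. M \<le> i \<longrightarrow> c k i = 0)"
proof
  assume "\<exists>c'. tau_combination d \<kappa> c N = tau_combination d \<kappa> c' M"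
  then obtain c' where c': "tau_combination d \<kappa> c N = tau_combination d \<kappa> c' M" by blast
  let ?L = "max N M"
  let ?a = "\<lambda>k i. if i < N then c k i else 0" and ?b = "\<lambda>k i. if i < M then c' k i else 0"
  have "tau_combination d \<kappa> ?a ?L = tau_combination d \<kappa> ?b ?L"
    using c' by (simp flip: tau_combination_extend)
  then have "tau_combination d \<kappa> (\<lambda>k i. ?a k i - ?b k i) ?L = 0"
    unfolding tau_combination_diff by simp
  then have "\<forall>k<d. \<forall>i<?L. ?a k i - ?b k i = 0"
    using assms unfolding tau_basis_def by blast
  then show "\<forall>k<d. \<forall>i<N. M \<le> i \<longrightarrow> c k i = 0" by fastforce
next
  assume z: "\<forall>k<d. \<forall>i<N. M \<le> i \<longrightarrow> c k i = 0"
  show "\<exists>c'. tau_combination d \<kappa> c N = tau_combination d \<kappa> c' M"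
  proof (cases "N \<le> M")
    case True
    then show ?thesis using tau_combination_extend by blast
  next
    case False
    have "tau_combination d \<kappa> c M = tau_combination d \<kappa> (\<lambda>k i. if i < M then c k i else 0) N"
      using False by (intro tau_combination_extend) simp
    also have "\<dots> = tau_combination d \<kappa> c N"
      using z by (intro tau_combination_cong) auto
    finally show ?thesis by metis
  qed
qed

lemma independent_family:
  assumes "\<And>a. (\<Sum>k<d. scale (a k) (\<kappa> k)) = 0 \<Longrightarrow> \<forall>k<d. a k = 0"
  shows "inj_on \<kappa> {..<d::nat} \<and> independent (\<kappa> ` {..<d})"
proof (rule independent_image_lessThan)
  fix k assume k: "k < d"
  show "\<kappa> k \<notin> span (\<kappa> ` {..<k})"
  proof
    assume "\<kappa> k \<in> span (\<kappa> ` {..<k})"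
    then obtain a where a: "\<kappa> k = (\<Sum>i<k. scale (a i) (\<kappa> i))" using in_span_image_lessThan by blast
    define b where "b i = (if i < k then a i else if i = k then -1 else 0)" for i
    have "(\<Sum>i<d. scale (b i) (\<kappa> i)) = (\<Sum>i<Suc k. scale (b i) (\<kappa> i))"
      using k by (intro sum.mono_neutral_right) (auto simp: b_def)
    also have "\<dots> = 0" by (simp add: b_def a[symmetric])
    finally show False using assms[of b] k by (auto simp: b_def)
  qed
qed

text \<open>
  The rank is determined by \<open>M\<close>, since a \<open>K{\<tau>}\<close>-basis becomes a \<open>K\<close>-basis of \<open>M / \<tau> M\<close>.
\<close>

lemma tau_basis_rank_le:
  assumes \<kappa>: "tau_basis e \<kappa>" and \<kappa>': "tau_basis d \<kappa>'"
  shows "e \<le> d"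
proof -
  have one: "tau_combination e \<kappa> (\<lambda>k i. a k) 1 = (\<Sum>k<e. scale (a k) (\<kappa> k))" for a
    by (simp add: tau_combination_def)
  have ind: "inj_on \<kappa> {..<e} \<and> independent (\<kappa> ` {..<e})"
  proof (rule independent_family)
    fix a assume "(\<Sum>k<e. scale (a k) (\<kappa> k)) = 0"
    then have "tau_combination e \<kappa> (\<lambda>k i. a k) 1 = 0" by (simp only: one)
    then have "\<forall>k<e. \<forall>i<1::nat. a k = 0" using \<kappa> unfolding tau_basis_def by blast
    then show "\<forall>k<e. a k = 0" by auto
  qed
  have "finite (\<kappa> ` {..<e}) \<and> card (\<kappa> ` {..<e}) \<le> card (\<kappa>' ` {..<d})"
  proof (rule independent_modulo_bound[where U = "span (\<kappa> ` {..<e})" and Z = "range (tau ^^ 1)"])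
    show "subspace (range (tau ^^ 1))" by (rule subspace_tau_pow_image) simp
    show "span (\<kappa> ` {..<e}) \<inter> range (tau ^^ 1) \<subseteq> {0}"
    proof
      fix x assume x: "x \<in> span (\<kappa> ` {..<e}) \<inter> range (tau ^^ 1)"
      then obtain a where a: "x = (\<Sum>k<e. scale (a k) (\<kappa> k))" using in_span_image_lessThan by blast
      obtain y where y: "x = tau y" using x by auto
      obtain N c where c: "y = tau_combination e \<kappa> c N" using \<kappa> unfolding tau_basis_def by blast
      let ?c = "\<lambda>k i. case i of 0 \<Rightarrow> 0 | Suc i \<Rightarrow> c k i ^ q"
      let ?a = "\<lambda>k i. if i < 1 then a k else 0"
      have "tau_combination e \<kappa> ?c (Suc N) = tau_combination e \<kappa> (\<lambda>k i. a k) 1"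
        using a y c by (simp only: one tau_tau_combination)
      also have "\<dots> = tau_combination e \<kappa> ?a (Suc N)"
        by (rule tau_combination_extend) simp
      finally have "tau_combination e \<kappa> (\<lambda>k i. ?c k i - ?a k i) (Suc N) = 0"
        unfolding tau_combination_diff by simp
      then have "\<forall>k<e. \<forall>i<Suc N. ?c k i - ?a k i = 0" using \<kappa> unfolding tau_basis_def by blast
      then have "\<forall>k<e. a k = 0" by fastforce
      then show "x \<in> {0}" using a by simp
    qed
    show "\<exists>z\<in>range (tau ^^ 1). x - z \<in> span (\<kappa>' ` {..<d})" for x
    proof -
      obtain N c where c: "x = tau_combination d \<kappa>' c N" using \<kappa>' unfolding tau_basis_def by blast
      then show ?thesis using tau_combination_modulo_tau[of d \<kappa>' c N] by auto
    qed
    show "independent (\<kappa> ` {..<e})" by (rule ind[THEN conjunct2])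
    show "subspace (span (\<kappa> ` {..<e}))" by (rule subspace_span)
  qed (use span_superset in auto)
  moreover have "card (\<kappa>' ` {..<d}) \<le> d" using card_image_le[of "{..<d}" \<kappa>'] by simp
  ultimately show ?thesis using ind by (auto simp: card_image)
qed

text \<open>
  The second conjunct, injectivity of \<open>x \<mapsto> x D\<^sub>s\<close> on row vectors, is invertibility of the leading matrix in
  the form in which the coefficients of \<open>t\<^sup>n (\<Sum>x\<^sub>i \<kappa>\<^sub>i)\<close> produce it.
\<close>

definition purity_equation ::
    "nat \<Rightarrow> (nat \<Rightarrow> 'm) \<Rightarrow> nat \<Rightarrow> nat \<Rightarrow> (nat \<Rightarrow> nat \<Rightarrow> nat \<Rightarrow> 'k) \<Rightarrow> bool" where
  "purity_equation d \<kappa> n s D \<longleftrightarrow>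
     (\<forall>i<d. (t ^^ n) (\<kappa> i) = tau_combination d \<kappa> (\<lambda>k j. D j i k) (Suc s)) \<and>
     (\<forall>x. (\<forall>k<d. (\<Sum>i<d. x i * D s i k) = 0) \<longrightarrow> (\<forall>i<d. x i = 0))"

end

section \<open>Filtrations and purity equations\<close>

context cofinite_frobenius_space
begin

lemma layer_tau_combination:
  assumes F: "degree_filtration n s P" and \<kappa>: "\<And>k. k < d \<Longrightarrow> (0, \<kappa> k) \<in> P"
  shows "(int N - 1, tau_combination d \<kappa> c N) \<in> P"
proof -
  have "scale (c k i) ((tau ^^ i) (\<kappa> k)) \<in> P `` {int N - 1}" if "k < d" "i < N" for k i
  proof -
    have "(0 + int i, (tau ^^ i) (\<kappa> k)) \<in> P" using layer_tau_pow[OF F] \<kappa>[OF that(1)] by blast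
    then have "(int N - 1, (tau ^^ i) (\<kappa> k)) \<in> P" by (rule layer_mono[OF F]) (use that in simp)
    then show ?thesis using layer_scale[OF F] by blast
  qed
  then have "tau_combination d \<kappa> c N \<in> P `` {int N - 1}"
    unfolding tau_combination_def
    by (intro subspace_sum[OF layer_subspace[OF F]]) auto
  then show ?thesis by simp
qed

text \<open>
  In a maximal filtration every element of degree \<open>j\<close> is \<open>\<tau>\<^sup>j w\<close> up to lower degree, with \<open>w\<close> in \<open>F\<^sub>0\<close>.
  Repeating this expands it in a \<open>K\<close>-basis \<open>\<kappa>\<close> of \<open>F\<^sub>0\<close> down to degree \<open>-1\<close>, where nothing is left, and
  a relation among the \<open>\<tau>\<^sup>i \<kappa>\<^sub>k\<close> would put its leading part into degree \<open>-1\<close>.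
\<close>

theorem degree_filtration_imp_purity_equation:
  assumes "degree_filtration n s P0" and s: "1 \<le> s"
  shows "\<exists>e \<kappa> D. tau_basis e \<kappa> \<and> purity_equation e \<kappa> n s D"
proof -
  obtain P where F: "degree_filtration n s P"
    and max: "\<And>P'. degree_filtration n s P' \<Longrightarrow> P \<subseteq> P' \<Longrightarrow> P' = P"
    using maximal_degree_filtration[OF assms(1)] by blast
  obtain B where B: "finite B" "independent B" "span B = P `` {0}"
    using layer_basis[OF F, of 0] by blast
  define e where "e = card B"
  obtain \<kappa> where \<kappa>: "bij_betw \<kappa> {..<e} B"
    using ex_bij_betw_nat_finite[OF B(1)] by (auto simp: e_def atLeast0LessThan)
  then have \<kappa>B: "\<kappa> ` {..<e} = B" by (simp add: bij_betw_def)
  have \<kappa>P: "(0, \<kappa> k) \<in> P" if "k < e" for k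
    using that \<kappa>B B(3) span_base[of "\<kappa> k" B] by auto
  have \<kappa>ind: "\<forall>k<e. a k = 0" if "(\<Sum>k<e. scale (a k) (\<kappa> k)) = 0" for a
  proof -
    have "(\<Sum>b\<in>B. scale (a (the_inv_into {..<e} \<kappa> b)) b) =
        (\<Sum>k<e. scale (a (the_inv_into {..<e} \<kappa> (\<kappa> k))) (\<kappa> k))"
      by (rule sum.reindex_bij_betw[OF \<kappa>, symmetric])
    also have "\<dots> = (\<Sum>k<e. scale (a k) (\<kappa> k))"
      using \<kappa> by (intro sum.cong) (simp_all add: the_inv_into_f_f bij_betw_def)
    finally have z: "(\<Sum>b\<in>B. scale (a (the_inv_into {..<e} \<kappa> b)) b) = 0" using that by simp
    have "a k = 0" if "k < e" for k
      using independentD[OF B(2,1) subset_refl z, of "\<kappa> k"] that \<kappa> \<kappa>B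
      by (auto simp: the_inv_into_f_f bij_betw_def)
    then show ?thesis by blast
  qed
  have expand: "\<exists>c. x = tau_combination e \<kappa> c N" if "(int N - 1, x) \<in> P" for N x
    using that
  proof (induction N arbitrary: x)
    case 0
    then have "x = 0" using layer_negative[OF F, of "-1" x] by simp
    then show ?case by simp
  next
    case (Suc N)
    then have "(int N, x) \<in> P" by simp
    then obtain w where w: "(0, w) \<in> P" and x: "(int N - 1, x - (tau ^^ N) w) \<in> P"
      using maximal_filtration_generated[OF F s max] by blast
    obtain c where c: "x - (tau ^^ N) w = tau_combination e \<kappa> c N" using Suc.IH[OF x] by blast
    have "w \<in> span (\<kappa> ` {..<e})" using w B(3) \<kappa>B by blast
    then obtain a where a: "w = (\<Sum>k<e. scale (a k) (\<kappa> k))" using in_span_image_lessThan by blast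
    define c' where "c' k i = (if i = N then a k ^ (q ^ N) else c k i)" for k i
    have "tau_combination e \<kappa> c' N = tau_combination e \<kappa> c N"
      by (rule tau_combination_cong) (simp add: c'_def)
    moreover have "(\<Sum>k<e. scale (c' k N) ((tau ^^ N) (\<kappa> k))) = (tau ^^ N) w"
      by (simp add: a tau_pow_sum tau_pow_scale c'_def)
    ultimately have "tau_combination e \<kappa> c' (Suc N) = x"
      using c by (simp add: tau_combination_Suc algebra_simps)
    then show ?case by blast
  qed
  have "\<exists>N c. x = tau_combination e \<kappa> c N" for x
  proof -
    obtain j where "(j, x) \<in> P" using layer_exhaustive[OF F] by blast
    then have "(int (nat (j + 1)) - 1, x) \<in> P" by (rule layer_mono[OF F]) simp
    then show ?thesis using expand by blast
  qed
  moreover have "\<forall>k<e. \<forall>i<N. c k i = 0" if "tau_combination e \<kappa> c N = 0" for N c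
    using that
  proof (induction N)
    case (Suc N)
    have "\<forall>k. \<exists>b. b ^ (q ^ N) = c k N" using frobenius_root by blast
    then obtain b where b: "\<And>k. b k ^ (q ^ N) = c k N" by metis
    have top: "(\<Sum>k<e. scale (c k N) ((tau ^^ N) (\<kappa> k))) = (tau ^^ N) (\<Sum>k<e. scale (b k) (\<kappa> k))"
      by (simp add: tau_pow_sum tau_pow_scale b)
    then have "(tau ^^ N) (\<Sum>k<e. scale (b k) (\<kappa> k)) = 0 - tau_combination e \<kappa> c N"
      using Suc.prems by (simp add: tau_combination_Suc eq_neg_iff_add_eq_0 add.commute)
    also have "(int N - 1, 0 - tau_combination e \<kappa> c N) \<in> P"
      using layer_diff[OF F layer_zero[OF F] layer_tau_combination[OF F \<kappa>P]] .
    finally have "(-1 + int N, (tau ^^ N) (\<Sum>k<e. scale (b k) (\<kappa> k))) \<in> P" by simp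
    then have b0: "(\<Sum>k<e. scale (b k) (\<kappa> k)) = 0"
      unfolding layer_tau_pow[OF F] using layer_negative[OF F, of "-1"] by simp
    then have "\<forall>k<e. b k = 0" by (rule \<kappa>ind)
    then have cN: "\<forall>k<e. c k N = 0" using b q_ge_2 by (metis power_0_left power_not_zero not_numeral_le_zero)
    then have "tau_combination e \<kappa> c N = 0" using Suc.prems by (simp add: tau_combination_Suc)
    then show ?case using Suc.IH cN by (auto simp: less_Suc_eq)
  qed simp
  ultimately have basis: "tau_basis e \<kappa>" unfolding tau_basis_def by blast
  have "\<exists>c. (t ^^ n) (\<kappa> i) = tau_combination e \<kappa> c (Suc s)" if "i < e" for i
  proof -
    have "(0 + int s, (t ^^ n) (\<kappa> i)) \<in> P" using layer_t[OF F] \<kappa>P[OF that] by blast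
    then show ?thesis using expand[of "Suc s"] by simp
  qed
  then obtain C where C: "\<And>i. i < e \<Longrightarrow> (t ^^ n) (\<kappa> i) = tau_combination e \<kappa> (C i) (Suc s)"
    by metis
  \<comment> \<open>If the coefficients of \<open>\<tau>\<^sup>s\<close> cancel, then \<open>t\<^sup>n (\<Sum>x\<^sub>i \<kappa>\<^sub>i)\<close> has degree below \<open>s\<close>, and the sum vanishes.\<close>
  have "\<forall>i<e. x i = 0" if x: "\<forall>k<e. (\<Sum>i<e. x i * C i k s) = 0" for x
  proof -
    have "(t ^^ n) (\<Sum>i<e. scale (x i) (\<kappa> i)) = (\<Sum>i<e. scale (x i) (tau_combination e \<kappa> (C i) (Suc s)))"
      by (simp add: t_pow_sum t_pow_scale C)
    also have "\<dots> = tau_combination e \<kappa> (\<lambda>k j. \<Sum>i<e. x i * C i k j) (Suc s)"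
      by (rule tau_combination_sum[symmetric])
    also have "\<dots> = tau_combination e \<kappa> (\<lambda>k j. \<Sum>i<e. x i * C i k j) s"
      using x by (simp add: tau_combination_Suc)
    finally have "(-1 + int s, (t ^^ n) (\<Sum>i<e. scale (x i) (\<kappa> i))) \<in> P"
      using layer_tau_combination[OF F \<kappa>P, of e "\<lambda>k. k" s] by simp
    then have "(\<Sum>i<e. scale (x i) (\<kappa> i)) = 0"
      unfolding layer_t[OF F] using layer_negative[OF F, of "-1"] by simp
    then show ?thesis by (rule \<kappa>ind)
  qed
  then have "purity_equation e \<kappa> n s (\<lambda>j i k. C i k j)"
    using C by (simp add: purity_equation_def)
  then show ?thesis using basis by blast
qed

text \<open>
  The filtration is the degree in \<open>\<tau>\<close> with respect to \<open>\<kappa>\<close>; \<open>F\<^sub>j\<close> consists of the combinations with fewer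
  than \<open>j + 1\<close> powers of \<open>\<tau>\<close>.  The invertible leading matrix prevents cancellation of the top
  coefficients under \<open>t\<^sup>n\<close>.
\<close>

theorem purity_equation_imp_degree_filtration:
  assumes basis: "tau_basis d \<kappa>" and eqn: "purity_equation d \<kappa> n s D"
  shows "\<exists>P. degree_filtration n s P"
proof -
  define P where "P = {(j, x). \<exists>c. x = tau_combination d \<kappa> c (nat (j + 1))}"
  have iff: "(j, tau_combination d \<kappa> c N) \<in> P \<longleftrightarrow> (\<forall>k<d. \<forall>i<N. nat (j + 1) \<le> i \<longrightarrow> c k i = 0)" for j c N
    using tau_combination_eq_iff[OF basis, of c N "nat (j + 1)"] by (simp add: P_def)
  have combI: "(int N - 1, tau_combination d \<kappa> c N) \<in> P" for c N by (simp add: iff)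
  have ex: "\<exists>N c. x = tau_combination d \<kappa> c N" for x using basis unfolding tau_basis_def by blast
  have sub: "subspace (P `` {j})" for j
  proof (rule subspaceI)
    have "0 = tau_combination d \<kappa> (\<lambda>k i. 0) (nat (j + 1))" by (simp add: tau_combination_def)
    then show "0 \<in> P `` {j}" unfolding P_def by blast
  next
    fix x y assume "x \<in> P `` {j}" "y \<in> P `` {j}"
    then show "x + y \<in> P `` {j}"
      unfolding P_def by (auto simp flip: tau_combination_add)
  next
    fix a :: 'k and x assume "x \<in> P `` {j}"
    then show "scale a x \<in> P `` {j}"
      unfolding P_def by (auto simp flip: tau_combination_scale)
  qed
  have mono: "(j, x) \<in> P" if x: "(i, x) \<in> P" and ij: "i \<le> j" for i j x
  proof -
    obtain c where c: "x = tau_combination d \<kappa> c (nat (i + 1))" using x by (auto simp: P_def)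
    show ?thesis unfolding c iff using ij by auto
  qed
  have q_pos: "0 < q" using q_ge_2 by simp
  then have q0: "a ^ q = 0 \<longleftrightarrow> a = 0" for a :: 'k by simp
  have tau: "(j + 1, tau x) \<in> P \<longleftrightarrow> (j, x) \<in> P" for j x
  proof -
    obtain N c where c: "x = tau_combination d \<kappa> c N" using ex by blast
    show ?thesis
      unfolding c tau_tau_combination iff
      by (auto simp: q0 q_pos less_Suc_eq_0_disj nat_le_iff split: nat.splits)
  qed
  have tau_pow: "(j + int k, (tau ^^ k) x) \<in> P \<longleftrightarrow> (j, x) \<in> P" for j k x
  proof (induction k)
    case (Suc k)
    have "(j + int (Suc k), (tau ^^ Suc k) x) \<in> P \<longleftrightarrow> ((j + int k) + 1, tau ((tau ^^ k) x)) \<in> P"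
      by (simp add: algebra_simps)
    then show ?case unfolding tau Suc .
  qed simp
  have T\<kappa>: "(t ^^ n) (\<kappa> i) = tau_combination d \<kappa> (\<lambda>k j. D j i k) (Suc s)" if "i < d" for i
    using eqn that unfolding purity_equation_def by blast
  have inj: "\<forall>i<d. x i = 0" if "\<forall>k<d. (\<Sum>i<d. x i * D s i k) = 0" for x
    using eqn that unfolding purity_equation_def by blast
  have T_comb: "(int N - 1 + int s, (t ^^ n) (tau_combination d \<kappa> c N)) \<in> P" for N c
  proof -
    have "scale (c k i) ((t ^^ n) ((tau ^^ i) (\<kappa> k))) \<in> P `` {int N - 1 + int s}"
      if "k < d" "i < N" for k i
    proof -
      have "(int s, (t ^^ n) (\<kappa> k)) \<in> P"
        using combI[of "Suc s"] T\<kappa>[OF that(1)] by simp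
      then have "(int s + int i, (tau ^^ i) ((t ^^ n) (\<kappa> k))) \<in> P" by (simp only: tau_pow)
      then have "(int N - 1 + int s, (tau ^^ i) ((t ^^ n) (\<kappa> k))) \<in> P"
        by (rule mono) (use that in simp)
      then show ?thesis using subspace_scale[OF sub, of "(tau ^^ i) ((t ^^ n) (\<kappa> k))"]
        by (simp add: t_pow_tau_pow)
    qed
    then have "(t ^^ n) (tau_combination d \<kappa> c N) \<in> P `` {int N - 1 + int s}"
      unfolding tau_combination_def t_pow_sum t_pow_scale by (intro subspace_sum[OF sub]) auto
    then show ?thesis by simp
  qed
  have T1: "(j + int s, (t ^^ n) x) \<in> P" if x: "(j, x) \<in> P" for j x
  proof -
    obtain c where c: "x = tau_combination d \<kappa> c (nat (j + 1))" using x by (auto simp: P_def)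
    show ?thesis
    proof (cases "j < 0")
      case True
      then show ?thesis using c subspace_0[OF sub] by (simp add: t_pow_simps)
    next
      case False
      then show ?thesis using T_comb[of "nat (j + 1)" c] c by simp
    qed
  qed
  \<comment> \<open>Descend on \<open>N\<close>: while \<open>N\<close> exceeds \<open>j\<close>, the top coefficients have to vanish.\<close>
  have T2: "(j, tau_combination d \<kappa> c N) \<in> P"
    if "(j + int s, (t ^^ n) (tau_combination d \<kappa> c N)) \<in> P" for j c N
    using that
  proof (induction N)
    case 0
    then show ?case using subspace_0[OF sub] by simp
  next
    case (Suc N)
    show ?case
    proof (cases "int N \<le> j")
      case True
      then show ?thesis using mono[OF combI[of "Suc N" c], of j] by simp
    next
      case False
      have "\<forall>k. \<exists>b. b ^ (q ^ N) = c k N" using frobenius_root by blast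
      then obtain b where b: "\<And>k. b k ^ (q ^ N) = c k N" by metis
      let ?top = "\<Sum>k<d. scale (c k N) ((tau ^^ N) (\<kappa> k))"
      have "(t ^^ n) ?top = (tau ^^ N) (\<Sum>k<d. scale (b k) ((t ^^ n) (\<kappa> k)))"
        by (simp add: t_pow_sum t_pow_scale t_pow_tau_pow tau_pow_sum tau_pow_scale b)
      also have "(\<Sum>k<d. scale (b k) ((t ^^ n) (\<kappa> k))) =
          (\<Sum>k<d. scale (b k) (tau_combination d \<kappa> (\<lambda>l j. D j k l) (Suc s)))"
        by (rule sum.cong) (simp_all add: T\<kappa>)
      also have "\<dots> = tau_combination d \<kappa> (\<lambda>l j. \<Sum>k<d. b k * D j k l) (Suc s)"
        by (rule tau_combination_sum[symmetric])
      finally have top: "(t ^^ n) ?top =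
          (tau ^^ N) (tau_combination d \<kappa> (\<lambda>l j. \<Sum>k<d. b k * D j k l) (Suc s))" .
      have "(int N - 1 + int s, (t ^^ n) (tau_combination d \<kappa> c (Suc N))) \<in> P"
        using Suc.prems by (rule mono) (use False in simp)
      then have "(t ^^ n) (tau_combination d \<kappa> c (Suc N)) - (t ^^ n) (tau_combination d \<kappa> c N)
          \<in> P `` {int N - 1 + int s}"
        using T_comb[of N c] by (intro subspace_diff[OF sub]) simp_all
      then have "(t ^^ n) ?top \<in> P `` {int N - 1 + int s}"
        by (simp add: tau_combination_Suc t_pow_add)
      then have "((int s - 1) + int N, (t ^^ n) ?top) \<in> P" by (simp add: algebra_simps)
      then have "\<forall>l<d. (\<Sum>k<d. b k * D s k l) = 0"
        unfolding top tau_pow iff by simp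
      then have "\<forall>k<d. b k = 0" by (rule inj)
      then have "\<forall>k<d. c k N = 0"
        using b q_ge_2 by (metis power_0_left power_not_zero not_numeral_le_zero)
      then have "tau_combination d \<kappa> c (Suc N) = tau_combination d \<kappa> c N"
        by (simp add: tau_combination_Suc)
      then show ?thesis using Suc by simp
    qed
  qed
  have "degree_filtration n s P"
    unfolding degree_filtration_def
  proof (intro conjI allI impI)
    show "\<exists>j. (j, x) \<in> P" for x using ex[of x] combI by metis
    show "x = 0" if "j < 0" "(j, x) \<in> P" for j x using that by (auto simp: P_def)
    show "(j + int s, (t ^^ n) x) \<in> P \<longleftrightarrow> (j, x) \<in> P" for j x
    proof -
      obtain N c where "x = tau_combination d \<kappa> c N" using ex by blast
      then show ?thesis using T1 T2 by blast
    qed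
    show "(j + 1, x) \<in> P" if "(j, x) \<in> P" for j x using mono[OF that, of "j + 1"] by simp
  qed (rule sub tau)+
  then show ?thesis ..
qed

section \<open>Uniqueness of the slope\<close>

text \<open>
  From some degree \<open>A\<close> on, \<open>F\<^bsub>j+1\<^esub> = \<tau> F\<^sub>j + F\<^sub>A\<close>.  So a bound for the second degree on the
  finite-dimensional space \<open>F\<^sub>A\<close> propagates upwards with a constant shift.
\<close>

lemma filtration_comparison:
  assumes F: "degree_filtration n s P" and F': "degree_filtration n' s' P'"
  shows "\<exists>A\<ge>0. \<exists>C. \<forall>i x. (A + int i, x) \<in> P \<longrightarrow> (C + int i, x) \<in> P'"
proof -
  obtain Y where Y: "finite Y" "\<And>x. \<exists>y. x - tau y \<in> span Y" using tau_cofinite by blast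
  obtain A where A: "0 \<le> A" "Y \<subseteq> P `` {A}" using finite_subset_layer[OF F Y(1)] by blast
  obtain B where B: "finite B" "span B = P `` {A}" using layer_basis[OF F, of A] by blast
  obtain C where C: "B \<union> Y \<subseteq> P' `` {C}"
    using finite_subset_layer[OF F', of "B \<union> Y"] B(1) Y(1) by blast
  have "(C + int i, x) \<in> P'" if "(A + int i, x) \<in> P" for i x
    using that
  proof (induction i arbitrary: x)
    case 0
    then have "x \<in> span B" using B by simp
    then show ?case using layer_span[OF F', of B C x] C by simp
  next
    case (Suc i)
    obtain y where y: "x - tau y \<in> span Y" using Y(2) by blast
    have "(A, x - tau y) \<in> P" by (rule layer_span[OF F A(2) y])
    then have "(A + int (Suc i), x - tau y) \<in> P" by (rule layer_mono[OF F]) simp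
    from layer_diff[OF F Suc.prems this] have "((A + int i) + 1, tau y) \<in> P"
      by (simp add: algebra_simps)
    then have "(C + int i, y) \<in> P'" unfolding layer_tau[OF F] by (rule Suc.IH)
    then have 1: "(C + int i + 1, tau y) \<in> P'" unfolding layer_tau[OF F'] .
    have "(C, x - tau y) \<in> P'" using layer_span[OF F' _ y] C by blast
    then have 2: "(C + int i + 1, x - tau y) \<in> P'" by (rule layer_mono[OF F']) simp
    have "(C + int i + 1, tau y + (x - tau y)) \<in> P'" by (rule layer_add[OF F' 1 2])
    then show ?case by (simp add: algebra_simps)
  qed
  then show ?thesis using A(1) by blast
qed

text \<open>
  Applied to a fixed \<open>x\<close>, the power \<open>t\<^bsup>n n' k\<^esup>\<close> raises the first degree by \<open>s n' k\<close> and the second by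
  \<open>s' n k\<close>.  As the second degree exceeds the first by a bounded amount only, \<open>s' n \<le> s n'\<close>.
\<close>

lemma filtration_slope_le:
  fixes x :: 'm
  assumes F: "degree_filtration n s P" and F': "degree_filtration n' s' P'" and x: "x \<noteq> 0"
  shows "n * s' \<le> n' * s"
proof (rule ccontr)
  assume less: "\<not> n * s' \<le> n' * s"
  obtain A C where AC: "\<And>i x. (A + int i, x) \<in> P \<Longrightarrow> (C + int i, x) \<in> P'"
    using filtration_comparison[OF F F'] by blast
  obtain a where a: "(a, x) \<in> P" using layer_exhaustive[OF F] by blast
  define i0 where "i0 = nat (a - A)"
  have i0: "(A + int i0, x) \<in> P"
    using a by (rule layer_mono[OF F]) (simp add: i0_def)
  define k where "k = nat (C + int i0 + 1)"
  have "(A + int i0 + int (s * (n' * k)), (t ^^ (n * (n' * k))) x) \<in> P"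
    using i0 by (simp only: layer_t_pow[OF F])
  then have "(C + int (i0 + s * (n' * k)), (t ^^ (n * (n' * k))) x) \<in> P'"
    by (intro AC) (simp add: algebra_simps)
  moreover have "C + int (i0 + s * (n' * k)) =
      (C + int (i0 + s * (n' * k)) - int (s' * (n * k))) + int (s' * (n * k))" by simp
  moreover have "n * (n' * k) = n' * (n * k)" by simp
  ultimately have "(C + int (i0 + s * (n' * k)) - int (s' * (n * k)), x) \<in> P'"
    using layer_t_pow[OF F'] by metis
  moreover have "C + int (i0 + s * (n' * k)) - int (s' * (n * k)) < 0"
  proof -
    have "(n' * s + 1) * k \<le> (n * s') * k" using less by (intro mult_le_mono1) simp
    then have "s * (n' * k) + k \<le> s' * (n * k)" by (simp add: algebra_simps)
    then show ?thesis using k_def by linarith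
  qed
  ultimately show False using layer_negative[OF F'] x by blast
qed

theorem filtration_slope_unique:
  fixes x :: 'm
  assumes "degree_filtration n s P" "degree_filtration n' s' P'" "x \<noteq> 0"
  shows "n * s' = n' * s"
  using filtration_slope_le[OF assms] filtration_slope_le[OF assms(2,1,3)] by simp

section \<open>From pole orders to degrees\<close>

text \<open>
  The family \<open>E\<close> measures pole orders, for which \<open>\<tau>\<^sup>v\<close> but not \<open>\<tau>\<close> has a definite effect.  Degree at most
  \<open>j\<close> means that each \<open>\<tau>\<^sup>b x\<close> has pole order at most \<open>u (b + j) / v\<close>; this is written with integers \<open>c\<close>
  above that bound.  The conditions for \<open>b\<close> and \<open>b + v\<close> are equivalent, so shifting \<open>b\<close> by one shows
  that \<open>\<tau>\<close> raises the degree by exactly one.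
\<close>

theorem pole_filtration_imp_degree_filtration:
  assumes sub: "\<And>c. subspace (E c)"
    and mono: "\<And>c x. x \<in> E c \<Longrightarrow> x \<in> E (c + 1)"
    and exh: "\<And>x. \<exists>c. x \<in> E c"
    and sep: "E c0 = {0}"
    and Et: "\<And>c x. t x \<in> E (c + 1) \<longleftrightarrow> x \<in> E c"
    and Etau: "\<And>c x. (tau ^^ v) x \<in> E (c + int u) \<longleftrightarrow> x \<in> E c"
    and uv: "0 < u" "0 < v" and ns: "n * v = s * u"
  shows "\<exists>P. degree_filtration n s P"
proof -
  have mono': "x \<in> E d" if "x \<in> E c" "c \<le> d" for c d x
  proof -
    have "x \<in> E (c + int k)" for k
    proof (induction k)
      case (Suc k)
      then show ?case using mono[of x "c + int k"] by (simp add: algebra_simps)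
    qed (use that in simp)
    from this[of "nat (d - c)"] show ?thesis using that by simp
  qed
  have Et': "(t ^^ k) x \<in> E c \<longleftrightarrow> x \<in> E (c - int k)" for k c x
  proof (induction k arbitrary: c)
    case (Suc k)
    have "(t ^^ Suc k) x \<in> E c \<longleftrightarrow> t ((t ^^ k) x) \<in> E ((c - 1) + 1)" by simp
    also have "\<dots> \<longleftrightarrow> x \<in> E (c - 1 - int k)" unfolding Et Suc ..
    also have "c - 1 - int k = c - int (Suc k)" by simp
    finally show ?case .
  qed simp
  have Etau': "(tau ^^ (v + b)) x \<in> E c \<longleftrightarrow> (tau ^^ b) x \<in> E (c - int u)" for b c x
    using Etau[of "(tau ^^ b) x" "c - int u"] by (simp add: funpow_add)
  define F where "F j = {x. \<forall>b c. int u * (int b + j) \<le> int v * c \<longrightarrow> (tau ^^ b) x \<in> E c}" for j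
  \<comment> \<open>In degrees up to \<open>j0\<close> there is only \<open>0\<close>, because \<open>u * j0 \<le> v * c0\<close>.\<close>
  define j0 where "j0 = - int v * \<bar>c0\<bar>"
  have F0: "x = 0" if "x \<in> F j" "j \<le> j0" for j x
  proof -
    have "int u * j \<le> int u * j0" using that(2) by (intro mult_left_mono) simp_all
    also have "\<dots> = - (int v * (int u * \<bar>c0\<bar>))" by (simp add: j0_def)
    also have "\<dots> \<le> - (int v * \<bar>c0\<bar>)"
      using uv by (simp add: mult_left_mono mult_le_cancel_right1)
    also have "\<dots> = int v * (- \<bar>c0\<bar>)" by simp
    also have "\<dots> \<le> int v * c0" by (intro mult_left_mono) simp_all
    finally have "int u * (int 0 + j) \<le> int v * c0" by simp
    then have "(tau ^^ 0) x \<in> E c0" using that(1) unfolding F_def by blast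
    then show ?thesis using sep by simp
  qed
  have Fmono: "x \<in> F j'" if "x \<in> F j" "j \<le> j'" for j j' x
    unfolding F_def
  proof (intro CollectI allI impI)
    fix b c assume "int u * (int b + j') \<le> int v * c"
    moreover have "int u * (int b + j) \<le> int u * (int b + j')"
      using that(2) by (intro mult_left_mono) simp_all
    ultimately show "(tau ^^ b) x \<in> E c" using that(1) unfolding F_def by fastforce
  qed
  have "subspace (F j)" for j
  proof (rule subspaceI)
    show "0 \<in> F j" using subspace_0[OF sub] by (simp add: F_def tau_pow_simps)
    show "x + y \<in> F j" if "x \<in> F j" "y \<in> F j" for x y
      using that subspace_add[OF sub] by (simp add: F_def tau_pow_add)
    show "scale a x \<in> F j" if "x \<in> F j" for a x
      using that subspace_scale[OF sub] by (simp add: F_def tau_pow_scale)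
  qed
  moreover have "\<exists>j. x \<in> F j" for x
  proof -
    have "\<exists>C\<ge>0. \<forall>b<k. (tau ^^ b) x \<in> E C" for k
    proof (induction k)
      case (Suc k)
      then obtain C where C: "0 \<le> C" "\<forall>b<k. (tau ^^ b) x \<in> E C" by blast
      obtain C' where "(tau ^^ k) x \<in> E C'" using exh by blast
      then have "\<forall>b<Suc k. (tau ^^ b) x \<in> E (max C C')"
        using C mono'[of _ C "max C C'"] mono'[of _ C' "max C C'"] by (auto simp: less_Suc_eq)
      then show ?case using C(1) by (intro exI[of _ "max C C'"]) simp
    qed auto
    then obtain C where C: "0 \<le> C" "\<And>b. b < v \<Longrightarrow> (tau ^^ b) x \<in> E C" by blast
    have "(tau ^^ b) x \<in> E c" if "int u * (int b + int v * C) \<le> int v * c" for b c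
      using that
    proof (induction b arbitrary: c rule: less_induct)
      case (less b)
      show ?case
      proof (cases "b < v")
        case True
        have "int v * C \<le> int u * (int v * C)"
          using uv C(1) mult_right_mono[of 1 "int u" "int v * C"] by simp
        also have "\<dots> \<le> int u * (int b + int v * C)" by (intro mult_left_mono) simp_all
        also have "\<dots> \<le> int v * c" by (rule less.prems)
        finally have "C \<le> c" using uv by simp
        then show ?thesis using mono' C(2)[OF True] by blast
      next
        case False
        then obtain b' where b': "b = v + b'" using le_Suc_ex not_less by blast
        have "int u * (int b' + int v * C) \<le> int v * (c - int u)"
          using less.prems by (simp add: b' algebra_simps)
        then have "(tau ^^ b') x \<in> E (c - int u)" using less.IH[of b'] uv by (simp add: b')
        then show ?thesis by (simp only: b' Etau')
      qed
    qed
    then have "x \<in> F (int v * C)" by (simp add: F_def)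
    then show ?thesis ..
  qed
  moreover have "tau x \<in> F (j + 1) \<longleftrightarrow> x \<in> F j" for j x
  proof
    assume x: "x \<in> F j"
    show "tau x \<in> F (j + 1)"
      unfolding F_def
    proof (intro CollectI allI impI)
      fix b c assume "int u * (int b + (j + 1)) \<le> int v * c"
      then have "int u * (int (Suc b) + j) \<le> int v * c" by (simp add: algebra_simps)
      then have "(tau ^^ Suc b) x \<in> E c" using x unfolding F_def by blast
      then show "(tau ^^ b) (tau x) \<in> E c" by (simp add: funpow_swap1)
    qed
  next
    assume x: "tau x \<in> F (j + 1)"
    have Suc: "(tau ^^ Suc b) x \<in> E c" if "int u * (int (Suc b) + j) \<le> int v * c" for b c
    proof -
      have "int u * (int b + (j + 1)) \<le> int v * c" using that by (simp add: algebra_simps)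
      then have "(tau ^^ b) (tau x) \<in> E c" using x unfolding F_def by blast
      then show ?thesis by (simp add: funpow_swap1)
    qed
    show "x \<in> F j"
      unfolding F_def
    proof (intro CollectI allI impI)
      fix b c assume bc: "int u * (int b + j) \<le> int v * c"
      show "(tau ^^ b) x \<in> E c"
      proof (cases b)
        case 0
        have "int u * (int (Suc (v - 1)) + j) \<le> int v * (c + int u)"
          using bc uv by (simp add: 0 algebra_simps)
        then have "(tau ^^ Suc (v - 1)) x \<in> E (c + int u)" by (rule Suc)
        then have "(tau ^^ v) x \<in> E (c + int u)" using uv by simp
        then show ?thesis by (simp only: 0 Etau funpow_0)
      next
        case (Suc b')
        then show ?thesis using \<open>\<And>c b. int u * (int (Suc b) + j) \<le> int v * c \<Longrightarrow> (tau ^^ Suc b) x \<in> E c\<close> bc by blast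
      qed
    qed
  qed
  moreover have "(t ^^ n) x \<in> F (j + int s) \<longleftrightarrow> x \<in> F j" for j x
  proof -
    have nv: "int n * int v = int s * int u" using ns by (metis of_nat_mult)
    have "int u * (int b + (j + int s)) \<le> int v * c \<longleftrightarrow> int u * (int b + j) \<le> int v * (c - int n)" for b c
      using nv by (simp add: algebra_simps)
    then have "(t ^^ n) x \<in> F (j + int s) \<longleftrightarrow>
        (\<forall>b c. int u * (int b + j) \<le> int v * (c - int n) \<longrightarrow> (tau ^^ b) x \<in> E (c - int n))"
      by (simp add: F_def Et' flip: t_pow_tau_pow)
    also have "\<dots> \<longleftrightarrow> x \<in> F j"
      unfolding F_def by (auto, metis add_diff_cancel_right')
    finally show ?thesis .
  qed
  ultimately have F: "\<And>j. subspace (F j)" "\<And>x. \<exists>j. x \<in> F j"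
    "\<And>j x. tau x \<in> F (j + 1) \<longleftrightarrow> x \<in> F j" "\<And>j x. (t ^^ n) x \<in> F (j + int s) \<longleftrightarrow> x \<in> F j"
    by blast+
  have "degree_filtration n s {(j, x). x \<in> F (j + j0 + 1)}"
    unfolding degree_filtration_def
  proof (intro conjI allI impI)
    fix j x
    have "{(j, x). x \<in> F (j + j0 + 1)} `` {j} = F (j + j0 + 1)" by auto
    then show "subspace ({(j, x). x \<in> F (j + j0 + 1)} `` {j})" using F(1) by simp
    show "(j + 1, tau x) \<in> {(j, x). x \<in> F (j + j0 + 1)} \<longleftrightarrow> (j, x) \<in> {(j, x). x \<in> F (j + j0 + 1)}"
      using F(3)[of x "j + j0 + 1"] by (simp add: algebra_simps)
    show "(j + int s, (t ^^ n) x) \<in> {(j, x). x \<in> F (j + j0 + 1)} \<longleftrightarrow>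
        (j, x) \<in> {(j, x). x \<in> F (j + j0 + 1)}"
      using F(4)[of x "j + j0 + 1"] by (simp add: algebra_simps)
    show "(j + 1, x) \<in> {(j, x). x \<in> F (j + j0 + 1)}" if "(j, x) \<in> {(j, x). x \<in> F (j + j0 + 1)}"
      using that Fmono[of x "j + j0 + 1"] by simp
    show "x = 0" if "j < 0" "(j, x) \<in> {(j, x). x \<in> F (j + j0 + 1)}"
      using that F0[of x "j + j0 + 1"] by simp
  next
    fix x
    obtain j where "x \<in> F j" using F(2) by blast
    then show "\<exists>j. (j, x) \<in> {(j, x). x \<in> F (j + j0 + 1)}"
      by (intro exI[of _ "j - j0 - 1"]) simp
  qed
  then show ?thesis ..
qed

end

section \<open>The Frobenius map of a finite subfield\<close>

text \<open>Multiplication by a nonzero \<open>a\<close> permutes the nonzero elements, so it fixes their product.\<close>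

lemma finite_subfield_power_card:
  fixes F :: "'k::field set"
  assumes "finite_subfield F" "a \<in> F"
  shows "a ^ card F = a"
proof (cases "a = 0")
  case True
  then have "card F \<noteq> 0" using assms by (auto simp: finite_subfield_def)
  then show ?thesis using True by simp
next
  case False
  have F: "finite F" "0 \<in> F" and mult: "\<And>x y. x \<in> F \<Longrightarrow> y \<in> F \<Longrightarrow> x * y \<in> F"
    using assms by (auto simp: finite_subfield_def)
  let ?U = "F - {0}"
  have "(*) a ` ?U \<subseteq> ?U" using mult assms(2) False by auto
  moreover have inj: "inj_on ((*) a) ?U" using False by (auto simp: inj_on_def)
  ultimately have "(*) a ` ?U = ?U"
    using F by (intro card_subset_eq) (auto simp: card_image)
  then have "\<Prod>?U = (\<Prod>x\<in>?U. a * x)"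
    using prod.reindex[OF inj, of "\<lambda>x. x"] by simp
  also have "\<dots> = a ^ card ?U * \<Prod>?U" by (simp add: prod.distrib)
  finally have "\<Prod>?U = a ^ card ?U * \<Prod>?U" .
  moreover have "\<Prod>?U \<noteq> 0" using F by simp
  ultimately have "a ^ card ?U = 1" unfolding mult_cancel_right1 by blast
  moreover have "card F = Suc (card ?U)" using F card_Suc_Diff1[of F 0] by simp
  ultimately show ?thesis by simp
qed

lemma finite_subfield_card_ge_2:
  assumes "finite_subfield (F :: 'k::field set)"
  shows "2 \<le> card F"
proof -
  have "card {0, 1 :: 'k} \<le> card F"
    using assms by (intro card_mono) (auto simp: finite_subfield_def)
  then show ?thesis by simp
qed

text \<open>
  The polynomial \<open>(X + 1)\<^sup>q - X\<^sup>q - 1\<close> has degree less than \<open>q\<close> and vanishes on the \<open>q\<close> elements of the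
  subfield.  So it is zero, and the identity that it expresses holds on the whole field.
\<close>

lemma finite_subfield_frobenius_add:
  fixes F :: "'k::field set" and a b :: 'k
  assumes F: "finite_subfield F"
  shows "(a + b) ^ card F = a ^ card F + b ^ card F"
proof -
  define q where "q = card F"
  have q: "2 \<le> q" using finite_subfield_card_ge_2[OF F] by (simp add: q_def)
  define p :: "'k poly" where "p = [:1, 1:] ^ q - monom 1 q - 1"
  have "p = 0"
  proof (rule ccontr)
    assume p: "p \<noteq> 0"
    have "poly p x = 0" if "x \<in> F" for x
    proof -
      have "x + 1 \<in> F" using F that by (simp add: finite_subfield_def)
      then show ?thesis
        using finite_subfield_power_card[OF F] that
        by (simp add: p_def poly_monom q_def poly_power add.commute)
    qed
    then have "card F \<le> card {x. poly p x = 0}"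
      using p by (intro card_mono poly_roots_finite) auto
    also have "\<dots> \<le> degree p" by (rule card_poly_roots_bound[OF p])
    finally have dp: "q \<le> degree p" by (simp add: q_def)
    have "degree ([:1, 1:] ^ q :: 'k poly) = q" by (simp add: degree_power_eq)
    moreover have "lead_coeff ([:1, 1:] ^ q :: 'k poly) = 1" by (simp add: lead_coeff_power)
    ultimately have "coeff p q = 0" using q by (simp add: p_def coeff_1)
    moreover have "degree p \<le> q"
      unfolding p_def by (intro degree_diff_le) (simp_all add: degree_power_eq degree_monom_le)
    ultimately show False using dp p by (metis le_antisym leading_coeff_0_iff)
  qed
  then have "[:1, 1:] ^ q = monom 1 q + (1 :: 'k poly)" by (simp add: p_def algebra_simps)
  then have "poly ([:1, 1:] ^ q) x = poly (monom 1 q + 1) x" for x :: 'k by simp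
  then have one: "(1 + x) ^ q = x ^ q + 1" for x :: 'k by (simp add: poly_monom poly_power)
  have "(a + b) ^ q = a ^ q + b ^ q"
  proof (cases "b = 0")
    case True
    then show ?thesis using q by simp
  next
    case False
    then have "b * (1 + a / b) = a + b" by (simp add: distrib_left)
    then have "(a + b) ^ q = (b * (1 + a / b)) ^ q" by simp
    also have "\<dots> = b ^ q * ((a / b) ^ q + 1)" by (simp only: power_mult_distrib one)
    also have "\<dots> = a ^ q + b ^ q" using False by (simp add: distrib_left power_divide)
    finally show ?thesis .
  qed
  then show ?thesis by (simp add: q_def)
qed

section \<open>Invertible matrices\<close>

lemma mat_inverse_commute:
  fixes A B :: "nat \<Rightarrow> nat \<Rightarrow> 'a::field"
  assumes "\<And>i j. i < n \<Longrightarrow> j < n \<Longrightarrow> (\<Sum>k<n. A i k * B k j) = (if i = j then 1 else 0)"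
    and "i < n" "j < n"
  shows "(\<Sum>k<n. B i k * A k j) = (if i = j then 1 else 0)"
proof -
  define M :: "(nat \<Rightarrow> nat \<Rightarrow> 'a) \<Rightarrow> 'a mat" where "M X = mat n n (\<lambda>(i, j). X i j)" for X
  have M: "M X \<in> carrier_mat n n" for X by (simp add: M_def)
  have prod: "(M X * M Y) $$ (i, j) = (\<Sum>k<n. X i k * Y k j)" if ij: "i < n" "j < n" for X Y i j
    unfolding M_def using ij by (simp add: scalar_prod_def atLeast0LessThan)
  have "M A * M B = 1\<^sub>m n"
  proof (rule eq_matI)
    fix i j assume "i < dim_row (1\<^sub>m n :: 'a mat)" "j < dim_col (1\<^sub>m n :: 'a mat)"
    then have ij: "i < n" "j < n" by simp_all
    show "(M A * M B) $$ (i, j) = 1\<^sub>m n $$ (i, j)"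
      unfolding prod[OF ij] assms(1)[OF ij] using ij by simp
  qed (use M in auto)
  then have BA: "M B * M A = 1\<^sub>m n"
    by (rule mat_mult_left_right_inverse[OF M M])
  show ?thesis
    unfolding prod[OF assms(2,3), symmetric] BA using assms(2,3) by simp
qed

lemma invertible_mat_iff_rows_independent:
  fixes A :: "'a::field mat"
  assumes A: "A \<in> carrier_mat d d"
  shows "invertible_mat A \<longleftrightarrow> (\<forall>x. (\<forall>k<d. (\<Sum>i<d. x i * A $$ (i, k)) = 0) \<longrightarrow> (\<forall>i<d. x i = 0))"
proof
  assume "invertible_mat A"
  then obtain B where AB: "A * B = 1\<^sub>m d" and BA: "B * A = 1\<^sub>m (dim_row B)"
    using A by (auto simp: invertible_mat_def inverts_mat_def)
  have B: "B \<in> carrier_mat d d"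
    using AB BA A by (metis carrier_matD carrier_matI index_mult_mat(2,3) index_one_mat(2,3))
  show "\<forall>x. (\<forall>k<d. (\<Sum>i<d. x i * A $$ (i, k)) = 0) \<longrightarrow> (\<forall>i<d. x i = 0)"
  proof (intro allI impI)
    fix x l assume x: "\<forall>k<d. (\<Sum>i<d. x i * A $$ (i, k)) = 0" and l: "l < d"
    have AB': "(\<Sum>k<d. A $$ (i, k) * B $$ (k, l)) = (if i = l then 1 else 0)" if "i < d" for i
    proof -
      have "(A * B) $$ (i, l) = (\<Sum>k<d. A $$ (i, k) * B $$ (k, l))"
        using A B that l by (simp add: scalar_prod_def atLeast0LessThan)
      then show ?thesis using AB that l by simp
    qed
    have "x l = (\<Sum>i<d. x i * (if i = l then 1 else 0))"
      using l by (simp add: if_distrib[of "(*) _"] cong: if_cong)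
    also have "\<dots> = (\<Sum>i<d. x i * (\<Sum>k<d. A $$ (i, k) * B $$ (k, l)))"
      by (rule sum.cong) (simp_all add: AB')
    also have "\<dots> = (\<Sum>i<d. \<Sum>k<d. x i * A $$ (i, k) * B $$ (k, l))"
      by (simp add: sum_distrib_left mult.assoc)
    also have "\<dots> = (\<Sum>k<d. \<Sum>i<d. x i * A $$ (i, k) * B $$ (k, l))"
      by (rule sum.swap)
    also have "\<dots> = (\<Sum>k<d. (\<Sum>i<d. x i * A $$ (i, k)) * B $$ (k, l))"
      by (simp add: sum_distrib_right)
    also have "\<dots> = 0" using x by simp
    finally show "x l = 0" .
  qed
next
  assume inj: "\<forall>x. (\<forall>k<d. (\<Sum>i<d. x i * A $$ (i, k)) = 0) \<longrightarrow> (\<forall>i<d. x i = 0)"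
  have "det A \<noteq> 0"
  proof
    assume "det A = 0"
    then have "det A\<^sup>T = 0" using det_transpose[OF A] by simp
    then obtain v where v: "v \<in> carrier_vec d" "v \<noteq> 0\<^sub>v d" "A\<^sup>T *\<^sub>v v = 0\<^sub>v d"
      using det_0_iff_vec_prod_zero_field[of "A\<^sup>T" d] A by auto
    have "(\<Sum>i<d. v $ i * A $$ (i, k)) = 0" if "k < d" for k
    proof -
      have "(A\<^sup>T *\<^sub>v v) $ k = (\<Sum>i<d. A $$ (i, k) * v $ i)"
        using A v(1) that by (simp add: scalar_prod_def atLeast0LessThan)
      then show ?thesis using v(3) that by (simp add: mult.commute)
    qed
    then have "\<forall>i<d. v $ i = 0" using inj by blast
    then have "v = 0\<^sub>v d" using v(1) by (intro eq_vecI) auto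
    then show False using v(2) by blast
  qed
  then obtain B where "B \<in> carrier_mat d d" "B * A = 1\<^sub>m d" "A * B = 1\<^sub>m d"
    using det_non_zero_imp_unit[OF A, of "()"] by (auto simp: Units_def ring_mat_def)
  then show "invertible_mat A"
    using A unfolding invertible_mat_def inverts_mat_def by (intro conjI exI[of _ B]) auto
qed

section \<open>Modules over the skew polynomial ring in two variables\<close>

locale frobenius_skew_module = skew_module q act
  for q :: nat and act :: "'k::alg_closed_field skew \<Rightarrow> 'm::ab_group_add \<Rightarrow> 'm" +
  assumes q2: "2 \<le> q" and frob: "\<And>a b :: 'k. (a + b) ^ q = a ^ q + b ^ q"
begin

definition act_const :: "'k \<Rightarrow> 'm \<Rightarrow> 'm" where
  "act_const a = act (Poly_Mapping.single (0, 0) a)"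

definition act_t :: "'m \<Rightarrow> 'm" where
  "act_t = act (Poly_Mapping.single (0, 1) 1)"

abbreviation act_tau :: "'m \<Rightarrow> 'm" where
  "act_tau \<equiv> act skew_tau"

lemma act_single_times:
  "act (Poly_Mapping.single (i, j) a) (act (Poly_Mapping.single (k, l) b) x) =
     act (Poly_Mapping.single (i + k, j + l) (a * b ^ (q ^ i))) x"
  using q2 by (subst act_times[symmetric]) (simp add: skew_times_single)

sublocale frobenius_space act_const q act_tau act_t
proof
  show "act_const a (x + y) = act_const a x + act_const a y" for a x y
    by (simp add: act_const_def act_add_right)
  show "act_const (a + b) x = act_const a x + act_const b x" for a b x
    by (simp add: act_const_def single_add act_add_left)
  show "act_const a (act_const b x) = act_const (a * b) x" for a b x
    by (simp add: act_const_def act_single_times)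
  show "act_const 1 x = x" for x
    using act_one by (simp add: act_const_def skew_one_def)
  show "2 \<le> q" by (rule q2)
  show "(a + b) ^ q = a ^ q + b ^ q" for a b :: 'k by (rule frob)
  show "act_tau (x + y) = act_tau x + act_tau y" for x y by (rule act_add_right)
  show "act_tau (act_const a x) = act_const (a ^ q) (act_tau x)" for a x
    by (simp add: act_const_def skew_tau_def act_single_times)
  show "act_t (x + y) = act_t x + act_t y" for x y
    by (simp add: act_t_def act_add_right)
  show "act_t (act_const a x) = act_const a (act_t x)" for a x
    by (simp add: act_t_def act_const_def act_single_times)
  show "act_t (act_tau x) = act_tau (act_t x)" for x
    by (simp add: act_t_def skew_tau_def act_single_times)
qed

lemma act_zero [simp]: "act 0 x = 0"
  using act_add_left[of 0 0 x] by simp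

lemma act_sum: "act (\<Sum>i\<in>A. f i) x = (\<Sum>i\<in>A. act (f i) x)"
  by (induction A rule: infinite_finite_induct) (simp_all add: act_add_left)

lemma act_tau_pow: "(act_tau ^^ i) x = act (Poly_Mapping.single (i, 0) 1) x"
proof (induction i)
  case 0
  show ?case using act_one by (simp add: skew_one_def)
next
  case (Suc i)
  then show ?case by (simp add: skew_tau_def act_single_times)
qed

lemma act_t_pow: "(act_t ^^ j) x = act (Poly_Mapping.single (0, j) 1) x"
proof (induction j)
  case 0
  show ?case using act_one by (simp add: skew_one_def)
next
  case (Suc j)
  then show ?case by (simp add: act_t_def act_single_times)
qed

lemma act_single_tau: "act (Poly_Mapping.single (i, 0) a) x = act_const a ((act_tau ^^ i) x)"
  by (simp add: act_tau_pow act_const_def act_single_times)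

lemma act_single_t: "act (Poly_Mapping.single (0, j) a) x = act_const a ((act_t ^^ j) x)"
  by (simp add: act_t_pow act_const_def act_single_times)

definition tau_polynomial :: "(nat \<Rightarrow> 'k) \<Rightarrow> nat \<Rightarrow> 'k skew" where
  "tau_polynomial c N = (\<Sum>i<N. Poly_Mapping.single (i, 0) (c i))"

lemma lookup_tau_polynomial:
  "Poly_Mapping.lookup (tau_polynomial c N) (i, j) = (if i < N \<and> j = 0 then c i else 0)"
proof -
  have "Poly_Mapping.lookup (tau_polynomial c N) (i, j) = (\<Sum>l<N. if l = i then (if j = 0 then c i else 0) else 0)"
    unfolding tau_polynomial_def lookup_sum
    by (rule sum.cong) (auto simp: lookup_single when_def)
  then show ?thesis by simp
qed

lemma tau_polynomial_in_tau_subring: "tau_polynomial c N \<in> tau_subring"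
  by (auto simp: tau_subring_def in_keys_iff lookup_tau_polynomial split: if_splits)

lemma act_tau_polynomial: "act (tau_polynomial c N) x = (\<Sum>i<N. act_const (c i) ((act_tau ^^ i) x))"
  by (simp add: tau_polynomial_def act_sum act_single_tau)

text \<open>
  All large lengths are allowed, so that finitely many elements can be written with a common length.
\<close>

lemma tau_subring_eq_tau_polynomial:
  assumes f: "f \<in> tau_subring"
  shows "\<exists>N0. \<forall>N\<ge>N0. f = tau_polynomial (\<lambda>i. Poly_Mapping.lookup f (i, 0)) N"
proof -
  have "finite (fst ` Poly_Mapping.keys f)" by simp
  then obtain N0 where N0: "\<And>i. i \<in> fst ` Poly_Mapping.keys f \<Longrightarrow> i < N0"
    using finite_nat_set_iff_bounded[of "fst ` Poly_Mapping.keys f"] by blast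
  have "f = tau_polynomial (\<lambda>i. Poly_Mapping.lookup f (i, 0)) N" if "N0 \<le> N" for N
  proof (rule poly_mapping_eqI)
    fix p :: "nat \<times> nat"
    obtain i j where p: "p = (i, j)" by (cases p)
    show "Poly_Mapping.lookup f p = Poly_Mapping.lookup (tau_polynomial (\<lambda>i. Poly_Mapping.lookup f (i, 0)) N) p"
    proof (cases "(i, j) \<in> Poly_Mapping.keys f")
      case True
      then have "i \<in> fst ` Poly_Mapping.keys f" by force
      then have "i < N" using N0[of i] that by simp
      moreover have "j = 0" using f True by (auto simp: tau_subring_def)
      ultimately show ?thesis by (simp add: p lookup_tau_polynomial)
    next
      case False
      then show ?thesis by (auto simp: p lookup_tau_polynomial in_keys_iff)
    qed
  qed
  then show ?thesis by blast
qed

lemma tau_combination_eq_act: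
  "tau_combination d \<kappa> c N = (\<Sum>k<d. act (tau_polynomial (c k) N) (\<kappa> k))"
  by (simp add: tau_combination_def act_tau_polynomial)

lemma tau_polynomial_family:
  assumes "\<forall>k<d. f k \<in> tau_subring"
  shows "\<exists>N. \<forall>k<(d::nat). f k = tau_polynomial (\<lambda>i. Poly_Mapping.lookup (f k) (i, 0)) N"
proof -
  have "\<forall>k\<in>{..<d}. \<exists>N0. \<forall>N\<ge>N0. f k = tau_polynomial (\<lambda>i. Poly_Mapping.lookup (f k) (i, 0)) N"
    using tau_subring_eq_tau_polynomial assms by simp
  then obtain N0 where N0: "\<forall>k\<in>{..<d}. \<forall>N\<ge>N0 k.
      f k = tau_polynomial (\<lambda>i. Poly_Mapping.lookup (f k) (i, 0)) N"
    unfolding bchoice_iff by blast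
  have "N0 k \<le> (\<Sum>k<d. N0 k)" if "k < d" for k
    using that by (intro member_le_sum) auto
  then show ?thesis using N0 by (intro exI[of _ "\<Sum>k<d. N0 k"]) simp
qed

lemma is_basis_over_tau_subring_iff: "is_basis_over tau_subring act d \<kappa> \<longleftrightarrow> tau_basis d \<kappa>"
proof
  assume B: "is_basis_over tau_subring act d \<kappa>"
  show "tau_basis d \<kappa>"
    unfolding tau_basis_def
  proof (intro conjI allI impI)
    fix x
    obtain f where f: "\<forall>k<d. f k \<in> tau_subring" "x = (\<Sum>k<d. act (f k) (\<kappa> k))"
      using B unfolding is_basis_over_def by blast
    obtain N where N: "\<forall>k<d. f k = tau_polynomial (\<lambda>i. Poly_Mapping.lookup (f k) (i, 0)) N"
      using tau_polynomial_family[OF f(1)] by blast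
    have "x = (\<Sum>k<d. act (tau_polynomial (\<lambda>i. Poly_Mapping.lookup (f k) (i, 0)) N) (\<kappa> k))"
      unfolding f(2) using N by (intro sum.cong) simp_all
    then show "\<exists>N c. x = tau_combination d \<kappa> c N"
      unfolding tau_combination_eq_act
      by (intro exI[of _ N] exI[of _ "\<lambda>k i. Poly_Mapping.lookup (f k) (i, 0)"])
  next
    fix N c k i assume z: "tau_combination d \<kappa> c N = 0" and k: "k < d" and i: "i < N"
    have "\<forall>k<d. tau_polynomial (c k) N = 0"
      using B[unfolded is_basis_over_def, THEN conjunct2, rule_format, of "\<lambda>k. tau_polynomial (c k) N"]
        z tau_polynomial_in_tau_subring by (simp add: tau_combination_eq_act)
    then have "Poly_Mapping.lookup (tau_polynomial (c k) N) (i, 0) = 0" using k by simp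
    then show "c k i = 0" using i by (simp add: lookup_tau_polynomial)
  qed
next
  assume B: "tau_basis d \<kappa>"
  show "is_basis_over tau_subring act d \<kappa>"
    unfolding is_basis_over_def
  proof (intro conjI allI impI)
    fix x
    obtain N c where "x = tau_combination d \<kappa> c N" using B unfolding tau_basis_def by blast
    then show "\<exists>c. (\<forall>i<d. c i \<in> tau_subring) \<and> x = (\<Sum>i<d. act (c i) (\<kappa> i))"
      using tau_polynomial_in_tau_subring unfolding tau_combination_eq_act
      by (intro exI[of _ "\<lambda>k. tau_polynomial (c k) N"]) simp
  next
    fix f k assume f: "(\<forall>i<d. f i \<in> tau_subring) \<and> (\<Sum>i<d. act (f i) (\<kappa> i)) = 0" and k: "k < d"
    obtain N where N: "\<forall>k<d. f k = tau_polynomial (\<lambda>i. Poly_Mapping.lookup (f k) (i, 0)) N"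
      using tau_polynomial_family[of d f] f by blast
    let ?c = "\<lambda>k i. Poly_Mapping.lookup (f k) (i, 0)"
    have "tau_combination d \<kappa> ?c N = (\<Sum>k<d. act (f k) (\<kappa> k))"
      unfolding tau_combination_eq_act using N by (intro sum.cong) simp_all
    also have "\<dots> = 0" using f by blast
    finally have "\<forall>i<N. ?c k i = 0" using B k unfolding tau_basis_def by blast
    then have "tau_polynomial (?c k) N = 0" by (simp add: tau_polynomial_def)
    then show "f k = 0" using N k by simp
  qed
qed

lemma strict_purity_equation_iff:
  "strict_purity_equation act d \<kappa> n \<longleftrightarrow> (\<exists>s D. purity_equation d \<kappa> n s D)"
proof
  have eqn: "(\<Sum>k<d. act (\<Sum>j\<le>s. Poly_Mapping.single (j, 0) (D j $$ (i, k))) (\<kappa> k)) =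
      tau_combination d \<kappa> (\<lambda>k j. D j $$ (i, k)) (Suc s)" for s i and D :: "nat \<Rightarrow> 'k mat"
    by (simp add: tau_combination_eq_act tau_polynomial_def lessThan_Suc_atMost)
  {
    assume "strict_purity_equation act d \<kappa> n"
    then obtain s and D :: "nat \<Rightarrow> 'k mat" where D: "\<forall>j\<le>s. D j \<in> carrier_mat d d" "invertible_mat (D s)"
      and eq: "\<forall>i<d. act (Poly_Mapping.single (0, n) 1) (\<kappa> i) =
        (\<Sum>k<d. act (\<Sum>j\<le>s. Poly_Mapping.single (j, 0) (D j $$ (i, k))) (\<kappa> k))"
      unfolding strict_purity_equation_def by blast
    have "\<forall>x. (\<forall>k<d. (\<Sum>i<d. x i * D s $$ (i, k)) = 0) \<longrightarrow> (\<forall>i<d. x i = 0)"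
      using D invertible_mat_iff_rows_independent[of "D s" d] by blast
    then have "purity_equation d \<kappa> n s (\<lambda>j i k. D j $$ (i, k))"
      using eq unfolding purity_equation_def eqn act_t_pow by blast
    then show "\<exists>s D. purity_equation d \<kappa> n s D" by blast
  }
  assume "\<exists>s D. purity_equation d \<kappa> n s D"
  then obtain s D where D: "purity_equation d \<kappa> n s D" by blast
  let ?D = "\<lambda>j. mat d d (\<lambda>(i, k). D j i k)"
  have "invertible_mat (?D s)"
    using D invertible_mat_iff_rows_independent[of "?D s" d] by (simp add: purity_equation_def)
  moreover have "act (Poly_Mapping.single (0, n) 1) (\<kappa> i) =
      (\<Sum>k<d. act (\<Sum>j\<le>s. Poly_Mapping.single (j, 0) (?D j $$ (i, k))) (\<kappa> k))" if "i < d" for i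
  proof -
    have "act (Poly_Mapping.single (0, n) 1) (\<kappa> i) = tau_combination d \<kappa> (\<lambda>k j. D j i k) (Suc s)"
      using D that unfolding purity_equation_def act_t_pow by blast
    also have "\<dots> = tau_combination d \<kappa> (\<lambda>k j. ?D j $$ (i, k)) (Suc s)"
      using that by (intro tau_combination_cong) simp
    finally show ?thesis by (simp only: eqn)
  qed
  ultimately show "strict_purity_equation act d \<kappa> n"
    unfolding strict_purity_equation_def by (intro exI[of _ s] exI[of _ ?D]) simp
qed

lemma act_poly_to_skew: "act (poly_to_skew p) x = (\<Sum>j\<le>degree p. act_const (coeff p j) ((act_t ^^ j) x))"
  by (simp add: poly_to_skew_def act_sum act_single_t)

lemma act_poly_to_skew_le:
  assumes "degree p < N"
  shows "act (poly_to_skew p) x = (\<Sum>j<N. act_const (coeff p j) ((act_t ^^ j) x))"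
  unfolding act_poly_to_skew
  using assms by (intro sum.mono_neutral_left) (auto simp: coeff_eq_0)

lemma act_poly_to_skew_pCons:
  "act (poly_to_skew (pCons a p)) x = act_const a x + act_t (act (poly_to_skew p) x)"
proof -
  have "act (poly_to_skew (pCons a p)) x =
      (\<Sum>j<Suc (Suc (degree p)). act_const (coeff (pCons a p) j) ((act_t ^^ j) x))"
    by (rule act_poly_to_skew_le) (metis degree_pCons_le less_Suc_eq_le)
  also have "\<dots> = act_const a x + (\<Sum>j<Suc (degree p). act_const (coeff p j) ((act_t ^^ Suc j) x))"
    by (simp add: sum.lessThan_Suc_shift del: sum.lessThan_Suc)
  also have "(\<Sum>j<Suc (degree p). act_const (coeff p j) ((act_t ^^ Suc j) x)) =
      (act_t ^^ 1) (\<Sum>j<Suc (degree p). act_const (coeff p j) ((act_t ^^ j) x))"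
    unfolding t_pow_sum t_pow_scale by simp
  also have "(\<Sum>j<Suc (degree p). act_const (coeff p j) ((act_t ^^ j) x)) = act (poly_to_skew p) x"
    by (rule act_poly_to_skew_le[symmetric]) simp
  finally show ?thesis by simp
qed

lemma act_poly_to_skew_0 [simp]: "act (poly_to_skew 0) x = 0"
  by (simp add: act_poly_to_skew)

lemma act_poly_to_skew_add_left:
  "act (poly_to_skew (p + p')) x = act (poly_to_skew p) x + act (poly_to_skew p') x"
proof (induction p arbitrary: p')
  case 0
  then show ?case by simp
next
  case (pCons a p)
  obtain b r where p': "p' = pCons b r" by (cases p') auto
  show ?case
    unfolding p' add_pCons act_poly_to_skew_pCons pCons.IH t_add scale_left_distrib
    by (simp only: add_ac)
qed

lemma act_poly_to_skew_mult:
  "act (poly_to_skew (p * p')) x = act (poly_to_skew p) (act (poly_to_skew p') x)"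
proof (induction p)
  case 0
  then show ?case by simp
next
  case (pCons a p)
  have "act (poly_to_skew (Polynomial.smult a p')) x = act_const a (act (poly_to_skew p') x)"
    by (induction p') (simp_all add: act_poly_to_skew_pCons t_scale scale_right_distrib)
  then show ?case
    unfolding mult_pCons_left act_poly_to_skew_add_left act_poly_to_skew_pCons pCons.IH
    by simp
qed

text \<open>Modulo \<open>t\<close> only the constant terms of the coordinates remain.\<close>

lemma t_basis_cofinite:
  assumes "is_basis_over t_subring act r e"
  shows "\<exists>Y. finite Y \<and> (\<forall>x. \<exists>y. x - act_t y \<in> span Y)"
proof (intro exI[of _ "e ` {..<r}"] conjI allI)
  fix x
  obtain f where f: "\<forall>k<r. f k \<in> t_subring" "x = (\<Sum>k<r. act (f k) (e k))"
    using assms unfolding is_basis_over_def by blast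
  then have "\<forall>k. \<exists>p. k < r \<longrightarrow> f k = poly_to_skew p" by (auto simp: t_subring_def)
  then obtain p where p: "\<And>k. k < r \<Longrightarrow> f k = poly_to_skew (p k)" by metis
  have "x = (\<Sum>k<r. act (poly_to_skew (p k)) (e k))" unfolding f(2) by (rule sum.cong) (simp_all add: p)
  also have "\<dots> = (\<Sum>k<r. act_const (coeff (p k) 0) (e k) + act_t (act (poly_to_skew (poly_shift 1 (p k))) (e k)))"
  proof (rule sum.cong)
    fix k
    have "p k = pCons (coeff (p k) 0) (poly_shift 1 (p k))"
      by (rule poly_eqI) (simp add: coeff_pCons coeff_poly_shift split: nat.splits)
    then show "act (poly_to_skew (p k)) (e k) =
        act_const (coeff (p k) 0) (e k) + act_t (act (poly_to_skew (poly_shift 1 (p k))) (e k))"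
      using act_poly_to_skew_pCons[of "coeff (p k) 0" "poly_shift 1 (p k)" "e k"] by simp
  qed simp
  also have "\<dots> = (\<Sum>k<r. act_const (coeff (p k) 0) (e k)) +
      (act_t ^^ 1) (\<Sum>k<r. act (poly_to_skew (poly_shift 1 (p k))) (e k))"
    unfolding t_pow_sum by (simp add: sum.distrib)
  finally have "x - act_t (\<Sum>k<r. act (poly_to_skew (poly_shift 1 (p k))) (e k)) =
      (\<Sum>k<r. act_const (coeff (p k) 0) (e k))" by simp
  moreover have "(\<Sum>k<r. act_const (coeff (p k) 0) (e k)) \<in> span (e ` {..<r})"
    by (intro span_sum span_scale span_base) auto
  ultimately show "\<exists>y. x - act_t y \<in> span (e ` {..<r})" by metis
qed simp

end

section \<open>Laurent series in the inverse of t\<close>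

lemma fls_mult_nth_eq_0_below:
  fixes f g :: "'a::field fls"
  assumes "\<And>j. j < a \<Longrightarrow> fls_nth f j = 0" "\<And>j. j < b \<Longrightarrow> fls_nth g j = 0" "k < a + b"
  shows "fls_nth (f * g) k = 0"
proof (cases "f = 0 \<or> g = 0")
  case False
  then have "a \<le> fls_subdegree f" "b \<le> fls_subdegree g"
    using assms(1,2) by (auto intro: fls_subdegree_geI)
  then show ?thesis using assms(3) by (intro fls_times_nth_eq0) simp
qed auto

lemma fls_common_lower_bound:
  fixes f :: "nat \<Rightarrow> 'a::field fls"
  shows "\<exists>D. \<forall>i<n. \<forall>j<D. fls_nth (f i) j = 0"
proof (induction n)
  case (Suc n)
  then obtain D where D: "\<forall>i<n. \<forall>j<D. fls_nth (f i) j = 0" by blast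
  show ?case
    by (rule exI[of _ "min D (fls_subdegree (f n))"]) (use D in \<open>auto simp: less_Suc_eq\<close>)
qed simp

lemma range_fps_to_fls_iff: "f \<in> range fps_to_fls \<longleftrightarrow> (\<forall>j<0. fls_nth f j = 0)"
proof
  assume "\<forall>j<0. fls_nth f j = 0"
  then have "0 \<le> fls_subdegree f" by (intro fls_subdegree_ge0I) auto
  then have "fps_to_fls (fls_regpart f) = f" by simp
  then show "f \<in> range fps_to_fls" by (metis rangeI)
qed auto

lemma poly_to_laurent_0 [simp]: "poly_to_laurent 0 = 0"
  by (simp add: poly_to_laurent_def)

lemma poly_to_laurent_pCons:
  "poly_to_laurent (pCons a p) = fls_const a + fls_X_inv * poly_to_laurent p"
  by (simp add: poly_to_laurent_def map_poly_pCons)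

lemma poly_to_laurent_add: "poly_to_laurent (p + p') = poly_to_laurent p + poly_to_laurent p'"
proof (induction p arbitrary: p')
  case 0
  then show ?case by simp
next
  case (pCons a p)
  obtain b r where p': "p' = pCons b r" by (cases p') auto
  show ?case
    unfolding p' add_pCons poly_to_laurent_pCons pCons.IH
    by (simp add: fls_plus_const distrib_left add_ac)
qed

lemma poly_to_laurent_mult: "poly_to_laurent (p * p') = poly_to_laurent p * poly_to_laurent p'"
proof (induction p)
  case 0
  then show ?case by simp
next
  case (pCons a p)
  have "poly_to_laurent (Polynomial.smult a p') = fls_const a * poly_to_laurent p'"
    by (induction p') (simp_all add: poly_to_laurent_pCons algebra_simps)
  then show ?case
    unfolding mult_pCons_left poly_to_laurent_add poly_to_laurent_pCons pCons.IH
    by (simp add: algebra_simps)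
qed

lemma nth_poly_to_laurent: "fls_nth (poly_to_laurent p) (- int j) = coeff p j"
proof (induction p arbitrary: j)
  case 0
  then show ?case by simp
next
  case (pCons a p)
  show ?case
  proof (cases j)
    case 0
    have "fls_nth (poly_to_laurent p) k = 0" if "0 < k" for k
      using that
      by (induction p arbitrary: k) (simp_all add: poly_to_laurent_pCons fls_X_inv_times_conv_shift)
    then show ?thesis by (simp add: 0 poly_to_laurent_pCons fls_X_inv_times_conv_shift)
  next
    case (Suc i)
    then show ?thesis
      using pCons.IH[of i] by (simp add: poly_to_laurent_pCons fls_X_inv_times_conv_shift)
  qed
qed

section \<open>The completion at infinity\<close>

text \<open>
  The operations on classes are computed on representatives, that is, on formal integer combinations
  of pairs modulo the subgroup \<open>null\<close> of tensor relations.
\<close>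

context frobenius_skew_module
begin

abbreviation twist :: "'k fls \<Rightarrow> 'k fls" where
  "twist \<equiv> laurent_twist q"

lemma q_pos: "0 < q" using q2 by simp

lemma nth_twist [simp]: "fls_nth (twist f) j = fls_nth f j ^ q"
  by (rule fls_nth_laurent_twist[OF q_pos])

lemma twist_add: "twist (f + g) = twist f + twist g"
  by (rule fls_eqI) (simp add: frob)

lemma twist_0 [simp]: "twist 0 = 0"
  by (rule fls_eqI) (simp add: q_pos)

lemma twist_1 [simp]: "twist 1 = 1"
  by (rule fls_eqI) (simp add: q_pos)

lemma twist_const [simp]: "twist (fls_const a) = fls_const (a ^ q)"
  by (rule fls_eqI) (simp add: q_pos)

lemma twist_shift: "twist (fls_shift k f) = fls_shift k (twist f)"
  by (rule fls_eqI) simp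

lemma twist_eq_0_iff: "twist f = 0 \<longleftrightarrow> f = 0"
  using q_pos by (auto simp: fls_eq_iff)

lemma twist_subdegree: "fls_subdegree (twist f) = fls_subdegree f"
proof (cases "f = 0")
  case False
  then show ?thesis using q_pos by (intro fls_subdegree_eqI) auto
qed simp

lemma twist_mult: "twist (f * g) = twist f * twist g"
proof (rule fls_eqI)
  fix m
  have sum: "(\<Sum>i\<in>A. h i) ^ q = (\<Sum>i\<in>A. h i ^ q)" for A :: "int set" and h :: "int \<Rightarrow> 'k"
    by (induction A rule: infinite_finite_induct) (simp_all add: frob q_pos)
  show "fls_nth (twist (f * g)) m = fls_nth (twist f * twist g) m"
    unfolding nth_twist fls_times_nth(2) twist_subdegree sum by (simp add: power_mult_distrib)
qed

text \<open>
  Passing a polynomial across \<open>\<tau>\<close> twists its coefficients in both factors of the tensor product in the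
  same way; therefore \<open>\<tau>\<close> respects the balancing relations.
\<close>

lemma twist_poly:
  "\<exists>p'. twist (poly_to_laurent p) = poly_to_laurent p' \<and>
     (\<forall>x. act_tau (act (poly_to_skew p) x) = act (poly_to_skew p') (act_tau x))"
proof (induction p)
  case 0
  have "act_tau 0 = 0" using tau_pow_simps(2)[of 1] by simp
  then show ?case by (intro exI[of _ 0]) simp
next
  case (pCons a p)
  then obtain p' where p': "twist (poly_to_laurent p) = poly_to_laurent p'"
    "\<And>x. act_tau (act (poly_to_skew p) x) = act (poly_to_skew p') (act_tau x)" by blast
  have "twist fls_X_inv = fls_X_inv" by (rule fls_eqI) (simp add: q_pos)
  then have "twist (poly_to_laurent (pCons a p)) = poly_to_laurent (pCons (a ^ q) p')"
    by (simp add: poly_to_laurent_pCons twist_add twist_mult p')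
  moreover have "act_tau (act (poly_to_skew (pCons a p)) x) =
      act (poly_to_skew (pCons (a ^ q) p')) (act_tau x)" for x
    by (simp add: act_poly_to_skew_pCons tau_add tau_scale p'(2) flip: t_tau)
  ultimately show ?case by blast
qed

abbreviation null :: "('k fls \<times> 'm \<Rightarrow>\<^sub>0 int) set" where
  "null \<equiv> tensor_null (\<lambda>f p. f * poly_to_laurent p) (\<lambda>p. act (poly_to_skew p))"

definition scale_frag :: "'k fls \<Rightarrow> ('k fls \<times> 'm \<Rightarrow>\<^sub>0 int) \<Rightarrow> ('k fls \<times> 'm \<Rightarrow>\<^sub>0 int)" where
  "scale_frag g = frag_extend (\<lambda>p. frag_of (case p of (f, m) \<Rightarrow> (g * f, m)))"

definition tau_frag :: "('k fls \<times> 'm \<Rightarrow>\<^sub>0 int) \<Rightarrow> ('k fls \<times> 'm \<Rightarrow>\<^sub>0 int)" where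
  "tau_frag = frag_extend (\<lambda>p. frag_of (case p of (f, m) \<Rightarrow> (twist f, act_tau m)))"

definition tensor_class :: "('k fls \<times> 'm \<Rightarrow>\<^sub>0 int) \<Rightarrow> ('k fls \<times> 'm \<Rightarrow>\<^sub>0 int) set" where
  "tensor_class x = completion_rel act `` {x}"

lemma null_uminus: "x \<in> null \<Longrightarrow> - x \<in> null"
  using tensor_null.diff[OF tensor_null.zero] by fastforce

lemma null_add: "x \<in> null \<Longrightarrow> y \<in> null \<Longrightarrow> x + y \<in> null"
  using tensor_null.diff[OF _ null_uminus] by fastforce

lemma null_sum: "(\<And>i. i \<in> A \<Longrightarrow> f i \<in> null) \<Longrightarrow> (\<Sum>i\<in>A. f i) \<in> null"
  by (induction A rule: infinite_finite_induct) (auto intro: null_add tensor_null.zero)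

lemma tensor_class_eq_iff: "tensor_class x = tensor_class y \<longleftrightarrow> x - y \<in> null"
proof -
  have "equiv UNIV (completion_rel act)" by (simp add: completion_rel_def equiv_tensor_rel)
  then have "tensor_class x = tensor_class y \<longleftrightarrow> (x, y) \<in> completion_rel act"
    unfolding tensor_class_def by (rule eq_equiv_class_iff) simp_all
  then show ?thesis by (simp add: completion_rel_def tensor_rel_def)
qed

lemma mem_tensor_class_iff: "y \<in> tensor_class x \<longleftrightarrow> x - y \<in> null"
  by (simp add: tensor_class_def completion_rel_def tensor_rel_def)

lemma completion_eq_range: "completion act = range tensor_class"
  by (auto simp: completion_def quotient_def tensor_class_def)

lemma completion_zero_eq: "completion_zero act = tensor_class 0"
  by (simp add: completion_zero_def tensor_class_def)

lemma completion_add_class: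
  "completion_add act (tensor_class x) (tensor_class y) = tensor_class (x + y)"
proof -
  have "tensor_class (x' + y') = tensor_class (x + y)"
    if "x' \<in> tensor_class x" "y' \<in> tensor_class y" for x' y'
  proof -
    have "(x' + y') - (x + y) = - ((x - x') + (y - y'))" by simp
    also have "\<dots> \<in> null" using that by (intro null_uminus null_add) (simp_all add: mem_tensor_class_iff)
    finally show ?thesis by (simp add: tensor_class_eq_iff)
  qed
  moreover have "x \<in> tensor_class x" "y \<in> tensor_class y"
    by (simp_all add: mem_tensor_class_iff tensor_null.zero)
  ultimately show ?thesis
    unfolding completion_add_def tensor_class_def[symmetric] by blast
qed

lemma scale_frag_0 [simp]: "scale_frag g 0 = 0"
  by (simp add: scale_frag_def)

lemma scale_frag_of [simp]: "scale_frag g (frag_of (f, m)) = frag_of (g * f, m)"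
  by (simp add: scale_frag_def)

lemma scale_frag_diff: "scale_frag g (x - y) = scale_frag g x - scale_frag g y"
  by (simp add: scale_frag_def frag_extend_diff)

lemma scale_frag_sum: "scale_frag g (\<Sum>i\<in>A. f i) = (\<Sum>i\<in>A. scale_frag g (f i))"
  by (induction A rule: infinite_finite_induct) (simp_all add: scale_frag_def frag_extend_add)

lemma tau_frag_0 [simp]: "tau_frag 0 = 0"
  by (simp add: tau_frag_def)

lemma tau_frag_of [simp]: "tau_frag (frag_of (f, m)) = frag_of (twist f, act_tau m)"
  by (simp add: tau_frag_def)

lemma tau_frag_diff: "tau_frag (x - y) = tau_frag x - tau_frag y"
  by (simp add: tau_frag_def frag_extend_diff)

lemma scale_frag_null: "x \<in> null \<Longrightarrow> scale_frag g x \<in> null"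
proof (induction rule: tensor_null.induct)
  case (add_left a b m)
  then show ?case
    using tensor_null.add_left[of "g * a" "g * b" m] by (simp add: scale_frag_diff distrib_left)
next
  case (add_right a m n)
  then show ?case
    using tensor_null.add_right[of "g * a" m n] by (simp add: scale_frag_diff)
next
  case (balanced a r m)
  then show ?case
    using tensor_null.balanced[of "\<lambda>f p. f * poly_to_laurent p" "g * a" r m]
    by (simp add: scale_frag_diff mult.assoc)
qed (simp_all add: tensor_null.zero tensor_null.diff scale_frag_diff)

lemma tau_frag_null: "x \<in> null \<Longrightarrow> tau_frag x \<in> null"
proof (induction rule: tensor_null.induct)
  case (add_left a b m)
  then show ?case
    using tensor_null.add_left[of "twist a" "twist b" "act_tau m"] by (simp add: tau_frag_diff twist_add)
next
  case (add_right a m n)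
  then show ?case
    using tensor_null.add_right[of "twist a" "act_tau m" "act_tau n"] by (simp add: tau_frag_diff tau_add)
next
  case (balanced a p m)
  obtain p' where p': "twist (poly_to_laurent p) = poly_to_laurent p'"
    "\<And>x. act_tau (act (poly_to_skew p) x) = act (poly_to_skew p') (act_tau x)"
    using twist_poly by blast
  then show ?case
    using tensor_null.balanced[of "\<lambda>f p. f * poly_to_laurent p" "twist a" p' "act_tau m"]
    by (simp add: tau_frag_diff twist_mult)
qed (simp_all add: tensor_null.zero tensor_null.diff tau_frag_diff)

lemma completion_scale_tensor_class:
  "completion_scale act g (tensor_class x) = tensor_class (scale_frag g x)"
  unfolding tensor_class_def scale_frag_def by (rule completion_scale_class)

lemma completion_tau_tensor_class:
  "completion_tau q act (tensor_class x) = tensor_class (tau_frag x)"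
proof -
  have "tensor_class (tau_frag y) = tensor_class (tau_frag x)" if "y \<in> tensor_class x" for y
  proof -
    have "tau_frag (x - y) \<in> null" using that by (intro tau_frag_null) (simp add: mem_tensor_class_iff)
    then have "- (tau_frag x - tau_frag y) \<in> null" unfolding tau_frag_diff by (rule null_uminus)
    then show ?thesis by (simp add: tensor_class_eq_iff)
  qed
  moreover have "x \<in> tensor_class x" by (simp add: mem_tensor_class_iff tensor_null.zero)
  moreover have "completion_tau q act (tensor_class x) = (\<Union>y\<in>tensor_class x. tensor_class (tau_frag y))"
    by (simp add: completion_tau_def completion_map_def tensor_class_def tau_frag_def)
  ultimately show ?thesis by blast
qed

lemma completion_tau_pow_tensor_class:
  "(completion_tau q act ^^ v) (tensor_class x) = tensor_class ((tau_frag ^^ v) x)"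
  by (induction v) (simp_all add: completion_tau_tensor_class)

lemma scale_frag_scale_frag: "scale_frag g (scale_frag h x) = scale_frag (g * h) x"
proof (rule frag_induction[of x UNIV])
  show "scale_frag g (scale_frag h (frag_of p)) = scale_frag (g * h) (frag_of p)" for p
    by (cases p) (simp add: mult.assoc)
qed (simp_all add: scale_frag_diff)

lemma tau_frag_scale_frag: "tau_frag (scale_frag g x) = scale_frag (twist g) (tau_frag x)"
proof (rule frag_induction[of x UNIV])
  show "tau_frag (scale_frag g (frag_of p)) = scale_frag (twist g) (tau_frag (frag_of p))" for p
    by (cases p) (simp add: twist_mult)
qed (simp_all add: scale_frag_diff tau_frag_diff)

lemma scale_frag_add_left: "scale_frag (g + h) x - (scale_frag g x + scale_frag h x) \<in> null"
proof (rule frag_induction[of x UNIV])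
  fix p :: "'k fls \<times> 'm"
  obtain f m where p: "p = (f, m)" by (cases p)
  show "scale_frag (g + h) (frag_of p) - (scale_frag g (frag_of p) + scale_frag h (frag_of p)) \<in> null"
    using tensor_null.add_left[of "g * f" "h * f" m "\<lambda>f p. f * poly_to_laurent p"]
    by (simp add: p distrib_right diff_diff_eq)
next
  fix x y
  assume "scale_frag (g + h) x - (scale_frag g x + scale_frag h x) \<in> null"
    "scale_frag (g + h) y - (scale_frag g y + scale_frag h y) \<in> null"
  from tensor_null.diff[OF this]
  show "scale_frag (g + h) (x - y) - (scale_frag g (x - y) + scale_frag h (x - y)) \<in> null"
    by (simp add: scale_frag_diff algebra_simps)
qed (simp_all add: tensor_null.zero)

lemma frag_of_0_left: "frag_of (0, m) \<in> null"
  using null_uminus[OF tensor_null.add_left[of 0 0 m "\<lambda>f p. f * poly_to_laurent p" "\<lambda>p. act (poly_to_skew p)"]] by simp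

lemma scale_frag_0_left: "scale_frag 0 x \<in> null"
proof (rule frag_induction[of x UNIV])
  show "scale_frag 0 (frag_of p) \<in> null" for p
    by (cases p) (simp add: frag_of_0_left)
qed (simp_all add: tensor_null.zero tensor_null.diff scale_frag_diff)

lemma scale_frag_sum_left: "scale_frag (\<Sum>i\<in>A. g i) x - (\<Sum>i\<in>A. scale_frag (g i) x) \<in> null"
proof (induction A rule: infinite_finite_induct)
  case (insert i A)
  from null_add[OF scale_frag_add_left[of "g i" "\<Sum>i\<in>A. g i" x] insert.IH]
  show ?case using insert.hyps by (simp add: algebra_simps)
qed (simp_all add: scale_frag_0_left)

lemma tau_frag_pow_0 [simp]: "(tau_frag ^^ v) 0 = 0"
  by (induction v) simp_all

lemma tau_frag_pow_diff: "(tau_frag ^^ v) (x - y) = (tau_frag ^^ v) x - (tau_frag ^^ v) y"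
  by (induction v) (simp_all add: tau_frag_diff)

lemma tau_frag_pow_sum: "(tau_frag ^^ v) (\<Sum>i\<in>A. f i) = (\<Sum>i\<in>A. (tau_frag ^^ v) (f i))"
proof (induction A rule: infinite_finite_induct)
  case (insert i A)
  have "(tau_frag ^^ v) (f i + (\<Sum>i\<in>A. f i)) = (tau_frag ^^ v) (f i - (0 - (\<Sum>i\<in>A. f i)))" by simp
  also have "\<dots> = (tau_frag ^^ v) (f i) + (tau_frag ^^ v) (\<Sum>i\<in>A. f i)"
    unfolding tau_frag_pow_diff by simp
  finally show ?case using insert by simp
qed simp_all

lemma tau_frag_pow_null: "x \<in> null \<Longrightarrow> (tau_frag ^^ v) x \<in> null"
  by (induction v) (simp_all add: tau_frag_null)

lemma tau_frag_pow_scale_frag: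
  "(tau_frag ^^ v) (scale_frag g x) = scale_frag ((twist ^^ v) g) ((tau_frag ^^ v) x)"
  by (induction v) (simp_all add: tau_frag_scale_frag)

lemma twist_pow_shift: "(twist ^^ v) (fls_shift k f) = fls_shift k ((twist ^^ v) f)"
  by (induction v) (simp_all add: twist_shift)

lemma twist_pow_eq_0_iff: "(twist ^^ v) f = 0 \<longleftrightarrow> f = 0"
  by (induction v) (simp_all add: twist_eq_0_iff)

lemma twist_pow_diff: "(twist ^^ v) (f - g) = (twist ^^ v) f - (twist ^^ v) g"
proof (induction v)
  case (Suc v)
  have "twist (f - g) = twist f - twist g" for f g
    using twist_add[of "f - g" g] by simp
  then show ?case by (simp add: Suc)
qed simp

definition embed :: "'m \<Rightarrow> ('k fls \<times> 'm \<Rightarrow>\<^sub>0 int)" where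
  "embed m = frag_of (1, m)"

lemma embed_add: "embed (m + m') - (embed m + embed m') \<in> null"
  using tensor_null.add_right[of 1 m m' "\<lambda>f p. f * poly_to_laurent p" "\<lambda>p. act (poly_to_skew p)"]
  by (simp add: embed_def diff_diff_eq)

lemma embed_poly: "embed (act (poly_to_skew p) m) - scale_frag (poly_to_laurent p) (embed m) \<in> null"
  using null_uminus[OF tensor_null.balanced[of "\<lambda>f p. f * poly_to_laurent p" 1 p m "\<lambda>p. act (poly_to_skew p)"]]
  by (simp add: embed_def)

lemma tau_frag_pow_embed: "(tau_frag ^^ v) (embed m) = embed ((act_tau ^^ v) m)"
  by (induction v) (simp_all add: embed_def)

end

section \<open>The lattice of a pure motive in coordinates\<close>

context frobenius_skew_module
begin

definition frag_combination ::
    "nat \<Rightarrow> (nat \<Rightarrow> 'k fls \<times> 'm \<Rightarrow>\<^sub>0 int) \<Rightarrow> (nat \<Rightarrow> 'k fls) \<Rightarrow> ('k fls \<times> 'm \<Rightarrow>\<^sub>0 int)" where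
  "frag_combination n \<beta> c = (\<Sum>i<n. scale_frag (c i) (\<beta> i))"

lemma completion_lincomb_class:
  assumes "\<And>i. i < n \<Longrightarrow> b i = tensor_class (\<beta> i)"
  shows "completion_lincomb act c b n = tensor_class (frag_combination n \<beta> c)"
  using assms
proof (induction n)
  case 0
  then show ?case by (simp add: completion_zero_eq frag_combination_def)
next
  case (Suc n)
  then show ?case
    by (simp add: completion_scale_tensor_class completion_add_class frag_combination_def)
qed

lemma purity_exponents_frag:
  assumes "purity_exponents q act u v"
  shows "\<exists>n \<beta>. (\<forall>x. \<exists>c. x - frag_combination n \<beta> c \<in> null) \<and>
    (\<forall>c. frag_combination n \<beta> c \<in> null \<longrightarrow> (\<forall>i<n. c i = 0)) \<and>
    (\<forall>c. (\<forall>i<n. c i \<in> range fps_to_fls) \<longrightarrow> (\<exists>c'. (\<forall>i<n. c' i \<in> range fps_to_fls) \<and>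
       scale_frag (fls_X_inv ^ u) (frag_combination n \<beta> c) -
       (tau_frag ^^ v) (frag_combination n \<beta> c') \<in> null)) \<and>
    (\<forall>c. (\<forall>i<n. c i \<in> range fps_to_fls) \<longrightarrow> (\<exists>c'. (\<forall>i<n. c' i \<in> range fps_to_fls) \<and>
       (tau_frag ^^ v) (frag_combination n \<beta> c) -
       scale_frag (fls_X_inv ^ u) (frag_combination n \<beta> c') \<in> null))"
proof -
  obtain L where L: "is_lattice act L"
    "completion_scale act (fls_X_inv ^ u) ` L = (completion_tau q act ^^ v) ` L"
    using assms unfolding purity_exponents_def by blast
  obtain n b where basis: "completion_basis act n b"
    and Lb: "L = {completion_lincomb act c b n | c. \<forall>i<n. c i \<in> range fps_to_fls}"
    using L(1) unfolding is_lattice_def by blast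
  have mem: "\<And>i. i < n \<Longrightarrow> b i \<in> range tensor_class"
    and gen: "\<And>X. X \<in> range tensor_class \<Longrightarrow> \<exists>c. X = completion_lincomb act c b n"
    and ind: "\<And>c. completion_lincomb act c b n = tensor_class 0 \<Longrightarrow> \<forall>i<n. c i = 0"
    using basis unfolding completion_basis_def completion_eq_range completion_zero_eq by blast+
  have "\<forall>i\<in>{..<n}. \<exists>x. b i = tensor_class x"
    using mem by (simp add: image_iff)
  then obtain \<beta> where "\<forall>i\<in>{..<n}. b i = tensor_class (\<beta> i)" unfolding bchoice_iff by blast
  then have \<beta>: "completion_lincomb act c b n = tensor_class (frag_combination n \<beta> c)" for c
    by (intro completion_lincomb_class) simp
  have "\<exists>c. x - frag_combination n \<beta> c \<in> null" for x
    using gen[of "tensor_class x"] unfolding \<beta> tensor_class_eq_iff by simp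
  moreover have "\<forall>i<n. c i = 0" if c: "frag_combination n \<beta> c \<in> null" for c
  proof -
    have "tensor_class (frag_combination n \<beta> c) = tensor_class 0"
      using c by (simp add: tensor_class_eq_iff)
    then show ?thesis by (intro ind) (simp only: \<beta>)
  qed
  moreover have "\<exists>c'. (\<forall>i<n. c' i \<in> range fps_to_fls) \<and>
       scale_frag (fls_X_inv ^ u) (frag_combination n \<beta> c) -
       (tau_frag ^^ v) (frag_combination n \<beta> c') \<in> null" if c: "\<forall>i<n. c i \<in> range fps_to_fls" for c
  proof -
    have "tensor_class (scale_frag (fls_X_inv ^ u) (frag_combination n \<beta> c)) \<in>
        completion_scale act (fls_X_inv ^ u) ` L"
      unfolding completion_scale_tensor_class[symmetric] Lb \<beta> using c by blast
    then obtain X where X: "X \<in> L" and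
      eq: "tensor_class (scale_frag (fls_X_inv ^ u) (frag_combination n \<beta> c)) =
        (completion_tau q act ^^ v) X"
      unfolding L(2) by (rule imageE)
    from X obtain c' where c': "\<forall>i<n. c' i \<in> range fps_to_fls"
      "X = tensor_class (frag_combination n \<beta> c')" unfolding Lb \<beta> by blast
    show ?thesis
      using eq c'(1) unfolding c'(2) completion_tau_pow_tensor_class tensor_class_eq_iff by blast
  qed
  moreover have "\<exists>c'. (\<forall>i<n. c' i \<in> range fps_to_fls) \<and>
       (tau_frag ^^ v) (frag_combination n \<beta> c) -
       scale_frag (fls_X_inv ^ u) (frag_combination n \<beta> c') \<in> null"
    if c: "\<forall>i<n. c i \<in> range fps_to_fls" for c
  proof -
    have "tensor_class ((tau_frag ^^ v) (frag_combination n \<beta> c)) \<in> (completion_tau q act ^^ v) ` L"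
      unfolding completion_tau_pow_tensor_class[symmetric] Lb \<beta> using c by blast
    then obtain X where X: "X \<in> L" and
      eq: "tensor_class ((tau_frag ^^ v) (frag_combination n \<beta> c)) =
        completion_scale act (fls_X_inv ^ u) X"
      unfolding L(2)[symmetric] by (rule imageE)
    from X obtain c' where c': "\<forall>i<n. c' i \<in> range fps_to_fls"
      "X = tensor_class (frag_combination n \<beta> c')" unfolding Lb \<beta> by blast
    show ?thesis
      using eq c'(1) unfolding c'(2) completion_scale_tensor_class tensor_class_eq_iff by blast
  qed
  ultimately show ?thesis by blast
qed

lemma scale_frag_combination:
  "scale_frag g (frag_combination n \<beta> c) = frag_combination n \<beta> (\<lambda>i. g * c i)"
  by (simp add: frag_combination_def scale_frag_sum scale_frag_scale_frag)

lemma frag_combination_add: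
  "frag_combination n \<beta> (\<lambda>i. c i + c' i) - (frag_combination n \<beta> c + frag_combination n \<beta> c') \<in> null"
proof -
  have "frag_combination n \<beta> (\<lambda>i. c i + c' i) - (frag_combination n \<beta> c + frag_combination n \<beta> c') =
      (\<Sum>i<n. scale_frag (c i + c' i) (\<beta> i) - (scale_frag (c i) (\<beta> i) + scale_frag (c' i) (\<beta> i)))"
    by (simp add: frag_combination_def sum_subtractf sum.distrib)
  also have "\<dots> \<in> null" by (intro null_sum scale_frag_add_left)
  finally show ?thesis .
qed

lemma null_trans: "x - y \<in> null \<Longrightarrow> y - z \<in> null \<Longrightarrow> x - z \<in> null"
  using null_add[of "x - y" "y - z"] by simp

lemma null_sym: "x - y \<in> null \<Longrightarrow> y - x \<in> null"
  using null_uminus[of "x - y"] by simp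

lemma null_add_cong: "x - x' \<in> null \<Longrightarrow> y - y' \<in> null \<Longrightarrow> (x + y) - (x' + y') \<in> null"
  using null_add[of "x - x'" "y - y'"] by (simp add: algebra_simps)

lemma frag_combination_unique:
  assumes ind: "\<And>c. frag_combination n \<beta> c \<in> null \<Longrightarrow> \<forall>i<n. c i = 0"
    and eq: "frag_combination n \<beta> c - frag_combination n \<beta> c' \<in> null" and i: "i < n"
  shows "c i = c' i"
proof -
  have "frag_combination n \<beta> c - (frag_combination n \<beta> (\<lambda>i. c i - c' i) + frag_combination n \<beta> c') \<in> null"
    using frag_combination_add[of n \<beta> "\<lambda>i. c i - c' i" c'] by simp
  from tensor_null.diff[OF eq this] have "frag_combination n \<beta> (\<lambda>i. c i - c' i) \<in> null" by simp
  then show ?thesis using ind i by fastforce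
qed

text \<open>
  If \<open>B\<close> is the matrix of \<open>\<tau>\<^sup>v\<close> with respect to \<open>\<beta>\<close>, then \<open>\<tau>\<^sup>v\<close> acts on coordinate rows by twisting
  them \<open>v\<close> times and multiplying by \<open>B\<close>.
\<close>

lemma tau_frag_pow_combination:
  assumes B: "\<And>i. i < n \<Longrightarrow> (tau_frag ^^ v) (\<beta> i) - frag_combination n \<beta> (B i) \<in> null"
  shows "(tau_frag ^^ v) (frag_combination n \<beta> c) -
    frag_combination n \<beta> (\<lambda>j. \<Sum>i<n. (twist ^^ v) (c i) * B i j) \<in> null"
proof -
  let ?d = "\<lambda>i. (twist ^^ v) (c i)"
  have eq: "(tau_frag ^^ v) (frag_combination n \<beta> c) = (\<Sum>i<n. scale_frag (?d i) ((tau_frag ^^ v) (\<beta> i)))"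
    by (simp add: frag_combination_def tau_frag_pow_sum tau_frag_pow_scale_frag)
  have "(\<Sum>i<n. scale_frag (?d i) ((tau_frag ^^ v) (\<beta> i) - frag_combination n \<beta> (B i))) \<in> null"
    using B by (intro null_sum scale_frag_null) simp
  then have 1: "(tau_frag ^^ v) (frag_combination n \<beta> c) -
      (\<Sum>i<n. scale_frag (?d i) (frag_combination n \<beta> (B i))) \<in> null"
    by (simp add: eq scale_frag_diff sum_subtractf)
  have "(\<Sum>j<n. scale_frag (\<Sum>i<n. ?d i * B i j) (\<beta> j) - (\<Sum>i<n. scale_frag (?d i * B i j) (\<beta> j))) \<in> null"
    by (intro null_sum scale_frag_sum_left)
  moreover have "(\<Sum>j<n. \<Sum>i<n. scale_frag (?d i * B i j) (\<beta> j)) =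
      (\<Sum>i<n. scale_frag (?d i) (frag_combination n \<beta> (B i)))"
  proof -
    have "(\<Sum>j<n. \<Sum>i<n. scale_frag (?d i * B i j) (\<beta> j)) =
        (\<Sum>i<n. frag_combination n \<beta> (\<lambda>j. ?d i * B i j))"
      unfolding frag_combination_def by (rule sum.swap)
    then show ?thesis by (simp only: scale_frag_combination)
  qed
  ultimately have "frag_combination n \<beta> (\<lambda>j. \<Sum>i<n. ?d i * B i j) -
      (\<Sum>i<n. scale_frag (?d i) (frag_combination n \<beta> (B i))) \<in> null"
    by (simp add: frag_combination_def sum_subtractf)
  from null_trans[OF 1 null_sym[OF this]] show ?thesis .
qed

text \<open>
  A \<open>K[t]\<close>-linear map \<open>\<phi>\<close> from \<open>M\<close> to \<open>K[t]\<close> extends to the completion by \<open>f \<otimes> m \<mapsto> f \<phi>(m)\<close>.  These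
  functionals detect nonzero elements of \<open>M\<close> in the completion.
\<close>

definition frag_functional :: "('m \<Rightarrow> 'k poly) \<Rightarrow> ('k fls \<times> 'm \<Rightarrow>\<^sub>0 int) \<Rightarrow> 'k fls" where
  "frag_functional \<phi> x = (\<Sum>p\<in>Poly_Mapping.keys x.
     of_int (Poly_Mapping.lookup x p) * (fst p * poly_to_laurent (\<phi> (snd p))))"

lemma frag_functional_superset:
  assumes "finite A" "Poly_Mapping.keys x \<subseteq> A"
  shows "frag_functional \<phi> x = (\<Sum>p\<in>A.
     of_int (Poly_Mapping.lookup x p) * (fst p * poly_to_laurent (\<phi> (snd p))))"
  unfolding frag_functional_def using assms
  by (intro sum.mono_neutral_left) (auto simp: in_keys_iff)

lemma frag_functional_diff: "frag_functional \<phi> (x - y) = frag_functional \<phi> x - frag_functional \<phi> y"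
proof -
  let ?A = "Poly_Mapping.keys x \<union> Poly_Mapping.keys y"
  have "Poly_Mapping.keys (x - y) \<subseteq> ?A" by (auto simp: in_keys_iff lookup_minus)
  then show ?thesis
    by (simp add: frag_functional_superset[of ?A] lookup_minus left_diff_distrib sum_subtractf)
qed

lemma frag_functional_0 [simp]: "frag_functional \<phi> 0 = 0"
  by (simp add: frag_functional_def)

lemma frag_functional_of [simp]: "frag_functional \<phi> (frag_of (f, m)) = f * poly_to_laurent (\<phi> m)"
  by (simp add: frag_functional_def)

lemma frag_functional_sum: "frag_functional \<phi> (\<Sum>i\<in>A. x i) = (\<Sum>i\<in>A. frag_functional \<phi> (x i))"
proof (induction A rule: infinite_finite_induct)
  case (insert i A)
  have "frag_functional \<phi> (x i + (\<Sum>i\<in>A. x i)) = frag_functional \<phi> (x i - (0 - (\<Sum>i\<in>A. x i)))" by simp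
  also have "\<dots> = frag_functional \<phi> (x i) + frag_functional \<phi> (\<Sum>i\<in>A. x i)"
    unfolding frag_functional_diff by simp
  finally show ?case using insert by simp
qed simp_all

lemma frag_functional_scale: "frag_functional \<phi> (scale_frag g x) = g * frag_functional \<phi> x"
proof (rule frag_induction[of x UNIV])
  show "frag_functional \<phi> (scale_frag g (frag_of p)) = g * frag_functional \<phi> (frag_of p)" for p
    by (cases p) (simp add: mult.assoc)
qed (simp_all add: scale_frag_diff frag_functional_diff right_diff_distrib)

lemma frag_functional_null:
  assumes add: "\<And>m m'. \<phi> (m + m') = \<phi> m + \<phi> m'"
    and mult: "\<And>p m. \<phi> (act (poly_to_skew p) m) = p * \<phi> m"
  shows "x \<in> null \<Longrightarrow> frag_functional \<phi> x = 0"
  by (induction rule: tensor_null.induct)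
    (simp_all add: frag_functional_diff add mult poly_to_laurent_add poly_to_laurent_mult
      distrib_left distrib_right mult.assoc)

lemma t_basis_coordinates:
  assumes "is_basis_over t_subring act r e"
  shows "\<exists>\<phi>. (\<forall>k m m'. \<phi> k (m + m') = \<phi> k m + \<phi> k m') \<and>
    (\<forall>k p m. \<phi> k (act (poly_to_skew p) m) = p * \<phi> k m) \<and>
    (\<forall>m. (\<forall>k<r. \<phi> k m = 0) \<longrightarrow> m = (0::'m))"
proof -
  have ex: "\<exists>p. m = (\<Sum>k<r. act (poly_to_skew (p k)) (e k)) \<and> (\<forall>k\<ge>r. p k = 0)" for m
  proof -
    obtain f where f: "\<forall>k<r. f k \<in> t_subring" "m = (\<Sum>k<r. act (f k) (e k))"
      using assms unfolding is_basis_over_def by blast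
    then have "\<forall>k\<in>{..<r}. \<exists>p. f k = poly_to_skew p" by (auto simp: t_subring_def)
    then obtain p where p: "\<forall>k\<in>{..<r}. f k = poly_to_skew (p k)" unfolding bchoice_iff by blast
    let ?p = "\<lambda>k. if k < r then p k else 0"
    have "m = (\<Sum>k<r. act (poly_to_skew (?p k)) (e k))"
      unfolding f(2) by (rule sum.cong) (simp_all add: p)
    then show ?thesis by (intro exI[of _ ?p]) simp
  qed
  then have "\<forall>m. \<exists>p. m = (\<Sum>k<r. act (poly_to_skew (p k)) (e k)) \<and> (\<forall>k\<ge>r. p k = 0)" by blast
  then obtain \<psi> where \<psi>: "\<forall>m. m = (\<Sum>k<r. act (poly_to_skew (\<psi> m k)) (e k)) \<and> (\<forall>k\<ge>r. \<psi> m k = 0)"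
    unfolding choice_iff by blast
  have \<psi>1: "(\<Sum>k<r. act (poly_to_skew (\<psi> m k)) (e k)) = m" for m using \<psi> by metis
  have skew_0: "p = 0" if "poly_to_skew p = 0" for p :: "'k poly"
  proof (rule poly_eqI)
    fix j
    have "Poly_Mapping.lookup (poly_to_skew p) (0, j) =
        (\<Sum>i\<le>degree p. if i = j then coeff p j else 0)"
      unfolding poly_to_skew_def lookup_sum by (rule sum.cong) (auto simp: lookup_single when_def)
    also have "\<dots> = coeff p j" by (simp add: coeff_eq_0)
    finally show "coeff p j = coeff 0 j" using that by simp
  qed
  have uniq: "p k = p' k"
    if eq: "(\<Sum>k<r. act (poly_to_skew (p k)) (e k)) = (\<Sum>k<r. act (poly_to_skew (p' k)) (e k))"
      and zero: "\<forall>k\<ge>r. p k = 0" "\<forall>k\<ge>r. p' k = 0" for p p' k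
  proof (cases "k < r")
    case True
    have "act (poly_to_skew (p k)) x = act (poly_to_skew (p k - p' k)) x + act (poly_to_skew (p' k)) x" for k x
      using act_poly_to_skew_add_left[of "p k - p' k" "p' k" x] by simp
    then have "(\<Sum>k<r. act (poly_to_skew (p k - p' k)) (e k)) = 0"
      using eq by (simp add: sum.distrib)
    moreover have "\<forall>k<r. poly_to_skew (p k - p' k) \<in> t_subring" by (simp add: t_subring_def)
    ultimately have "\<forall>k<r. poly_to_skew (p k - p' k) = 0"
      using assms[unfolded is_basis_over_def, THEN conjunct2, rule_format, of "\<lambda>k. poly_to_skew (p k - p' k)"]
      by blast
    then show ?thesis using skew_0[of "p k - p' k"] True by simp
  qed (use zero in simp)
  define \<phi> where "\<phi> k m = \<psi> m k" for k m
  have "\<phi> k (m + m') = \<phi> k m + \<phi> k m'" for k m m'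
    unfolding \<phi>_def
  proof (rule uniq[of "\<psi> (m + m')" "\<lambda>k. \<psi> m k + \<psi> m' k"])
    show "(\<Sum>k<r. act (poly_to_skew (\<psi> (m + m') k)) (e k)) =
        (\<Sum>k<r. act (poly_to_skew (\<psi> m k + \<psi> m' k)) (e k))"
      by (simp add: \<psi>1 act_poly_to_skew_add_left sum.distrib)
  qed (use \<psi> in auto)
  moreover have "\<phi> k (act (poly_to_skew p) m) = p * \<phi> k m" for k p m
    unfolding \<phi>_def
  proof (rule uniq[of "\<psi> (act (poly_to_skew p) m)" "\<lambda>k. p * \<psi> m k"])
    have act_sum_right: "act (poly_to_skew p) (\<Sum>k\<in>A. x k) = (\<Sum>k\<in>A. act (poly_to_skew p) (x k))"
      for A :: "nat set" and x
    proof (induction A rule: infinite_finite_induct)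
      case empty
      show ?case using act_add_right[of "poly_to_skew p" 0 0] by simp
    next
      case (infinite A)
      then show ?case using act_add_right[of "poly_to_skew p" 0 0] by simp
    qed (simp add: act_add_right)
    show "(\<Sum>k<r. act (poly_to_skew (\<psi> (act (poly_to_skew p) m) k)) (e k)) =
        (\<Sum>k<r. act (poly_to_skew (p * \<psi> m k)) (e k))"
      by (simp only: \<psi>1 act_poly_to_skew_mult flip: act_sum_right)
  qed (use \<psi> in auto)
  moreover have "m = 0" if "\<forall>k<r. \<phi> k m = 0" for m
  proof -
    have "(\<Sum>k<r. act (poly_to_skew (\<psi> m k)) (e k)) = 0"
      using that by (intro sum.neutral) (simp add: \<phi>_def)
    then show ?thesis by (simp add: \<psi>1)
  qed
  ultimately show ?thesis by (intro exI[of _ \<phi>]) simp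
qed

end

locale motive_skew_module = frobenius_skew_module q act
  for q :: nat and act :: "'k::alg_closed_field skew \<Rightarrow> 'm::ab_group_add \<Rightarrow> 'm" +
  assumes free_tau: "\<exists>d. free_of_rank tau_subring act d"
    and free_t: "\<exists>r. free_of_rank t_subring act r"
begin

sublocale cofinite_frobenius_space act_const q act_tau act_t
proof
  show "\<exists>Y. finite Y \<and> (\<forall>x. \<exists>y. x - act_tau y \<in> span Y)"
    using free_tau tau_basis_cofinite unfolding free_of_rank_def is_basis_over_tau_subring_iff by blast
  show "\<exists>Y. finite Y \<and> (\<forall>x. \<exists>y. x - act_t y \<in> span Y)"
    using free_t t_basis_cofinite unfolding free_of_rank_def by blast
qed

text \<open>
  Let \<open>\<beta>\<close> be a basis of the lattice, \<open>\<gamma> m\<close> the coordinate row of \<open>1 \<otimes> m\<close>, and \<open>M c\<close> the effect of \<open>\<tau>\<^sup>v\<close> on a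
  coordinate row \<open>c\<close>.  The subspace \<open>E c\<close> consists of the elements of the motive whose coordinates have
  poles of order at most \<open>c\<close>.  The inclusion of \<open>\<tau>\<^sup>v \<Lambda>\<close> in \<open>t\<^sup>u \<Lambda>\<close> bounds the pole order of \<open>\<tau>\<^sup>v m\<close> from
  above; the reverse inclusion together with the injectivity of \<open>M\<close> bounds it from below.
\<close>

theorem purity_exponents_imp_degree_filtration:
  assumes pure: "purity_exponents q act u v" and ns: "N * v = s * u"
  shows "\<exists>P. degree_filtration N s P"
proof -
  have uv: "0 < u" "0 < v" using pure by (simp_all add: purity_exponents_def)
  obtain n \<beta> where gen: "\<And>x. \<exists>c. x - frag_combination n \<beta> c \<in> null"
    and ind: "\<And>c. frag_combination n \<beta> c \<in> null \<Longrightarrow> \<forall>i<n. c i = 0"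
    and A: "\<And>c. \<forall>i<n. c i \<in> range fps_to_fls \<Longrightarrow> \<exists>c'. (\<forall>i<n. c' i \<in> range fps_to_fls) \<and>
       scale_frag (fls_X_inv ^ u) (frag_combination n \<beta> c) -
       (tau_frag ^^ v) (frag_combination n \<beta> c') \<in> null"
    and B: "\<And>c. \<forall>i<n. c i \<in> range fps_to_fls \<Longrightarrow> \<exists>c'. (\<forall>i<n. c' i \<in> range fps_to_fls) \<and>
       (tau_frag ^^ v) (frag_combination n \<beta> c) -
       scale_frag (fls_X_inv ^ u) (frag_combination n \<beta> c') \<in> null"
    using purity_exponents_frag[OF pure] by blast
  have uniq: "c i = c' i"
    if "frag_combination n \<beta> c - frag_combination n \<beta> c' \<in> null" "i < n" for c c' i
    by (rule frag_combination_unique[OF _ that]) (rule ind)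
  have "\<forall>i. \<exists>c. (tau_frag ^^ v) (\<beta> i) - frag_combination n \<beta> c \<in> null" using gen by blast
  then obtain b where b: "\<And>i. (tau_frag ^^ v) (\<beta> i) - frag_combination n \<beta> (b i) \<in> null"
    unfolding choice_iff by blast
  define M where "M c j = (\<Sum>i<n. (twist ^^ v) (c i) * b i j)" for c j
  have tau_M: "(tau_frag ^^ v) (frag_combination n \<beta> c) - frag_combination n \<beta> (M c) \<in> null" for c
    unfolding M_def by (rule tau_frag_pow_combination) (rule b)
  have M_shift: "M (\<lambda>i. fls_shift k (c i)) j = fls_shift k (M c j)" for c k j
  proof -
    have "fls_shift k (\<Sum>i\<in>A. f i) = (\<Sum>i\<in>A. fls_shift k (f i))" for A :: "nat set" and f :: "nat \<Rightarrow> 'k fls"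
      by (induction A rule: infinite_finite_induct) simp_all
    then show ?thesis
      by (simp add: M_def twist_pow_shift fls_shifted_times_simps)
  qed
  have scale_shift: "fls_X_inv ^ u * f = fls_shift (int u) f" for f :: "'k fls"
    by (rule fls_X_inv_power_times_conv_shift)
  have A': "\<exists>c'. (\<forall>i<n. \<forall>j<0. fls_nth (c' i) j = 0) \<and> (\<forall>i<n. fls_shift (int u) (c i) = M c' i)"
    if c: "\<forall>i<n. \<forall>j<0. fls_nth (c i) j = 0" for c
  proof -
    obtain c' where c': "\<forall>i<n. c' i \<in> range fps_to_fls" and
      eq: "scale_frag (fls_X_inv ^ u) (frag_combination n \<beta> c) -
        (tau_frag ^^ v) (frag_combination n \<beta> c') \<in> null"
      using A[of c] c unfolding range_fps_to_fls_iff by blast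
    have "frag_combination n \<beta> (\<lambda>i. fls_X_inv ^ u * c i) - frag_combination n \<beta> (M c') \<in> null"
      using null_trans[OF eq tau_M] by (simp only: scale_frag_combination)
    from uniq[OF this] have "\<forall>i<n. fls_X_inv ^ u * c i = M c' i" by blast
    then show ?thesis using c' unfolding range_fps_to_fls_iff scale_shift by blast
  qed
  have B': "\<exists>c'. (\<forall>i<n. \<forall>j<0. fls_nth (c' i) j = 0) \<and> (\<forall>i<n. M c i = fls_shift (int u) (c' i))"
    if c: "\<forall>i<n. \<forall>j<0. fls_nth (c i) j = 0" for c
  proof -
    obtain c' where c': "\<forall>i<n. c' i \<in> range fps_to_fls" and
      eq: "(tau_frag ^^ v) (frag_combination n \<beta> c) -
        scale_frag (fls_X_inv ^ u) (frag_combination n \<beta> c') \<in> null"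
      using B[of c] c unfolding range_fps_to_fls_iff by blast
    have "frag_combination n \<beta> (M c) - frag_combination n \<beta> (\<lambda>i. fls_X_inv ^ u * c' i) \<in> null"
      using null_trans[OF null_sym[OF tau_M] eq] by (simp only: scale_frag_combination)
    from uniq[OF this] have "\<forall>i<n. M c i = fls_X_inv ^ u * c' i" by blast
    then show ?thesis using c' unfolding range_fps_to_fls_iff scale_shift by blast
  qed
  \<comment> \<open>As \<open>t\<^sup>u \<Lambda>\<close> is contained in \<open>\<tau>\<^sup>v \<Lambda>\<close>, the unit vectors are in the image of the matrix \<open>b\<close>, so \<open>b\<close> is
    invertible.\<close>
  have M_inj: "\<forall>i<n. d i = 0" if d: "\<forall>j<n. M d j = 0" for d
  proof -
    have "\<exists>y. \<forall>j<n. (\<Sum>i<n. fls_shift (- int u) ((twist ^^ v) (y i)) * b i j) = (if k = j then 1 else 0)" for k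
    proof -
      have "\<forall>i<n. \<forall>j<0. fls_nth (if k = i then 1 else 0 :: 'k fls) j = 0" by simp
      from A'[OF this] obtain y where y: "\<forall>i<n. fls_shift (int u) (if k = i then 1 else 0) = M y i"
        by blast
      have "(\<Sum>i<n. fls_shift (- int u) ((twist ^^ v) (y i)) * b i j) = (if k = j then 1 else 0)"
        if "j < n" for j
      proof -
        have "(\<Sum>i<n. fls_shift (- int u) ((twist ^^ v) (y i)) * b i j) =
            M (\<lambda>i. fls_shift (- int u) (y i)) j"
          by (simp add: M_def twist_pow_shift)
        also have "\<dots> = fls_shift (- int u) (fls_shift (int u) (if k = j then 1 else 0))"
          unfolding M_shift using y that by simp
        finally show ?thesis by (simp del: fls_shift_fls_shift add: fls_shift_fls_shift[of "- int u"])
      qed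
      then show ?thesis by blast
    qed
    then have "\<forall>k. \<exists>y. \<forall>j<n.
        (\<Sum>i<n. fls_shift (- int u) ((twist ^^ v) (y i)) * b i j) = (if k = j then 1 else 0)"
      by blast
    then obtain y where y: "\<forall>k. \<forall>j<n.
        (\<Sum>i<n. fls_shift (- int u) ((twist ^^ v) (y k i)) * b i j) = (if k = j then 1 else 0)"
      unfolding choice_iff by blast
    let ?a = "\<lambda>k i. fls_shift (- int u) ((twist ^^ v) (y k i))"
    have inv: "(\<Sum>j<n. b i j * ?a j l) = (if i = l then 1 else 0)" if "i < n" "l < n" for i l
      by (rule mat_inverse_commute[OF _ that]) (simp add: y)
    have "(twist ^^ v) (d l) = 0" if l: "l < n" for l
    proof -
      have "(twist ^^ v) (d l) = (\<Sum>i<n. (twist ^^ v) (d i) * (if i = l then 1 else 0))"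
        using l by (simp add: if_distrib[of "(*) _"] cong: if_cong)
      also have "\<dots> = (\<Sum>i<n. (twist ^^ v) (d i) * (\<Sum>j<n. b i j * ?a j l))"
        using l by (intro sum.cong) (simp_all add: inv)
      also have "\<dots> = (\<Sum>i<n. \<Sum>j<n. (twist ^^ v) (d i) * b i j * ?a j l)"
        by (simp add: sum_distrib_left mult.assoc)
      also have "\<dots> = (\<Sum>j<n. \<Sum>i<n. (twist ^^ v) (d i) * b i j * ?a j l)" by (rule sum.swap)
      also have "\<dots> = (\<Sum>j<n. M d j * ?a j l)" by (simp add: M_def sum_distrib_right)
      also have "\<dots> = 0" using d by simp
      finally show ?thesis .
    qed
    then show ?thesis by (simp add: twist_pow_eq_0_iff)
  qed
  have "\<forall>m. \<exists>c. embed m - frag_combination n \<beta> c \<in> null" using gen by blast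
  then obtain \<gamma> where \<gamma>: "\<And>m. embed m - frag_combination n \<beta> (\<gamma> m) \<in> null"
    unfolding choice_iff by blast
  have \<gamma>_add: "\<gamma> (m + m') i = \<gamma> m i + \<gamma> m' i" if i: "i < n" for m m' i
  proof (rule uniq[OF _ i, of "\<gamma> (m + m')" "\<lambda>i. \<gamma> m i + \<gamma> m' i"])
    show "frag_combination n \<beta> (\<gamma> (m + m')) - frag_combination n \<beta> (\<lambda>i. \<gamma> m i + \<gamma> m' i) \<in> null"
      by (rule null_trans[OF null_sym[OF \<gamma>] null_trans[OF embed_add
        null_trans[OF null_add_cong[OF \<gamma> \<gamma>] null_sym[OF frag_combination_add]]]])
  qed
  have \<gamma>_poly: "\<gamma> (act (poly_to_skew p) m) i = poly_to_laurent p * \<gamma> m i" if i: "i < n" for p m i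
  proof (rule uniq[OF _ i, of "\<gamma> (act (poly_to_skew p) m)" "\<lambda>i. poly_to_laurent p * \<gamma> m i"])
    have "scale_frag (poly_to_laurent p) (embed m) -
        scale_frag (poly_to_laurent p) (frag_combination n \<beta> (\<gamma> m)) \<in> null"
      using scale_frag_null[OF \<gamma>[of m], of "poly_to_laurent p"] by (simp add: scale_frag_diff)
    from null_trans[OF null_sym[OF \<gamma>] null_trans[OF embed_poly this]]
    show "frag_combination n \<beta> (\<gamma> (act (poly_to_skew p) m)) -
        frag_combination n \<beta> (\<lambda>i. poly_to_laurent p * \<gamma> m i) \<in> null"
      by (simp only: scale_frag_combination)
  qed
  have \<gamma>_tau: "\<gamma> ((act_tau ^^ v) m) i = M (\<gamma> m) i" if i: "i < n" for m i
  proof (rule uniq[OF _ i])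
    have "embed ((act_tau ^^ v) m) - (tau_frag ^^ v) (frag_combination n \<beta> (\<gamma> m)) \<in> null"
      using tau_frag_pow_null[OF \<gamma>[of m], of v] by (simp add: tau_frag_pow_diff tau_frag_pow_embed)
    from null_trans[OF null_sym[OF \<gamma>] null_trans[OF this tau_M]]
    show "frag_combination n \<beta> (\<gamma> ((act_tau ^^ v) m)) - frag_combination n \<beta> (M (\<gamma> m)) \<in> null" .
  qed
  have \<gamma>_scale: "\<gamma> (act_const a m) i = fls_const a * \<gamma> m i" if "i < n" for a m i
    using \<gamma>_poly[OF that, of "[:a:]" m] by (simp add: act_poly_to_skew_pCons poly_to_laurent_pCons
        tau_pow_simps(2)[of 1, simplified] t_pow_simps(2)[of 1, simplified])
  have \<gamma>_t: "\<gamma> (act_t m) i = fls_shift 1 (\<gamma> m i)" if "i < n" for m i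
    using \<gamma>_poly[OF that, of "[:0, 1:]" m] by (simp add: act_poly_to_skew_pCons poly_to_laurent_pCons
        t_pow_simps(2)[of 1, simplified] fls_X_inv_times_conv_shift)
  have \<gamma>_0: "\<gamma> 0 i = 0" if "i < n" for i
  proof -
    have "\<gamma> 0 i + 0 = \<gamma> 0 i + \<gamma> 0 i"
      using \<gamma>_add[OF that, of 0 0] by (simp only: add_0_left add_0_right)
    then show ?thesis by (rule add_left_imp_eq[symmetric])
  qed
  define E where "E c = {m. \<forall>i<n. \<forall>j<(- c). fls_nth (\<gamma> m i) j = 0}" for c :: int
  obtain r e where e: "is_basis_over t_subring act r e" using free_t unfolding free_of_rank_def by blast
  obtain \<phi> where \<phi>: "\<And>k m m'. \<phi> k (m + m') = \<phi> k m + \<phi> k m'"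
    "\<And>k p m. \<phi> k (act (poly_to_skew p) m) = p * \<phi> k m" "\<And>m. \<forall>k<r. \<phi> k m = 0 \<Longrightarrow> m = 0"
    using t_basis_coordinates[OF e] by blast
  \<comment> \<open>The functionals take values of bounded pole order on \<open>\<beta>\<close>.  For \<open>m\<close> in \<open>E (D - 1)\<close> the polynomial
    \<open>\<phi> k m\<close> is then divisible by \<open>1 / t\<close> as a power series in \<open>1 / t\<close>, and hence zero.\<close>
  have "\<exists>D. \<forall>k<r. \<forall>i<n. \<forall>j<D. fls_nth (frag_functional (\<phi> k) (\<beta> i)) j = 0"
  proof (induction r)
    case (Suc r)
    then obtain D where D: "\<forall>k<r. \<forall>i<n. \<forall>j<D. fls_nth (frag_functional (\<phi> k) (\<beta> i)) j = 0" by blast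
    obtain D' where "\<forall>i<n. \<forall>j<D'. fls_nth (frag_functional (\<phi> r) (\<beta> i)) j = 0"
      using fls_common_lower_bound[of n "\<lambda>i. frag_functional (\<phi> r) (\<beta> i)"] by blast
    then show ?case using D by (intro exI[of _ "min D D'"]) (auto simp: less_Suc_eq)
  qed simp
  then obtain D where D: "\<And>k i j. k < r \<Longrightarrow> i < n \<Longrightarrow> j < D \<Longrightarrow>
      fls_nth (frag_functional (\<phi> k) (\<beta> i)) j = 0" by blast
  show ?thesis
  proof (rule pole_filtration_imp_degree_filtration[OF _ _ _ _ _ _ uv ns])
    show "subspace (E c)" for c
    proof (rule subspaceI)
      show "0 \<in> E c" by (simp add: E_def \<gamma>_0)
      show "x + y \<in> E c" if "x \<in> E c" "y \<in> E c" for x y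
        using that by (simp add: E_def \<gamma>_add)
      show "act_const a x \<in> E c" if "x \<in> E c" for a x
        using that by (simp add: E_def \<gamma>_scale)
    qed
    show "x \<in> E (c + 1)" if "x \<in> E c" for c x using that by (simp add: E_def)
    show "\<exists>c. x \<in> E c" for x
    proof -
      obtain D where "\<forall>i<n. \<forall>j<D. fls_nth (\<gamma> x i) j = 0"
        using fls_common_lower_bound[of n "\<gamma> x"] by blast
      then show ?thesis by (intro exI[of _ "- D"]) (simp add: E_def)
    qed
    show "act_t x \<in> E (c + 1) \<longleftrightarrow> x \<in> E c" for c x
    proof -
      have "(\<forall>j<(- (c + 1)). fls_nth f (j + 1) = 0) \<longleftrightarrow> (\<forall>j<(- c). fls_nth f j = 0)" for f :: "'k fls"
      proof
        assume *: "\<forall>j<(- (c + 1)). fls_nth f (j + 1) = 0"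
        show "\<forall>j<(- c). fls_nth f j = 0"
        proof (intro allI impI)
          fix j assume "j < -c"
          then show "fls_nth f j = 0" using *[rule_format, of "j - 1"] by simp
        qed
      qed simp
      then show ?thesis by (simp add: E_def \<gamma>_t)
    qed
    show "(act_tau ^^ v) x \<in> E (c + int u) \<longleftrightarrow> x \<in> E c" for c x
    proof
      assume x: "x \<in> E c"
      let ?c = "\<lambda>i. fls_shift (- c) (\<gamma> x i)"
      have "\<forall>i<n. \<forall>j<0. fls_nth (?c i) j = 0" using x by (simp add: E_def)
      from B'[OF this] obtain c' where c': "\<forall>i<n. \<forall>j<0. fls_nth (c' i) j = 0"
        and eq: "\<forall>i<n. M ?c i = fls_shift (int u) (c' i)" by blast
      show "(act_tau ^^ v) x \<in> E (c + int u)"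
        unfolding E_def
      proof (intro CollectI allI impI)
        fix i j assume i: "i < n" and j: "j < - (c + int u)"
        have "fls_shift (- c) (\<gamma> ((act_tau ^^ v) x) i) = fls_shift (int u) (c' i)"
          using eq i by (simp add: \<gamma>_tau flip: M_shift)
        then have "fls_nth (fls_shift (- c) (\<gamma> ((act_tau ^^ v) x) i)) (j + c) =
            fls_nth (fls_shift (int u) (c' i)) (j + c)" by (rule arg_cong)
        also have "\<dots> = 0" using c' i j by simp
        finally show "fls_nth (\<gamma> ((act_tau ^^ v) x) i) j = 0" by simp
      qed
    next
      assume x: "(act_tau ^^ v) x \<in> E (c + int u)"
      let ?c = "\<lambda>i. fls_shift (- (c + int u)) (\<gamma> ((act_tau ^^ v) x) i)"
      have "\<forall>i<n. \<forall>j<0. fls_nth (?c i) j = 0" using x by (simp add: E_def)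
      from A'[OF this] obtain c' where c': "\<forall>i<n. \<forall>j<0. fls_nth (c' i) j = 0"
        and eq: "\<forall>i<n. fls_shift (int u) (?c i) = M c' i" by blast
      let ?d = "\<lambda>i. fls_shift (- c) (\<gamma> x i) - c' i"
      have "M ?d j = 0" if j: "j < n" for j
      proof -
        have "M ?d j = M (\<lambda>i. fls_shift (- c) (\<gamma> x i)) j - M c' j"
          by (simp add: M_def twist_pow_diff left_diff_distrib sum_subtractf)
        also have "M (\<lambda>i. fls_shift (- c) (\<gamma> x i)) j = fls_shift (- c) (\<gamma> ((act_tau ^^ v) x) j)"
          using j by (simp add: M_shift \<gamma>_tau)
        also have "M c' j = fls_shift (- c) (\<gamma> ((act_tau ^^ v) x) j)"
          using eq[rule_format, OF j] by simp
        finally show ?thesis by simp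
      qed
      then have "\<forall>j<n. M ?d j = 0" by blast
      then have "\<forall>i<n. ?d i = 0" by (rule M_inj)
      then have d: "fls_shift (- c) (\<gamma> x i) = c' i" if "i < n" for i using that by simp
      show "x \<in> E c"
        unfolding E_def
      proof (intro CollectI allI impI)
        fix i j assume i: "i < n" and j: "j < - c"
        have "fls_nth (\<gamma> x i) j = fls_nth (fls_shift (- c) (\<gamma> x i)) (j + c)" by simp
        also have "\<dots> = 0" using d[OF i] c' i j by simp
        finally show "fls_nth (\<gamma> x i) j = 0" .
      qed
    qed
    show "E (D - 1) = {0}"
    proof
      show "{0} \<subseteq> E (D - 1)" by (simp add: E_def \<gamma>_0)
      show "E (D - 1) \<subseteq> {0}"
      proof
        fix m assume m: "m \<in> E (D - 1)"
        have "\<phi> k m = 0" if k: "k < r" for k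
        proof (rule poly_eqI)
          fix j
          have "frag_functional (\<phi> k) (embed m - frag_combination n \<beta> (\<gamma> m)) = 0"
            by (rule frag_functional_null[OF \<phi>(1,2) \<gamma>])
          then have "poly_to_laurent (\<phi> k m) = (\<Sum>i<n. \<gamma> m i * frag_functional (\<phi> k) (\<beta> i))"
            by (simp add: frag_functional_diff embed_def frag_combination_def frag_functional_sum
                frag_functional_scale)
          then have "coeff (\<phi> k m) j = (\<Sum>i<n. fls_nth (\<gamma> m i * frag_functional (\<phi> k) (\<beta> i)) (- int j))"
            by (simp add: fls_nth_sum flip: nth_poly_to_laurent)
          also have "\<dots> = 0"
          proof (rule sum.neutral, rule ballI)
            fix i assume i: "i \<in> {..<n}"
            show "fls_nth (\<gamma> m i * frag_functional (\<phi> k) (\<beta> i)) (- int j) = 0"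
            proof (rule fls_mult_nth_eq_0_below)
              show "fls_nth (\<gamma> m i) l = 0" if "l < 1 - D" for l
                using m i that by (simp add: E_def)
              show "fls_nth (frag_functional (\<phi> k) (\<beta> i)) l = 0" if "l < D" for l
                using D k i that by simp
            qed simp
          qed
          finally show "coeff (\<phi> k m) j = coeff 0 j" by simp
        qed
        then show "m \<in> {0}" using \<phi>(3) by blast
      qed
    qed
  qed
qed

end

section \<open>Almost strictly pure bases\<close>

lemma motive_weight_eq:
  assumes pure: "purity_exponents q act u v"
    and unique: "\<And>u' v'. purity_exponents q act u' v' \<Longrightarrow> u * v' = u' * v"
  shows "motive_weight q act = of_nat u / of_nat v"
  unfolding motive_weight_def
proof (rule the_equality)
  show "\<exists>u' v'. purity_exponents q act u' v' \<and> (of_nat u / of_nat v :: rat) = of_nat u' / of_nat v'"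
    using pure by blast
  fix w :: rat assume "\<exists>u' v'. purity_exponents q act u' v' \<and> w = of_nat u' / of_nat v'"
  then obtain u' v' where uv': "purity_exponents q act u' v'" "w = of_nat u' / of_nat v'" by blast
  have "0 < v" "0 < v'" using pure uv'(1) by (simp_all add: purity_exponents_def)
  moreover have "of_nat u * of_nat v' = (of_nat u' * of_nat v :: rat)"
    using unique[OF uv'(1)] by (metis of_nat_mult)
  ultimately show "w = of_nat u / of_nat v" by (simp add: uv'(2) field_simps)
qed

theorem theorem1:
  fixes Fq :: "'k::alg_closed_field set" and q d :: nat and \<theta> :: 'k
    and act :: "'k skew \<Rightarrow> 'm::ab_group_add \<Rightarrow> 'm"
  assumes "finite_subfield Fq" and "card Fq = q"
    and "anderson_t_motive q \<theta> act"
    and "pure_motive q act"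
    and "free_of_rank tau_subring act d"
  shows "(\<exists>\<kappa>. is_basis_over tau_subring act d \<kappa> \<and> almost_strictly_pure act d \<kappa>) \<and>
    ((\<exists>\<kappa>. is_basis_over tau_subring act d \<kappa> \<and> strictly_pure act d \<kappa>) \<longleftrightarrow>
      1 / motive_weight q act \<in> \<int>)"
proof -
  interpret skew_module q act using assms(3) by (simp add: anderson_t_motive_def)
  interpret motive_skew_module q act
  proof
    show "2 \<le> q" using finite_subfield_card_ge_2[OF assms(1)] assms(2) by simp
    show "(a + b) ^ q = a ^ q + b ^ q" for a b :: 'k
      using finite_subfield_frobenius_add[OF assms(1)] assms(2) by simp
    show "\<exists>d. free_of_rank tau_subring act d" "\<exists>r. free_of_rank t_subring act r"
      using assms(3) by (simp_all add: anderson_t_motive_def)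
  qed
  obtain b where b: "tau_basis d b"
    using assms(5) unfolding free_of_rank_def is_basis_over_tau_subring_iff by blast
  obtain x :: 'm where x: "x \<noteq> 0" using assms(3) by (auto simp: anderson_t_motive_def)
  obtain u v where pure: "purity_exponents q act u v" using assms(4) unfolding pure_motive_def by blast
  have uv: "0 < u" "0 < v" using pure by (simp_all add: purity_exponents_def)
  obtain P where P: "degree_filtration u v P"
    using purity_exponents_imp_degree_filtration[OF pure, of u v] by (auto simp: mult.commute)
  have "u * v' = u' * v" if uv': "purity_exponents q act u' v'" for u' v'
  proof -
    obtain P' where "degree_filtration u' v' P'"
      using purity_exponents_imp_degree_filtration[OF uv', of u' v'] by (auto simp: mult.commute)
    then show ?thesis by (rule filtration_slope_unique[OF P _ x])
  qed
  then have weight: "motive_weight q act = of_nat u / of_nat v" by (rule motive_weight_eq[OF pure])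
  have basis: "\<exists>\<kappa> D. tau_basis d \<kappa> \<and> purity_equation d \<kappa> n s D"
    if Q: "degree_filtration n s Q" "1 \<le> s" for n s Q
  proof -
    obtain e \<kappa> D where \<kappa>: "tau_basis e \<kappa>" "purity_equation e \<kappa> n s D"
      using degree_filtration_imp_purity_equation[OF Q] by blast
    have "e = d" using tau_basis_rank_le[OF \<kappa>(1) b] tau_basis_rank_le[OF b \<kappa>(1)] by simp
    then show ?thesis using \<kappa> by blast
  qed
  have "\<exists>\<kappa>. is_basis_over tau_subring act d \<kappa> \<and> almost_strictly_pure act d \<kappa>"
  proof -
    have "1 \<le> u" "1 \<le> v" using uv by simp_all
    then show ?thesis
      using basis[OF P]
      unfolding almost_strictly_pure_def is_basis_over_tau_subring_iff strict_purity_equation_iff by blast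
  qed
  moreover have "(\<exists>\<kappa>. is_basis_over tau_subring act d \<kappa> \<and> strictly_pure act d \<kappa>) \<longleftrightarrow>
      1 / motive_weight q act \<in> \<int>"
  proof
    assume "\<exists>\<kappa>. is_basis_over tau_subring act d \<kappa> \<and> strictly_pure act d \<kappa>"
    then obtain \<kappa> s D where \<kappa>: "tau_basis d \<kappa>" "purity_equation d \<kappa> 1 s D"
      unfolding strictly_pure_def is_basis_over_tau_subring_iff strict_purity_equation_iff by blast
    obtain P' where "degree_filtration 1 s P'"
      using purity_equation_imp_degree_filtration[OF \<kappa>] by blast
    from filtration_slope_unique[OF P this x] have "v = u * s" by simp
    then have "1 / motive_weight q act = of_nat s" using uv by (simp add: weight)
    then show "1 / motive_weight q act \<in> \<int>" by simp
  next
    assume "1 / motive_weight q act \<in> \<int>"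
    then obtain k where k: "1 / motive_weight q act = of_int k" by (elim Ints_cases)
    have "(of_int (int v) :: rat) = of_int (k * int u)"
      using k uv by (simp add: weight field_simps)
    then have vk: "int v = k * int u" by (simp only: of_int_eq_iff)
    have "0 < k" using vk uv by (metis of_nat_0_less_iff zero_less_mult_pos2)
    then have "int v = int (nat k * u)" using vk by simp
    then have s: "v = nat k * u" "1 \<le> nat k" using \<open>0 < k\<close> by (simp_all only: of_nat_eq_iff)
    obtain Q where "degree_filtration 1 (nat k) Q"
      using purity_exponents_imp_degree_filtration[OF pure, of 1 "nat k"] s by auto
    from basis[OF this s(2)]
    show "\<exists>\<kappa>. is_basis_over tau_subring act d \<kappa> \<and> strictly_pure act d \<kappa>"
      unfolding strictly_pure_def is_basis_over_tau_subring_iff strict_purity_equation_iff by blast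
  qed
  ultimately show ?thesis by blast
qed

end
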